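(* Let $k$ be a field, $\mathcal C$ a Hom-finite Krull--Schmidt $k$-category, and $\Gamma$ a finite group whose order is not divisible by the characteristic of $k$, acting on $\mathcal C$. Then: 1. The category $\mathcal C\Gamma$ is $k$-additive, Hom-finite and Krull--Schmidt. 2. If $\mathcal C$ is abelian, then $\mathcal C\Gamma$ is also abelian. 3. If $\mathcal C$ is exact and if for all $g\in\Gamma$ the functor $\mathbf g\otimes-:\mathcal C\to\mathcal C$ is exact, then $\mathcal C\Gamma$ is exact, with admissible short exact sequences those of the form $0\to(X,\psi)\xrightarrow{f}(X',\psi')\xrightarrow{g}(X'',\psi'')\to0$ such that $0\to X\xrightarrow{f}X'\xrightarrow{g}X''\to0$ is an admissible short exact sequence in $\mathcal C$.
   Context: $k$-category means $k$-linear additive category; Krull--Schmidt means idempotents split and indecomposable objects have local endomorphism rings. An action of $\Gamma$ on $\mathcal C$ is a structure of module category over the monoidal category $\mathrm{mod}\,k(\Gamma)$, where $k(\Gamma)$ is the Hopf algebra of $k$-valued functions on $\Gamma$; its simple modules are denoted $\mathbf g$ ($g\in\Gamma$), with $\mathbf g\otimes\mathbf h=\mathbf{gh}$. So one has $k$-linear auto-equivalences $\mathbf g\otimes-$ of $\mathcal C$ and coherent natural structural isomorphisms $\alpha:\mathbf{gh}\otimes X\to\mathbf g\otimes(\mathbf h\otimes X)$ and $\mathbf 1\otimes X\to X$. The $\Gamma$-equivariant category $\mathcal C\Gamma$ has as objects the pairs $(X,\psi)$, $X\in\mathcal C$, $\psi=(\psi_g:\mathbf g\otimes X\to X)_{g\in\Gamma}$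 a family of isomorphisms such that $\psi_{gh}=\psi_g\circ(\mathrm{id}_{\mathbf g}\otimes\psi_h)\circ\alpha$ for all $g,h\in\Gamma$ and $\psi_e:\mathbf 1\otimes X\to X$ is the structural isomorphism. Morphisms $(X,\psi)\to(Y,\chi)$ are the morphisms $f:X\to Y$ of $\mathcal C$ with $f\circ\psi_g=\chi_g\circ(\mathrm{id}_{\mathbf g}\otimes f)$ for all $g$. "Exact" category is in the sense of Quillen. *)

theory Defs
  imports
    "Jordan_Normal_Form.Missing_VectorSpace"
    "HOL-Algebra.Multiplicative_Group"
begin

section \<open>Fields and rings\<close>

text \<open>The additive order of the unit element; \<^const>\<open>group.ord\<close> is \<open>0\<close> at elements of
  infinite order, as required for characteristic \<open>0\<close>.\<close>

definition ring_char :: "('k, 'r) ring_scheme \<Rightarrow> nat"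
  where "ring_char K = group.ord (add_monoid K) \<one>\<^bsub>K\<^esub>"

text \<open>Local rings, not necessarily commutative.\<close>

definition local_ring :: "('a, 'r) ring_scheme \<Rightarrow> bool"
  where "local_ring R \<longleftrightarrow> ring R \<and> \<one>\<^bsub>R\<^esub> \<noteq> \<zero>\<^bsub>R\<^esub> \<and>
    (\<forall>a \<in> carrier R - Units R. \<forall>b \<in> carrier R - Units R. a \<oplus>\<^bsub>R\<^esub> b \<in> carrier R - Units R)"


section \<open>Linear categories\<close>

text \<open>The morphism spaces \<open>homs C X Y\<close> are module records, of which the ring
  fields \<open>mult\<close> and \<open>one\<close> are ignored. They need not be disjoint for different pairs of objects,
  so composition carries its objects: \<open>cmp C X Y Z g f\<close> is the composite
  \<open>g \<circ> f\<close> of \<open>f : X \<rightarrow> Y\<close> and \<open>g : Y \<rightarrow> Z\<close>.\<close>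

record ('o, 'm, 'k) klin_cat =
  ob :: "'o set"
  homs :: "'o \<Rightarrow> 'o \<Rightarrow> ('k, 'm) module"
  idm :: "'o \<Rightarrow> 'm"
  cmp :: "'o \<Rightarrow> 'o \<Rightarrow> 'o \<Rightarrow> 'm \<Rightarrow> 'm \<Rightarrow> 'm"

abbreviation mor :: "('o, 'm, 'k) klin_cat \<Rightarrow> 'o \<Rightarrow> 'o \<Rightarrow> 'm set"
  where "mor C X Y \<equiv> carrier (homs C X Y)"

locale k_linear_category = field K
  for K :: "('k, 'r) ring_scheme" (structure) +
  fixes C :: "('o, 'm, 'k) klin_cat"
  assumes homs_vectorspace: "\<lbrakk>X \<in> ob C; Y \<in> ob C\<rbrakk> \<Longrightarrow> vectorspace K (homs C X Y)"
    and idm_mor: "X \<in> ob C \<Longrightarrow> idm C X \<in> mor C X X"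
    and cmp_mor: "\<lbrakk>X \<in> ob C; Y \<in> ob C; Z \<in> ob C; f \<in> mor C X Y; g \<in> mor C Y Z\<rbrakk>
      \<Longrightarrow> cmp C X Y Z g f \<in> mor C X Z"
    and cmp_idm_right: "\<lbrakk>X \<in> ob C; Y \<in> ob C; f \<in> mor C X Y\<rbrakk>
      \<Longrightarrow> cmp C X X Y f (idm C X) = f"
    and cmp_idm_left: "\<lbrakk>X \<in> ob C; Y \<in> ob C; f \<in> mor C X Y\<rbrakk>
      \<Longrightarrow> cmp C X Y Y (idm C Y) f = f"
    and cmp_assoc: "\<lbrakk>W \<in> ob C; X \<in> ob C; Y \<in> ob C; Z \<in> ob C;
        f \<in> mor C W X; g \<in> mor C X Y; h \<in> mor C Y Z\<rbrakk>
      \<Longrightarrow> cmp C W X Z (cmp C X Y Z h g) f = cmp C W Y Z h (cmp C W X Y g f)"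
    and cmp_add_left: "\<lbrakk>X \<in> ob C; Y \<in> ob C; Z \<in> ob C;
        f \<in> mor C X Y; g \<in> mor C Y Z; g' \<in> mor C Y Z\<rbrakk>
      \<Longrightarrow> cmp C X Y Z (g \<oplus>\<^bsub>homs C Y Z\<^esub> g') f
        = cmp C X Y Z g f \<oplus>\<^bsub>homs C X Z\<^esub> cmp C X Y Z g' f"
    and cmp_add_right: "\<lbrakk>X \<in> ob C; Y \<in> ob C; Z \<in> ob C;
        f \<in> mor C X Y; f' \<in> mor C X Y; g \<in> mor C Y Z\<rbrakk>
      \<Longrightarrow> cmp C X Y Z g (f \<oplus>\<^bsub>homs C X Y\<^esub> f')
        = cmp C X Y Z g f \<oplus>\<^bsub>homs C X Z\<^esub> cmp C X Y Z g f'"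
    and cmp_smult_left: "\<lbrakk>X \<in> ob C; Y \<in> ob C; Z \<in> ob C; c \<in> carrier K;
        f \<in> mor C X Y; g \<in> mor C Y Z\<rbrakk>
      \<Longrightarrow> cmp C X Y Z (c \<odot>\<^bsub>homs C Y Z\<^esub> g) f = c \<odot>\<^bsub>homs C X Z\<^esub> cmp C X Y Z g f"
    and cmp_smult_right: "\<lbrakk>X \<in> ob C; Y \<in> ob C; Z \<in> ob C; c \<in> carrier K;
        f \<in> mor C X Y; g \<in> mor C Y Z\<rbrakk>
      \<Longrightarrow> cmp C X Y Z g (c \<odot>\<^bsub>homs C X Y\<^esub> f) = c \<odot>\<^bsub>homs C X Z\<^esub> cmp C X Y Z g f"

definition is_iso :: "('o, 'm, 'k) klin_cat \<Rightarrow> 'o \<Rightarrow> 'o \<Rightarrow> 'm \<Rightarrow> bool"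
  where "is_iso C X Y f \<longleftrightarrow> f \<in> mor C X Y \<and>
    (\<exists>f' \<in> mor C Y X. cmp C X Y X f' f = idm C X \<and> cmp C Y X Y f f' = idm C Y)"

definition is_mono :: "('o, 'm, 'k) klin_cat \<Rightarrow> 'o \<Rightarrow> 'o \<Rightarrow> 'm \<Rightarrow> bool"
  where "is_mono C X Y f \<longleftrightarrow> f \<in> mor C X Y \<and>
    (\<forall>W \<in> ob C. \<forall>u \<in> mor C W X. \<forall>v \<in> mor C W X. cmp C W X Y f u = cmp C W X Y f v \<longrightarrow> u = v)"

definition is_epi :: "('o, 'm, 'k) klin_cat \<Rightarrow> 'o \<Rightarrow> 'o \<Rightarrow> 'm \<Rightarrow> bool"
  where "is_epi C X Y f \<longleftrightarrow> f \<in> mor C X Y \<and>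
    (\<forall>W \<in> ob C. \<forall>u \<in> mor C Y W. \<forall>v \<in> mor C Y W. cmp C X Y W u f = cmp C X Y W v f \<longrightarrow> u = v)"

definition is_zero_object :: "('o, 'm, 'k) klin_cat \<Rightarrow> 'o \<Rightarrow> bool"
  where "is_zero_object C Z \<longleftrightarrow> Z \<in> ob C \<and>
    (\<forall>X \<in> ob C. (\<exists>!f. f \<in> mor C X Z) \<and> (\<exists>!f. f \<in> mor C Z X))"

text \<open>\<open>P\<close> is the direct sum of \<open>X\<close> and \<open>Y\<close>, with injections \<open>i\<close>, \<open>j\<close> and projections \<open>p\<close>, \<open>q\<close>.\<close>

definition is_biproduct ::
    "('o, 'm, 'k) klin_cat \<Rightarrow> 'o \<Rightarrow> 'o \<Rightarrow> 'o \<Rightarrow> 'm \<Rightarrow> 'm \<Rightarrow> 'm \<Rightarrow> 'm \<Rightarrow> bool"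
  where "is_biproduct C X Y P i j p q \<longleftrightarrow>
    X \<in> ob C \<and> Y \<in> ob C \<and> P \<in> ob C \<and>
    i \<in> mor C X P \<and> j \<in> mor C Y P \<and> p \<in> mor C P X \<and> q \<in> mor C P Y \<and>
    cmp C X P X p i = idm C X \<and> cmp C Y P Y q j = idm C Y \<and>
    cmp C X P Y q i = \<zero>\<^bsub>homs C X Y\<^esub> \<and> cmp C Y P X p j = \<zero>\<^bsub>homs C Y X\<^esub> \<and>
    cmp C P X P i p \<oplus>\<^bsub>homs C P P\<^esub> cmp C P Y P j q = idm C P"

text \<open>A \<open>k\<close>-category is a \<open>k\<close>-linear additive category.\<close>

locale k_category = k_linear_category +
  assumes ex_zero_object: "\<exists>Z. is_zero_object C Z"
    and ex_biproduct: "\<lbrakk>X \<in> ob C; Y \<in> ob C\<rbrakk> \<Longrightarrow> \<exists>P i j p q. is_biproduct C X Y P i j p q"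

definition hom_finite :: "('k, 'r) ring_scheme \<Rightarrow> ('o, 'm, 'k) klin_cat \<Rightarrow> bool"
  where "hom_finite K C \<longleftrightarrow>
    (\<forall>X \<in> ob C. \<forall>Y \<in> ob C. vectorspace.fin_dim K (homs C X Y))"


subsection \<open>Krull--Schmidt categories\<close>

definition idempotents_split :: "('o, 'm, 'k) klin_cat \<Rightarrow> bool"
  where "idempotents_split C \<longleftrightarrow>
    (\<forall>X \<in> ob C. \<forall>e \<in> mor C X X. cmp C X X X e e = e \<longrightarrow>
      (\<exists>Y \<in> ob C. \<exists>r \<in> mor C X Y. \<exists>s \<in> mor C Y X.
        cmp C Y X Y r s = idm C Y \<and> cmp C X Y X s r = e))"

definition indecomposable :: "('o, 'm, 'k) klin_cat \<Rightarrow> 'o \<Rightarrow> bool"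
  where "indecomposable C X \<longleftrightarrow> X \<in> ob C \<and> \<not> is_zero_object C X \<and>
    (\<forall>Y Z i j p q. is_biproduct C Y Z X i j p q \<longrightarrow> is_zero_object C Y \<or> is_zero_object C Z)"

definition end_ring :: "('o, 'm, 'k) klin_cat \<Rightarrow> 'o \<Rightarrow> ('k, 'm) module"
  where "end_ring C X = (homs C X X)\<lparr>mult := cmp C X X X, one := idm C X\<rparr>"

definition krull_schmidt :: "('o, 'm, 'k) klin_cat \<Rightarrow> bool"
  where "krull_schmidt C \<longleftrightarrow> idempotents_split C \<and>
    (\<forall>X. indecomposable C X \<longrightarrow> local_ring (end_ring C X))"


subsection \<open>Abelian categories\<close>

text \<open>\<open>i : N \<rightarrow> X\<close> is a kernel of \<open>f : X \<rightarrow> Y\<close>.\<close>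

definition is_kernel :: "('o, 'm, 'k) klin_cat \<Rightarrow> 'o \<Rightarrow> 'o \<Rightarrow> 'm \<Rightarrow> 'o \<Rightarrow> 'm \<Rightarrow> bool"
  where "is_kernel C X Y f N i \<longleftrightarrow>
    X \<in> ob C \<and> Y \<in> ob C \<and> N \<in> ob C \<and> f \<in> mor C X Y \<and> i \<in> mor C N X \<and>
    cmp C N X Y f i = \<zero>\<^bsub>homs C N Y\<^esub> \<and>
    (\<forall>W \<in> ob C. \<forall>h \<in> mor C W X. cmp C W X Y f h = \<zero>\<^bsub>homs C W Y\<^esub> \<longrightarrow>
      (\<exists>!u. u \<in> mor C W N \<and> cmp C W N X i u = h))"

text \<open>\<open>p : Y \<rightarrow> Q\<close> is a cokernel of \<open>f : X \<rightarrow> Y\<close>.\<close>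

definition is_cokernel :: "('o, 'm, 'k) klin_cat \<Rightarrow> 'o \<Rightarrow> 'o \<Rightarrow> 'm \<Rightarrow> 'o \<Rightarrow> 'm \<Rightarrow> bool"
  where "is_cokernel C X Y f Q p \<longleftrightarrow>
    X \<in> ob C \<and> Y \<in> ob C \<and> Q \<in> ob C \<and> f \<in> mor C X Y \<and> p \<in> mor C Y Q \<and>
    cmp C X Y Q p f = \<zero>\<^bsub>homs C X Q\<^esub> \<and>
    (\<forall>W \<in> ob C. \<forall>h \<in> mor C Y W. cmp C X Y W h f = \<zero>\<^bsub>homs C X W\<^esub> \<longrightarrow>
      (\<exists>!u. u \<in> mor C Q W \<and> cmp C Y Q W u p = h))"

locale abelian_category = k_category +
  assumes ex_kernel: "\<lbrakk>X \<in> ob C; Y \<in> ob C; f \<in> mor C X Y\<rbrakk> \<Longrightarrow> \<exists>N i. is_kernel C X Y f N i"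
    and ex_cokernel: "\<lbrakk>X \<in> ob C; Y \<in> ob C; f \<in> mor C X Y\<rbrakk> \<Longrightarrow> \<exists>Q p. is_cokernel C X Y f Q p"
    and mono_is_kernel: "\<lbrakk>X \<in> ob C; Y \<in> ob C; is_mono C X Y f\<rbrakk>
      \<Longrightarrow> \<exists>Z g. is_kernel C Y Z g X f"
    and epi_is_cokernel: "\<lbrakk>X \<in> ob C; Y \<in> ob C; is_epi C X Y f\<rbrakk>
      \<Longrightarrow> \<exists>Z g. is_cokernel C Z X g Y f"


subsection \<open>Exact categories\<close>

text \<open>The square with \<open>u : P \<rightarrow> X\<close>, \<open>v : P \<rightarrow> Y\<close> is a pullback of \<open>f : X \<rightarrow> Z\<close> and \<open>g : Y \<rightarrow> Z\<close>.\<close>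

definition is_pullback ::
    "('o, 'm, 'k) klin_cat \<Rightarrow> 'o \<Rightarrow> 'o \<Rightarrow> 'o \<Rightarrow> 'm \<Rightarrow> 'm \<Rightarrow> 'o \<Rightarrow> 'm \<Rightarrow> 'm \<Rightarrow> bool"
  where "is_pullback C X Y Z f g P u v \<longleftrightarrow>
    X \<in> ob C \<and> Y \<in> ob C \<and> Z \<in> ob C \<and> P \<in> ob C \<and>
    f \<in> mor C X Z \<and> g \<in> mor C Y Z \<and> u \<in> mor C P X \<and> v \<in> mor C P Y \<and>
    cmp C P X Z f u = cmp C P Y Z g v \<and>
    (\<forall>W \<in> ob C. \<forall>a \<in> mor C W X. \<forall>b \<in> mor C W Y. cmp C W X Z f a = cmp C W Y Z g b \<longrightarrow>
      (\<exists>!w. w \<in> mor C W P \<and> cmp C W P X u w = a \<and> cmp C W P Y v w = b))"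

text \<open>The square with \<open>u : X \<rightarrow> P\<close>, \<open>v : Y \<rightarrow> P\<close> is a pushout of \<open>f : Z \<rightarrow> X\<close> and \<open>g : Z \<rightarrow> Y\<close>.\<close>

definition is_pushout ::
    "('o, 'm, 'k) klin_cat \<Rightarrow> 'o \<Rightarrow> 'o \<Rightarrow> 'o \<Rightarrow> 'm \<Rightarrow> 'm \<Rightarrow> 'o \<Rightarrow> 'm \<Rightarrow> 'm \<Rightarrow> bool"
  where "is_pushout C X Y Z f g P u v \<longleftrightarrow>
    X \<in> ob C \<and> Y \<in> ob C \<and> Z \<in> ob C \<and> P \<in> ob C \<and>
    f \<in> mor C Z X \<and> g \<in> mor C Z Y \<and> u \<in> mor C X P \<and> v \<in> mor C Y P \<and>
    cmp C Z X P u f = cmp C Z Y P v g \<and>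
    (\<forall>W \<in> ob C. \<forall>a \<in> mor C X W. \<forall>b \<in> mor C Y W. cmp C Z X W a f = cmp C Z Y W b g \<longrightarrow>
      (\<exists>!w. w \<in> mor C P W \<and> cmp C X P W w u = a \<and> cmp C Y P W w v = b))"

text \<open>\<open>(X, i, Y, p, Z)\<close> stands for the sequence \<open>0 \<rightarrow> X \<rightarrow> Y \<rightarrow> Z \<rightarrow> 0\<close> with maps \<open>i\<close> and \<open>p\<close>.\<close>

type_synonym ('o, 'm) short_seq = "'o \<times> 'm \<times> 'o \<times> 'm \<times> 'o"

definition admissible_mono :: "('o, 'm) short_seq set \<Rightarrow> 'o \<Rightarrow> 'o \<Rightarrow> 'm \<Rightarrow> bool"
  where "admissible_mono E X Y i \<longleftrightarrow> (\<exists>p Z. (X, i, Y, p, Z) \<in> E)"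

definition admissible_epi :: "('o, 'm) short_seq set \<Rightarrow> 'o \<Rightarrow> 'o \<Rightarrow> 'm \<Rightarrow> bool"
  where "admissible_epi E Y Z p \<longleftrightarrow> (\<exists>X i. (X, i, Y, p, Z) \<in> E)"

text \<open>Quillen's axioms from \<^emph>\<open>Higher algebraic K-theory I\<close>, Section 2, including his last pair
  of axioms, which Keller showed to follow from the others.\<close>

locale exact_category = k_category +
  fixes E :: "('o, 'm) short_seq set"
  assumes ses_kernel: "(X, i, Y, p, Z) \<in> E \<Longrightarrow> is_kernel C Y Z p X i"
    and ses_cokernel: "(X, i, Y, p, Z) \<in> E \<Longrightarrow> is_cokernel C X Y i Z p"
    and ses_iso: "\<lbrakk>(X, i, Y, p, Z) \<in> E; X' \<in> ob C; Y' \<in> ob C; Z' \<in> ob C;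
        i' \<in> mor C X' Y'; p' \<in> mor C Y' Z';
        is_iso C X X' a; is_iso C Y Y' b; is_iso C Z Z' c;
        cmp C X Y Y' b i = cmp C X X' Y' i' a; cmp C Y Z Z' c p = cmp C Y Y' Z' p' b\<rbrakk>
      \<Longrightarrow> (X', i', Y', p', Z') \<in> E"
    and ses_split: "is_biproduct C X Z Y i j q p \<Longrightarrow> (X, i, Y, p, Z) \<in> E"
    and epi_cmp: "\<lbrakk>admissible_epi E X Y p; admissible_epi E Y Z q\<rbrakk>
      \<Longrightarrow> admissible_epi E X Z (cmp C X Y Z q p)"
    and epi_base_change: "\<lbrakk>admissible_epi E Y Z p; X \<in> ob C; f \<in> mor C X Z\<rbrakk>
      \<Longrightarrow> \<exists>P u v. is_pullback C X Y Z f p P u v \<and> admissible_epi E P X u"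
    and mono_cmp: "\<lbrakk>admissible_mono E X Y i; admissible_mono E Y Z j\<rbrakk>
      \<Longrightarrow> admissible_mono E X Z (cmp C X Y Z j i)"
    and mono_cobase_change: "\<lbrakk>admissible_mono E Z Y i; X \<in> ob C; f \<in> mor C Z X\<rbrakk>
      \<Longrightarrow> \<exists>P u v. is_pushout C X Y Z f i P u v \<and> admissible_mono E X P u"
    and epi_cancel: "\<lbrakk>is_kernel C Y Z p N n; X \<in> ob C; f \<in> mor C X Y;
        admissible_epi E X Z (cmp C X Y Z p f)\<rbrakk> \<Longrightarrow> admissible_epi E Y Z p"
    and mono_cancel: "\<lbrakk>is_cokernel C X Y i Q q; Z \<in> ob C; f \<in> mor C Y Z;
        admissible_mono E X Z (cmp C X Y Z f i)\<rbrakk> \<Longrightarrow> admissible_mono E X Y i"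


subsection \<open>Functors\<close>

locale k_linear_functor =
  S: k_linear_category K C + T: k_linear_category K D
  for K :: "('k, 'r) ring_scheme" (structure)
    and C :: "('o, 'm, 'k) klin_cat" and D :: "('p, 'n, 'k) klin_cat" +
  fixes Fo :: "'o \<Rightarrow> 'p" and Fm :: "'o \<Rightarrow> 'o \<Rightarrow> 'm \<Rightarrow> 'n"
  assumes Fo_ob: "X \<in> ob C \<Longrightarrow> Fo X \<in> ob D"
    and Fm_mor: "\<lbrakk>X \<in> ob C; Y \<in> ob C; f \<in> mor C X Y\<rbrakk> \<Longrightarrow> Fm X Y f \<in> mor D (Fo X) (Fo Y)"
    and Fm_idm: "X \<in> ob C \<Longrightarrow> Fm X X (idm C X) = idm D (Fo X)"
    and Fm_cmp: "\<lbrakk>X \<in> ob C; Y \<in> ob C; Z \<in> ob C; f \<in> mor C X Y; g \<in> mor C Y Z\<rbrakk>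
      \<Longrightarrow> Fm X Z (cmp C X Y Z g f) = cmp D (Fo X) (Fo Y) (Fo Z) (Fm Y Z g) (Fm X Y f)"
    and Fm_add: "\<lbrakk>X \<in> ob C; Y \<in> ob C; f \<in> mor C X Y; g \<in> mor C X Y\<rbrakk>
      \<Longrightarrow> Fm X Y (f \<oplus>\<^bsub>homs C X Y\<^esub> g) = Fm X Y f \<oplus>\<^bsub>homs D (Fo X) (Fo Y)\<^esub> Fm X Y g"
    and Fm_smult: "\<lbrakk>X \<in> ob C; Y \<in> ob C; c \<in> carrier K; f \<in> mor C X Y\<rbrakk>
      \<Longrightarrow> Fm X Y (c \<odot>\<^bsub>homs C X Y\<^esub> f) = c \<odot>\<^bsub>homs D (Fo X) (Fo Y)\<^esub> Fm X Y f"

definition exact_functor ::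
    "('o, 'm) short_seq set \<Rightarrow> ('p, 'n) short_seq set \<Rightarrow>
     ('o \<Rightarrow> 'p) \<Rightarrow> ('o \<Rightarrow> 'o \<Rightarrow> 'm \<Rightarrow> 'n) \<Rightarrow> bool"
  where "exact_functor E E' Fo Fm \<longleftrightarrow>
    (\<forall>X i Y p Z. (X, i, Y, p, Z) \<in> E \<longrightarrow> (Fo X, Fm X Y i, Fo Y, Fm Y Z p, Fo Z) \<in> E')"


section \<open>Group actions and equivariant categories\<close>

text \<open>The data of a module category over \<open>mod k(\<Gamma>)\<close>, given on the simple modules \<open>g \<in> \<Gamma>\<close>, of which
  every object of \<open>mod k(\<Gamma>)\<close> is a direct sum: \<open>tens_ob A g X\<close> is \<open>g \<otimes> X\<close>, \<open>tens_mor A g X Y f\<close> is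
  \<open>id \<otimes> f : g \<otimes> X \<rightarrow> g \<otimes> Y\<close>, \<open>asc A g h X\<close> is the structural isomorphism
  \<open>gh \<otimes> X \<rightarrow> g \<otimes> (h \<otimes> X)\<close>, and \<open>unitor A X\<close> is \<open>1 \<otimes> X \<rightarrow> X\<close>.\<close>

record ('g, 'o, 'm) cat_action =
  tens_ob :: "'g \<Rightarrow> 'o \<Rightarrow> 'o"
  tens_mor :: "'g \<Rightarrow> 'o \<Rightarrow> 'o \<Rightarrow> 'm \<Rightarrow> 'm"
  asc :: "'g \<Rightarrow> 'g \<Rightarrow> 'o \<Rightarrow> 'm"
  unitor :: "'o \<Rightarrow> 'm"

text \<open>Coherence is the pentagon and the triangle axiom of a module category. The second
  triangle (\<open>unitor\<close> at \<open>g \<otimes> X\<close> after \<open>asc\<close> at \<open>1, g, X\<close> is the identity) follows, and so does the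
  fact that each \<open>g \<otimes> -\<close> is an auto-equivalence, with quasi-inverse \<open>g\<inverse> \<otimes> -\<close>.\<close>

locale category_action = group G + k_linear_category K C
  for K :: "('k, 'r) ring_scheme"
    and C :: "('o, 'm, 'k) klin_cat"
    and G :: "('g, 's) monoid_scheme" (structure) +
  fixes A :: "('g, 'o, 'm) cat_action"
  assumes tens_functor: "g \<in> carrier G \<Longrightarrow> k_linear_functor K C C (tens_ob A g) (tens_mor A g)"
    and asc_iso: "\<lbrakk>g \<in> carrier G; h \<in> carrier G; X \<in> ob C\<rbrakk>
      \<Longrightarrow> is_iso C (tens_ob A (g \<otimes> h) X) (tens_ob A g (tens_ob A h X)) (asc A g h X)"
    and asc_natural: "\<lbrakk>g \<in> carrier G; h \<in> carrier G; X \<in> ob C; Y \<in> ob C; f \<in> mor C X Y\<rbrakk>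
      \<Longrightarrow> cmp C (tens_ob A (g \<otimes> h) X) (tens_ob A (g \<otimes> h) Y) (tens_ob A g (tens_ob A h Y))
            (asc A g h Y) (tens_mor A (g \<otimes> h) X Y f)
        = cmp C (tens_ob A (g \<otimes> h) X) (tens_ob A g (tens_ob A h X)) (tens_ob A g (tens_ob A h Y))
            (tens_mor A g (tens_ob A h X) (tens_ob A h Y) (tens_mor A h X Y f)) (asc A g h X)"
    and unitor_iso: "X \<in> ob C \<Longrightarrow> is_iso C (tens_ob A \<one> X) X (unitor A X)"
    and unitor_natural: "\<lbrakk>X \<in> ob C; Y \<in> ob C; f \<in> mor C X Y\<rbrakk>
      \<Longrightarrow> cmp C (tens_ob A \<one> X) (tens_ob A \<one> Y) Y (unitor A Y) (tens_mor A \<one> X Y f)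
        = cmp C (tens_ob A \<one> X) X Y f (unitor A X)"
    and pentagon: "\<lbrakk>g \<in> carrier G; h \<in> carrier G; l \<in> carrier G; X \<in> ob C\<rbrakk>
      \<Longrightarrow> cmp C (tens_ob A (g \<otimes> h \<otimes> l) X) (tens_ob A (g \<otimes> h) (tens_ob A l X))
            (tens_ob A g (tens_ob A h (tens_ob A l X)))
            (asc A g h (tens_ob A l X)) (asc A (g \<otimes> h) l X)
        = cmp C (tens_ob A (g \<otimes> h \<otimes> l) X) (tens_ob A g (tens_ob A (h \<otimes> l) X))
            (tens_ob A g (tens_ob A h (tens_ob A l X)))
            (tens_mor A g (tens_ob A (h \<otimes> l) X) (tens_ob A h (tens_ob A l X)) (asc A h l X))
            (asc A g (h \<otimes> l) X)"
    and triangle: "\<lbrakk>g \<in> carrier G; X \<in> ob C\<rbrakk>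
      \<Longrightarrow> cmp C (tens_ob A g X) (tens_ob A g (tens_ob A \<one> X)) (tens_ob A g X)
            (tens_mor A g (tens_ob A \<one> X) X (unitor A X)) (asc A g \<one> X)
        = idm C (tens_ob A g X)"

text \<open>The families \<open>\<psi>\<close> are extensional functions on the carrier of the group, so that
  two families agreeing on the carrier are equal.\<close>

definition equivariant_objects ::
    "('o, 'm, 'k) klin_cat \<Rightarrow> ('g, 's) monoid_scheme \<Rightarrow> ('g, 'o, 'm) cat_action \<Rightarrow>
     ('o \<times> ('g \<Rightarrow> 'm)) set"
  where "equivariant_objects C G A = {(X, \<psi>). X \<in> ob C \<and>
    \<psi> \<in> (\<Pi>\<^sub>E g \<in> carrier G. {f. is_iso C (tens_ob A g X) X f}) \<and>
    (\<forall>g \<in> carrier G. \<forall>h \<in> carrier G.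
      \<psi> (g \<otimes>\<^bsub>G\<^esub> h) =
        cmp C (tens_ob A (g \<otimes>\<^bsub>G\<^esub> h) X) (tens_ob A g (tens_ob A h X)) X
          (cmp C (tens_ob A g (tens_ob A h X)) (tens_ob A g X) X
            (\<psi> g) (tens_mor A g (tens_ob A h X) X (\<psi> h)))
          (asc A g h X)) \<and>
    \<psi> \<one>\<^bsub>G\<^esub> = unitor A X}"

definition equivariant_mor ::
    "('o, 'm, 'k) klin_cat \<Rightarrow> ('g, 's) monoid_scheme \<Rightarrow> ('g, 'o, 'm) cat_action \<Rightarrow>
     'o \<times> ('g \<Rightarrow> 'm) \<Rightarrow> 'o \<times> ('g \<Rightarrow> 'm) \<Rightarrow> 'm set"
  where "equivariant_mor C G A = (\<lambda>(X, \<psi>) (Y, \<chi>). {f \<in> mor C X Y. \<forall>g \<in> carrier G.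
    cmp C (tens_ob A g X) X Y f (\<psi> g)
      = cmp C (tens_ob A g X) (tens_ob A g Y) Y (\<chi> g) (tens_mor A g X Y f)})"

definition equivariant_category ::
    "('o, 'm, 'k) klin_cat \<Rightarrow> ('g, 's) monoid_scheme \<Rightarrow> ('g, 'o, 'm) cat_action \<Rightarrow>
     ('o \<times> ('g \<Rightarrow> 'm), 'm, 'k) klin_cat"
  where "equivariant_category C G A =
    \<lparr>ob = equivariant_objects C G A,
     homs = (\<lambda>P Q. (homs C (fst P) (fst Q))\<lparr>carrier := equivariant_mor C G A P Q\<rparr>),
     idm = (\<lambda>P. idm C (fst P)),
     cmp = (\<lambda>P Q R. cmp C (fst P) (fst Q) (fst R))\<rparr>"

text \<open>The short sequences of the equivariant category whose underlying sequence in \<open>C\<close> is in \<open>E\<close>.\<close>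

definition equivariant_ses ::
    "('o, 'm, 'k) klin_cat \<Rightarrow> ('g, 's) monoid_scheme \<Rightarrow> ('g, 'o, 'm) cat_action \<Rightarrow>
     ('o, 'm) short_seq set \<Rightarrow> ('o \<times> ('g \<Rightarrow> 'm), 'm) short_seq set"
  where "equivariant_ses C G A E = {(P, f, Q, g, R).
    P \<in> ob (equivariant_category C G A) \<and> Q \<in> ob (equivariant_category C G A) \<and>
    R \<in> ob (equivariant_category C G A) \<and>
    f \<in> mor (equivariant_category C G A) P Q \<and> g \<in> mor (equivariant_category C G A) Q R \<and>
    (fst P, f, fst Q, g, fst R) \<in> E}"

end

theory Submission
  imports Defs
begin

text \<open>An equivariant structure on an object \<open>N\<close> is determined by its effect on a jointly monic pair
  of equivariant maps out of \<open>N\<close>, or a jointly epic pair of equivariant maps into \<open>N\<close>; conversely, if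
  the structure maps can be chosen one group element at a time, they automatically satisfy the
  cocycle condition and are invertible. Hence zero objects, biproducts, splittings of idempotents,
  kernels, cokernels, pullbacks and pushouts of equivariant diagrams are computed in \<open>C\<close>, without any
  averaging over the group. The Krull--Schmidt property then follows because a finite-dimensional
  algebra without nontrivial idempotents is local. The one axiom of exact categories that does not
  transfer directly is the cancellation axiom, since a kernel in the equivariant category need not
  obviously be a kernel in \<open>C\<close>; but idempotent completeness of \<open>C\<close> makes that kernel superfluous.\<close>

section \<open>Finite-dimensional algebras\<close>

text \<open>Invertibility of the action enters through the isomorphisms \<open>asc\<close> and
  \<open>unitor\<close>. They make \<open>inv g \<otimes> (g \<otimes> -)\<close> naturally
  isomorphic to the identity, so \<open>g \<otimes> -\<close> is faithful; a structure map is then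
  inverted from a one-sided inverse and another one-sided inverse found after applying
  \<open>inv g \<otimes> -\<close>. Universal properties act asymmetrically: a limit
  \<open>N\<close> receives maps \<open>g \<otimes> N -> N\<close>, whereas a colimit emits maps
  \<open>N -> g \<otimes> N\<close>, so colimits are treated through coactions whose inverses form
  the structure. Kernels and monomorphisms of the equivariant category are tested against
  equivariant objects only. For monomorphisms this is repaired by giving the kernel in
  \<open>C\<close> an equivariant structure. Abelian categories have a second gap: the map of
  \<open>C\<close> whose kernel is a given monomorphism need not be equivariant, and the cokernel
  takes its place. The statement on finite-dimensional algebras rests on Fitting's alternative: an
  element is invertible or nilpotent, because the stable range of its powers yields an
  idempotent.\<close>

lemma (in vectorspace) subspace_fin_dim:
  assumes "fin_dim" and W: "VectorSpace.subspace K W V"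
  shows "vectorspace.fin_dim K (vs W)"
proof -
  interpret W: vectorspace K "vs W" by (rule subspace_is_vs[OF W])
  have sub: "LinearCombinations.submodule K W V" using W by simp
  then have "W \<subseteq> carrier V" by (simp add: LinearCombinations.submodule_def)
  have li: "W.lin_dep S \<longleftrightarrow> lin_dep S" if "S \<subseteq> W" for S
    using span_li_not_depend(2)[OF that sub] .
  \<comment> \<open>Independent subsets of \<open>W\<close> are independent in \<open>V\<close>, so
    \<open>dim\<close> bounds their size; a maximal one generates \<open>W\<close>.\<close>
  have "\<exists>S. finite S \<and> maximal S (\<lambda>S. S \<subseteq> W \<and> W.lin_indpt S)"
  proof (rule maximal_exists)
    show "finite S \<and> card S \<le> dim" if "S \<subseteq> W \<and> W.lin_indpt S" for S
      using li_le_dim[OF assms(1), of S] that li \<open>W \<subseteq> carrier V\<close> by auto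
    show "{} \<subseteq> W \<and> W.lin_indpt {}" by (auto simp: W.lin_dep_def)
  qed
  then obtain S where S: "finite S" "maximal S (\<lambda>S. S \<subseteq> W \<and> W.lin_indpt S)" by blast
  then have "W.gen_set S" using W.max_li_is_gen[of S] by simp
  moreover have "S \<subseteq> W" using S(2) by (simp add: maximal_def)
  ultimately show ?thesis using S(1) by (auto simp: W.fin_dim_def)
qed

text \<open>A basis of \<open>W\<close> stays independent in \<open>V\<close> and, by the bound on
  dimensions, is large enough to be a basis of \<open>V\<close>.\<close>

lemma (in vectorspace) subspace_eq_carrier:
  assumes "fin_dim" and W: "VectorSpace.subspace K W V" and "dim \<le> vectorspace.dim K (vs W)"
  shows "W = carrier V"
proof -
  interpret W: vectorspace K "vs W" by (rule subspace_is_vs[OF W])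
  have sub: "LinearCombinations.submodule K W V" using W by simp
  obtain B where B: "finite B" "W.basis B"
    using W.finite_basis_exists subspace_fin_dim assms by blast
  have BW: "B \<subseteq> W" and gen: "W.span B = W" and "\<not> W.lin_dep B"
    using B(2) by (auto simp: W.basis_def)
  have "W \<subseteq> carrier V" using sub by (simp add: LinearCombinations.submodule_def)
  have "basis B"
  proof (rule dim_li_is_basis)
    show "dim \<le> card B" using W.dim_basis[OF B] assms(3) by simp
    show "lin_indpt B" using \<open>\<not> W.lin_dep B\<close> span_li_not_depend(2)[OF BW sub] by simp
  qed (use assms(1) B(1) BW \<open>W \<subseteq> carrier V\<close> in auto)
  then show ?thesis
    using span_li_not_depend(1)[OF BW sub] gen by (simp add: basis_def)
qed

text \<open>One equality of neighbours suffices for Fitting's argument; it occurs where the sequence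
  of dimensions attains its minimum.\<close>

lemma (in vectorspace) decreasing_subspaces_stabilize:
  assumes fd: "fin_dim" and W: "\<And>n. VectorSpace.subspace K (W n) V" and dec: "\<And>n. W (Suc n) \<subseteq> W n"
  shows "\<exists>n. W (Suc n) = W n"
proof -
  define d where "d n = vectorspace.dim K (vs (W n))" for n :: nat
  obtain n where n: "d n \<le> d (Suc n)"
    using ex_has_least_nat[of "\<lambda>_. True" _ d] by blast
  interpret U: vectorspace K "vs (W n)" by (rule subspace_is_vs[OF W])
  have "VectorSpace.subspace K (W (Suc n)) (vs (W n))"
    using W[of "Suc n"] dec[of n] U.vectorspace_axioms U.module_axioms
    by (auto simp: VectorSpace.subspace_def LinearCombinations.submodule_def)
  then have "W (Suc n) = carrier (vs (W n))"
    using U.subspace_eq_carrier subspace_fin_dim[OF fd W] n by (simp add: d_def)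
  then show ?thesis by auto
qed

text \<open>Descent on the exponent of \<open>x\<close>: if \<open>x^(k+1) = 0\<close>, then
  multiplying \<open>x + y = 1\<close> by \<open>x^k\<close> gives \<open>x^k = x^k y\<close>, hence
  \<open>x^k = x^k y^n = 0\<close>; at exponent zero this reads \<open>1 = 0\<close>.\<close>

lemma (in ring) sum_nilpotent_neq_one:
  assumes x: "x \<in> carrier R" and y: "y \<in> carrier R" and "x \<oplus> y = \<one>" and "\<one> \<noteq> \<zero>"
    and "x [^] (m :: nat) = \<zero>" and ny: "y [^] (n :: nat) = \<zero>"
  shows False
proof -
  have "x [^] k = \<zero> \<Longrightarrow> \<one> = \<zero>" for k :: nat
  proof (induction k)
    case 0
    then show ?case by simp
  next
    case (Suc k)
    have "x [^] k = x [^] k \<otimes> (x \<oplus> y)" using assms by simp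
    also have "\<dots> = x [^] k \<otimes> y" using Suc.prems x y by (simp add: r_distr)
    finally have step: "x [^] k = x [^] k \<otimes> y" .
    have "x [^] k = x [^] k \<otimes> y [^] l" for l :: nat
    proof (induction l)
      case (Suc l)
      have "x [^] k \<otimes> y [^] Suc l = x [^] k \<otimes> y [^] l \<otimes> y" using x y by (simp add: m_assoc)
      then show ?case using Suc.IH step by simp
    qed (use x in simp)
    then have "x [^] k = \<zero>" using ny x by (metis nat_pow_closed r_null)
    then show ?case by (rule Suc.IH)
  qed
  with assms show False by blast
qed

text \<open>By Fitting's alternative nonunits are nilpotent. If two nonunits had an invertible sum,
  scaling by its inverse would write one as a sum of two nilpotents. Ring and vector space are
  separate records with common carrier and addition because the module record of morphisms does not
  carry composition as its multiplication.\<close>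

lemma local_ring_if_trivial_idempotents:
  fixes R (structure)
  assumes "ring R" and "vectorspace K V" and fd: "vectorspace.fin_dim K V"
    and carr: "carrier R = carrier V" and add: "add R = add V" and zero: "\<zero> = \<zero>\<^bsub>V\<^esub>"
    and smult_left: "\<And>c x y. \<lbrakk>c \<in> carrier K; x \<in> carrier R; y \<in> carrier R\<rbrakk>
      \<Longrightarrow> (c \<odot>\<^bsub>V\<^esub> x) \<otimes> y = c \<odot>\<^bsub>V\<^esub> (x \<otimes> y)"
    and smult_right: "\<And>c x y. \<lbrakk>c \<in> carrier K; x \<in> carrier R; y \<in> carrier R\<rbrakk>
      \<Longrightarrow> x \<otimes> (c \<odot>\<^bsub>V\<^esub> y) = c \<odot>\<^bsub>V\<^esub> (x \<otimes> y)"
    and idem: "\<And>e. \<lbrakk>e \<in> carrier R; e \<otimes> e = e\<rbrakk> \<Longrightarrow> e = \<zero> \<or> e = \<one>"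
    and "\<one> \<noteq> \<zero>"
  shows "local_ring R"
proof -
  interpret R: ring R by fact
  interpret V: vectorspace K V by fact
  have unit_or_nil: "a \<in> Units R \<or> (\<exists>n :: nat. a [^] n = \<zero>)" if a: "a \<in> carrier R" for a
  proof -
    \<comment> \<open>The centralizer of \<open>a\<close> replaces the whole ring, so that the
      \<open>b\<close> found below commutes with \<open>a\<close> and powers of the product
      \<open>a b\<close> can be split.\<close>
    define Z where "Z = {x \<in> carrier R. a \<otimes> x = x \<otimes> a}"
    define W where "W n = (\<lambda>x. a [^] n \<otimes> x) ` Z" for n :: nat
    have smult_closed: "c \<odot>\<^bsub>V\<^esub> x \<in> carrier R" if "c \<in> carrier K" "x \<in> carrier R" for c x
      using that carr by simp
    have "VectorSpace.subspace K (W n) V" for n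
    proof -
      have "LinearCombinations.submodule K (W n) V"
      proof
        show "W n \<subseteq> carrier V" using a by (auto simp: W_def Z_def carr[symmetric])
        show "v \<oplus>\<^bsub>V\<^esub> w \<in> W n" if vw: "v \<in> W n" "w \<in> W n" for v w
        proof -
          obtain x y where xy: "x \<in> Z" "y \<in> Z" "v = a [^] n \<otimes> x" "w = a [^] n \<otimes> y"
            using vw by (auto simp: W_def)
          then have "v \<oplus>\<^bsub>V\<^esub> w = a [^] n \<otimes> (x \<oplus> y)" "x \<oplus> y \<in> Z"
            using a by (auto simp: Z_def R.r_distr R.l_distr add[symmetric])
          then show ?thesis by (auto simp: W_def)
        qed
        have "\<zero> \<in> Z" using a by (simp add: Z_def)
        then show "\<zero>\<^bsub>V\<^esub> \<in> W n" 
          unfolding W_def zero[symmetric] using a by (intro image_eqI[of _ _ \<zero>]) auto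
        show "c \<odot>\<^bsub>V\<^esub> v \<in> W n" if c: "c \<in> carrier K" and v: "v \<in> W n" for c v
        proof -
          obtain x where x: "x \<in> Z" "v = a [^] n \<otimes> x" using v by (auto simp: W_def)
          then have "c \<odot>\<^bsub>V\<^esub> v = a [^] n \<otimes> (c \<odot>\<^bsub>V\<^esub> x)" "c \<odot>\<^bsub>V\<^esub> x \<in> Z"
            using a c by (auto simp: Z_def smult_left smult_right smult_closed)
          then show ?thesis by (auto simp: W_def)
        qed
      qed
      then show ?thesis using V.vectorspace_axioms by (simp add: VectorSpace.subspace_def)
    qed
    moreover have "W (Suc n) \<subseteq> W n" for n
    proof
      fix w assume "w \<in> W (Suc n)"
      then obtain x where x: "x \<in> Z" "w = a [^] Suc n \<otimes> x" by (auto simp: W_def)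
      then have "w = a [^] n \<otimes> (a \<otimes> x)" using a by (simp add: Z_def R.m_assoc)
      moreover have "a \<otimes> x \<in> Z" using a x(1) by (simp add: Z_def) (metis R.m_assoc)
      ultimately show "w \<in> W n" by (auto simp: W_def)
    qed
    ultimately obtain n where n: "W (Suc n) = W n"
      using V.decreasing_subspaces_stabilize[OF fd] by blast
    \<comment> \<open>The element \<open>a [^] n\<close> of \<open>W n\<close> also lies in
      \<open>W (Suc n)\<close>, which solves \<open>a^n = a^(n+1) b\<close> inside the
      centralizer.\<close>
    have "a [^] n \<in> W n" using a by (auto simp: W_def Z_def intro!: image_eqI[of _ _ \<one>])
    then obtain b where b: "b \<in> carrier R" "a \<otimes> b = b \<otimes> a" "a [^] n = a [^] Suc n \<otimes> b"
      using n by (auto simp: W_def Z_def)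
    \<comment> \<open>A positive exponent, even for \<open>n = 0\<close>: if \<open>c [^] m\<close>
      is one, a factor \<open>c = a b\<close> can be split off to invert \<open>a\<close>.\<close>
    define m where "m = Suc n"
    define c where "c = a \<otimes> b"
    have c: "c \<in> carrier R" "a \<otimes> c = c \<otimes> a" using a b(1,2) unfolding c_def by (simp, metis R.m_assoc)
    have cm: "c [^] m = a [^] m \<otimes> b [^] m"
      using R.pow_mult_distrib[OF b(2) a b(1)] by (simp add: c_def)
    have "a [^] n = a [^] n \<otimes> c" using a b(1,3) by (simp add: c_def R.m_assoc)
    then have "a \<otimes> a [^] n = a \<otimes> a [^] n \<otimes> c"
      using a c(1) by (simp add: R.m_assoc)
    then have amc: "a [^] m = a [^] m \<otimes> c"
      unfolding m_def using R.nat_pow_Suc2[OF a, of n] by simp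
    have "a [^] m = a [^] m \<otimes> c [^] k" for k :: nat
    proof (induction k)
      case (Suc k)
      have "a [^] m \<otimes> c [^] Suc k = a [^] m \<otimes> c [^] k \<otimes> c"
        using a c(1) by (simp add: R.m_assoc)
      then show ?case using Suc.IH amc by simp
    qed (use a in simp)
    then have am: "a [^] m = a [^] m \<otimes> c [^] m" .
    have comm: "a [^] m \<otimes> c [^] m = c [^] m \<otimes> a [^] m"
      using R.pow_mult_distrib[of a c m] R.pow_mult_distrib[of c a m] a c by simp
    \<comment> \<open>The idempotent is \<open>c^m = a^m b^m\<close>: since \<open>c^m\<close>
      commutes with \<open>a^m\<close> and is absorbed by it,
      \<open>c^m c^m = a^m c^m b^m = a^m b^m\<close>.\<close>
    have "c [^] m \<otimes> c [^] m = c [^] m \<otimes> a [^] m \<otimes> b [^] m"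
      using a b(1) c(1) cm by (simp add: R.m_assoc)
    also have "\<dots> = c [^] m" using am comm cm by simp
    finally have "c [^] m = \<zero> \<or> c [^] m = \<one>" using idem c(1) by simp
    then show ?thesis
    proof
      assume "c [^] m = \<zero>"
      then have "a [^] m = \<zero>" using am a by (metis R.nat_pow_closed R.r_null)
      then show ?thesis by blast
    next
      assume one: "c [^] m = \<one>"
      have "c [^] m = c \<otimes> c [^] n" unfolding m_def by (rule R.nat_pow_Suc2[OF c(1)])
      then have "a \<otimes> (b \<otimes> c [^] n) = \<one>" using one a b(1) c(1) by (simp add: c_def R.m_assoc)
      moreover have "c [^] m = c [^] n \<otimes> c" unfolding m_def by simp
      then have "(c [^] n \<otimes> b) \<otimes> a = \<one>"
        using one a b(1,2) c(1) by (simp add: c_def R.m_assoc)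
      ultimately show ?thesis
        using a b(1) c(1) R.inv_unique[of "c [^] n \<otimes> b" a "b \<otimes> c [^] n"]
        by (auto simp: Units_def)
    qed
  qed
  have "a \<oplus> b \<notin> Units R"
    if ab: "a \<in> carrier R - Units R" "b \<in> carrier R - Units R" for a b
  proof
    assume u: "a \<oplus> b \<in> Units R"
    define v where "v = inv (a \<oplus> b)"
    have v: "v \<in> Units R" using u by (simp add: v_def)
    \<comment> \<open>A unit times a nonunit is again a nonunit, so the alternative makes it
      nilpotent.\<close>
    have nil: "\<exists>n :: nat. (v \<otimes> z) [^] n = \<zero>" if z: "z \<in> carrier R - Units R" for z
    proof -
      have "v \<otimes> z \<notin> Units R"
      proof
        assume "v \<otimes> z \<in> Units R"
        then have "inv v \<otimes> (v \<otimes> z) \<in> Units R" using v by blast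
        moreover have "inv v \<otimes> (v \<otimes> z) = z"
          using v z by (simp add: R.Units_closed flip: R.m_assoc)
        ultimately show False using z by simp
      qed
      then show ?thesis using unit_or_nil[of "v \<otimes> z"] v z by auto
    qed
    have "v \<otimes> a \<oplus> v \<otimes> b = \<one>"
      using u v ab by (simp add: R.Units_closed v_def flip: R.r_distr)
    then show False
      using R.sum_nilpotent_neq_one[of "v \<otimes> a" "v \<otimes> b"] nil[OF ab(1)] nil[OF ab(2)] v ab \<open>\<one> \<noteq> \<zero>\<close>
      by auto
  qed
  then show ?thesis using R.ring_axioms \<open>\<one> \<noteq> \<zero>\<close> by (auto simp: local_ring_def)
qed

section \<open>Linear categories\<close>

context k_linear_category
begin

declare idm_mor [simp] cmp_mor [simp] cmp_idm_right [simp] cmp_idm_left [simp] cmp_assoc [simp]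

section \<open>Additive calculus in the morphism spaces\<close>

lemma homs_abelian_group:
  assumes "X \<in> ob C" and "Y \<in> ob C"
  shows "abelian_group (homs C X Y)"
  using vectorspace.axioms(1)[OF homs_vectorspace[OF assms]] by (rule Module.module.axioms(2))

lemma zero_mor [simp]: "\<lbrakk>X \<in> ob C; Y \<in> ob C\<rbrakk> \<Longrightarrow> \<zero>\<^bsub>homs C X Y\<^esub> \<in> mor C X Y"
  by (simp add: abelian_group.axioms(1) abelian_monoid.zero_closed homs_abelian_group)

lemma add_mor [simp]:
  "\<lbrakk>X \<in> ob C; Y \<in> ob C; f \<in> mor C X Y; g \<in> mor C X Y\<rbrakk> \<Longrightarrow> f \<oplus>\<^bsub>homs C X Y\<^esub> g \<in> mor C X Y"
  by (simp add: abelian_group.axioms(1) abelian_monoid.a_closed homs_abelian_group)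

lemma minus_mor [simp]:
  "\<lbrakk>X \<in> ob C; Y \<in> ob C; f \<in> mor C X Y; g \<in> mor C X Y\<rbrakk> \<Longrightarrow> f \<ominus>\<^bsub>homs C X Y\<^esub> g \<in> mor C X Y"
  by (simp add: abelian_group.minus_closed homs_abelian_group)

lemma add_zero_mor [simp]:
  assumes "X \<in> ob C" and "Y \<in> ob C" and "f \<in> mor C X Y"
  shows "f \<oplus>\<^bsub>homs C X Y\<^esub> \<zero>\<^bsub>homs C X Y\<^esub> = f" and "\<zero>\<^bsub>homs C X Y\<^esub> \<oplus>\<^bsub>homs C X Y\<^esub> f = f"
proof -
  interpret H: abelian_group "homs C X Y" using assms by (simp add: homs_abelian_group)
  show "f \<oplus>\<^bsub>homs C X Y\<^esub> \<zero>\<^bsub>homs C X Y\<^esub> = f" and "\<zero>\<^bsub>homs C X Y\<^esub> \<oplus>\<^bsub>homs C X Y\<^esub> f = f"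
    using assms by simp_all
qed

text \<open>Turns a statement on differences into one on sums, for which bilinearity of composition
  is available.\<close>

lemma minus_eq_iff:
  assumes "X \<in> ob C" and "Y \<in> ob C" and "f \<in> mor C X Y" and "g \<in> mor C X Y" and "h \<in> mor C X Y"
  shows "f \<ominus>\<^bsub>homs C X Y\<^esub> g = h \<longleftrightarrow> f = h \<oplus>\<^bsub>homs C X Y\<^esub> g"
proof -
  interpret H: abelian_group "homs C X Y" using assms by (simp add: homs_abelian_group)
  show ?thesis
    using assms by (auto simp: H.minus_eq H.a_assoc H.r_neg H.l_neg)
qed

lemma minus_add_mor [simp]:
  assumes "X \<in> ob C" and "Y \<in> ob C" and "f \<in> mor C X Y" and "g \<in> mor C X Y"
  shows "(f \<ominus>\<^bsub>homs C X Y\<^esub> g) \<oplus>\<^bsub>homs C X Y\<^esub> g = f"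
  using minus_eq_iff[of X Y f g "f \<ominus>\<^bsub>homs C X Y\<^esub> g"] assms by simp

lemma minus_eq_zero_iff [simp]:
  assumes "X \<in> ob C" and "Y \<in> ob C" and "f \<in> mor C X Y" and "g \<in> mor C X Y"
  shows "f \<ominus>\<^bsub>homs C X Y\<^esub> g = \<zero>\<^bsub>homs C X Y\<^esub> \<longleftrightarrow> f = g"
  using assms by (simp add: minus_eq_iff)

lemma minus_self_mor [simp]:
  "\<lbrakk>X \<in> ob C; Y \<in> ob C; f \<in> mor C X Y\<rbrakk> \<Longrightarrow> f \<ominus>\<^bsub>homs C X Y\<^esub> f = \<zero>\<^bsub>homs C X Y\<^esub>"
  by simp

lemma minus_zero_mor [simp]:
  assumes "X \<in> ob C" and "Y \<in> ob C" and "f \<in> mor C X Y"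
  shows "f \<ominus>\<^bsub>homs C X Y\<^esub> \<zero>\<^bsub>homs C X Y\<^esub> = f"
  using assms by (simp add: minus_eq_iff)

lemma cmp_zero_left [simp]:
  assumes "X \<in> ob C" and "Y \<in> ob C" and "Z \<in> ob C" and "f \<in> mor C X Y"
  shows "cmp C X Y Z \<zero>\<^bsub>homs C Y Z\<^esub> f = \<zero>\<^bsub>homs C X Z\<^esub>"
proof -
  let ?z = "\<zero>\<^bsub>homs C Y Z\<^esub>"
  interpret H: abelian_group "homs C X Z" using assms by (simp add: homs_abelian_group)
  have "cmp C X Y Z ?z f = cmp C X Y Z ?z f \<oplus>\<^bsub>homs C X Z\<^esub> cmp C X Y Z ?z f"
    using cmp_add_left[of X Y Z f ?z ?z] assms by simp
  then show ?thesis using assms by (metis H.add.r_cancel_one cmp_mor zero_mor)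
qed

lemma cmp_zero_right [simp]:
  assumes "X \<in> ob C" and "Y \<in> ob C" and "Z \<in> ob C" and "g \<in> mor C Y Z"
  shows "cmp C X Y Z g \<zero>\<^bsub>homs C X Y\<^esub> = \<zero>\<^bsub>homs C X Z\<^esub>"
proof -
  let ?z = "\<zero>\<^bsub>homs C X Y\<^esub>"
  interpret H: abelian_group "homs C X Z" using assms by (simp add: homs_abelian_group)
  have "cmp C X Y Z g ?z = cmp C X Y Z g ?z \<oplus>\<^bsub>homs C X Z\<^esub> cmp C X Y Z g ?z"
    using cmp_add_right[of X Y Z ?z ?z g] assms by simp
  then show ?thesis using assms by (metis H.add.r_cancel_one cmp_mor zero_mor)
qed

lemma cmp_minus_left:
  assumes "X \<in> ob C" and "Y \<in> ob C" and "Z \<in> ob C" and "f \<in> mor C X Y"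
    and "g \<in> mor C Y Z" and "g' \<in> mor C Y Z"
  shows "cmp C X Y Z (g \<ominus>\<^bsub>homs C Y Z\<^esub> g') f = cmp C X Y Z g f \<ominus>\<^bsub>homs C X Z\<^esub> cmp C X Y Z g' f"
proof -
  have "g = (g \<ominus>\<^bsub>homs C Y Z\<^esub> g') \<oplus>\<^bsub>homs C Y Z\<^esub> g'"
    using assms by simp
  then have "cmp C X Y Z g f = cmp C X Y Z (g \<ominus>\<^bsub>homs C Y Z\<^esub> g') f \<oplus>\<^bsub>homs C X Z\<^esub> cmp C X Y Z g' f"
    using assms by (metis cmp_add_left minus_mor)
  then show ?thesis using assms by (metis cmp_mor minus_eq_iff minus_mor)
qed

lemma cmp_minus_right:
  assumes "X \<in> ob C" and "Y \<in> ob C" and "Z \<in> ob C" and "f \<in> mor C X Y"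
    and "f' \<in> mor C X Y" and "g \<in> mor C Y Z"
  shows "cmp C X Y Z g (f \<ominus>\<^bsub>homs C X Y\<^esub> f') = cmp C X Y Z g f \<ominus>\<^bsub>homs C X Z\<^esub> cmp C X Y Z g f'"
proof -
  have "f = (f \<ominus>\<^bsub>homs C X Y\<^esub> f') \<oplus>\<^bsub>homs C X Y\<^esub> f'"
    using assms by simp
  then have "cmp C X Y Z g f = cmp C X Y Z g (f \<ominus>\<^bsub>homs C X Y\<^esub> f') \<oplus>\<^bsub>homs C X Z\<^esub> cmp C X Y Z g f'"
    using assms by (metis cmp_add_right minus_mor)
  then show ?thesis using assms by (metis cmp_mor minus_eq_iff minus_mor)
qed

section \<open>Zero objects, monomorphisms, kernels and isomorphisms\<close>

lemma zero_object_if_idm_zero: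
  assumes "X \<in> ob C" and "idm C X = \<zero>\<^bsub>homs C X X\<^esub>"
  shows "is_zero_object C X"
proof -
  have "f = \<zero>\<^bsub>homs C Y X\<^esub>" if "Y \<in> ob C" "f \<in> mor C Y X" for Y f
    using assms that by (metis cmp_idm_left cmp_zero_left)
  moreover have "f = \<zero>\<^bsub>homs C X Y\<^esub>" if "Y \<in> ob C" "f \<in> mor C X Y" for Y f
    using assms that by (metis cmp_idm_right cmp_zero_right)
  ultimately show ?thesis
    using assms(1) unfolding is_zero_object_def by (metis zero_mor)
qed

lemma zero_object_idm: "is_zero_object C X \<Longrightarrow> idm C X = \<zero>\<^bsub>homs C X X\<^esub>"
  unfolding is_zero_object_def by (metis idm_mor zero_mor)

lemma is_monoD:
  "\<lbrakk>is_mono C X Y f; cmp C W X Y f u = cmp C W X Y f v; W \<in> ob C; u \<in> mor C W X; v \<in> mor C W X\<rbrakk>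
    \<Longrightarrow> u = v"
  by (simp add: is_mono_def)

lemma is_epiD:
  "\<lbrakk>is_epi C X Y f; cmp C X Y W u f = cmp C X Y W v f; W \<in> ob C; u \<in> mor C Y W; v \<in> mor C Y W\<rbrakk>
    \<Longrightarrow> u = v"
  by (simp add: is_epi_def)

lemma is_mono_if_trivial_kernel:
  assumes "X \<in> ob C" and "Y \<in> ob C" and "f \<in> mor C X Y"
    and ker: "\<And>W h. \<lbrakk>W \<in> ob C; h \<in> mor C W X; cmp C W X Y f h = \<zero>\<^bsub>homs C W Y\<^esub>\<rbrakk>
      \<Longrightarrow> h = \<zero>\<^bsub>homs C W X\<^esub>"
  shows "is_mono C X Y f"
  unfolding is_mono_def
proof (intro conjI ballI impI)
  fix W u v
  assume *: "W \<in> ob C" "u \<in> mor C W X" "v \<in> mor C W X" "cmp C W X Y f u = cmp C W X Y f v"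
  then have "u \<ominus>\<^bsub>homs C W X\<^esub> v = \<zero>\<^bsub>homs C W X\<^esub>"
    using assms(1-3) by (intro ker) (simp_all add: cmp_minus_right)
  then show "u = v" using * assms(1-3) by simp
qed (fact assms)

lemma is_epi_if_trivial_cokernel:
  assumes "X \<in> ob C" and "Y \<in> ob C" and "f \<in> mor C X Y"
    and coker: "\<And>W h. \<lbrakk>W \<in> ob C; h \<in> mor C Y W; cmp C X Y W h f = \<zero>\<^bsub>homs C X W\<^esub>\<rbrakk>
      \<Longrightarrow> h = \<zero>\<^bsub>homs C Y W\<^esub>"
  shows "is_epi C X Y f"
  unfolding is_epi_def
proof (intro conjI ballI impI)
  fix W u v
  assume *: "W \<in> ob C" "u \<in> mor C Y W" "v \<in> mor C Y W" "cmp C X Y W u f = cmp C X Y W v f"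
  then have "u \<ominus>\<^bsub>homs C Y W\<^esub> v = \<zero>\<^bsub>homs C Y W\<^esub>"
    using assms(1-3) by (intro coker) (simp_all add: cmp_minus_left)
  then show "u = v" using * assms(1-3) by simp
qed (fact assms)

lemma kernel_is_mono:
  assumes k: "is_kernel C X Y f N i"
  shows "is_mono C N X i"
  unfolding is_mono_def
proof (intro conjI ballI impI)
  have *: "X \<in> ob C" "Y \<in> ob C" "N \<in> ob C" "f \<in> mor C X Y" "i \<in> mor C N X"
    "cmp C N X Y f i = \<zero>\<^bsub>homs C N Y\<^esub>"
    using k by (simp_all add: is_kernel_def)
  show "i \<in> mor C N X" by fact
  fix W u v
  assume uv: "W \<in> ob C" "u \<in> mor C W N" "v \<in> mor C W N" "cmp C W N X i u = cmp C W N X i v"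
  then have "cmp C W X Y f (cmp C W N X i v) = \<zero>\<^bsub>homs C W Y\<^esub>"
    using * by (metis cmp_assoc cmp_zero_left)
  then have "\<exists>!w. w \<in> mor C W N \<and> cmp C W N X i w = cmp C W N X i v"
    using k uv * by (simp add: is_kernel_def)
  then show "u = v" using uv by blast
qed

lemma cokernel_is_epi:
  assumes k: "is_cokernel C X Y f Q p"
  shows "is_epi C Y Q p"
  unfolding is_epi_def
proof (intro conjI ballI impI)
  have *: "X \<in> ob C" "Y \<in> ob C" "Q \<in> ob C" "f \<in> mor C X Y" "p \<in> mor C Y Q"
    "cmp C X Y Q p f = \<zero>\<^bsub>homs C X Q\<^esub>"
    using k by (simp_all add: is_cokernel_def)
  show "p \<in> mor C Y Q" by fact
  fix W u v
  assume uv: "W \<in> ob C" "u \<in> mor C Q W" "v \<in> mor C Q W" "cmp C Y Q W u p = cmp C Y Q W v p"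
  then have "cmp C X Y W (cmp C Y Q W v p) f = \<zero>\<^bsub>homs C X W\<^esub>"
    using * by simp
  then have "\<exists>!w. w \<in> mor C Q W \<and> cmp C Y Q W w p = cmp C Y Q W v p"
    using k uv * by (simp add: is_cokernel_def)
  then show "u = v" using uv by blast
qed

lemma is_isoE:
  assumes "is_iso C X Y f"
  obtains f' where "f \<in> mor C X Y" and "f' \<in> mor C Y X"
    and "cmp C X Y X f' f = idm C X" and "cmp C Y X Y f f' = idm C Y"
  using assms unfolding is_iso_def by blast

lemma iso_cancel_left:
  assumes "is_iso C X Y f" and eq: "cmp C W X Y f u = cmp C W X Y f v"
    and *: "W \<in> ob C" "X \<in> ob C" "Y \<in> ob C" "u \<in> mor C W X" "v \<in> mor C W X"
  shows "u = v"
proof -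
  obtain f' where f: "f \<in> mor C X Y" "f' \<in> mor C Y X" "cmp C X Y X f' f = idm C X"
    using assms(1) by (rule is_isoE)
  have "u = cmp C W Y X f' (cmp C W X Y f u)" using f * by (simp flip: cmp_assoc)
  also have "\<dots> = v" unfolding eq using f * by (simp flip: cmp_assoc)
  finally show ?thesis .
qed

lemma iso_cancel_right:
  assumes "is_iso C X Y f" and eq: "cmp C X Y W u f = cmp C X Y W v f"
    and *: "W \<in> ob C" "X \<in> ob C" "Y \<in> ob C" "u \<in> mor C Y W" "v \<in> mor C Y W"
  shows "u = v"
proof -
  obtain f' where f: "f \<in> mor C X Y" "f' \<in> mor C Y X" "cmp C Y X Y f f' = idm C Y"
    using assms(1) by (rule is_isoE)
  have "u = cmp C Y X W (cmp C X Y W u f) f'" using f * by simp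
  also have "\<dots> = v" unfolding eq using f * by simp
  finally show ?thesis .
qed

text \<open>Orthogonality has to be deduced. The composite \<open>s' r' s = (1 - s r) s\<close>
  vanishes, and applying \<open>r'\<close> removes \<open>s'\<close>, so \<open>r' s = 0\<close>.
  Likewise \<open>r s' r' = r (1 - s r)\<close> vanishes, and precomposing with \<open>s'\<close>
  gives \<open>r s' = 0\<close>.\<close>

lemma biproduct_of_complementary_idempotents:
  assumes ob: "X \<in> ob C" "Y \<in> ob C" "Z \<in> ob C"
    and m: "r \<in> mor C X Y" "s \<in> mor C Y X" "r' \<in> mor C X Z" "s' \<in> mor C Z X"
    and rs: "cmp C Y X Y r s = idm C Y" and rs': "cmp C Z X Z r' s' = idm C Z"
    and sr': "cmp C X Z X s' r' = idm C X \<ominus>\<^bsub>homs C X X\<^esub> cmp C X Y X s r"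
  shows "is_biproduct C Y Z X s s' r r'"
proof -
  interpret H: abelian_group "homs C X X" using ob by (simp add: homs_abelian_group)
  have "cmp C Y Z X s' (cmp C Y X Z r' s) = cmp C Y X X (cmp C X Z X s' r') s"
    using ob m by simp
  also have "\<dots> = \<zero>\<^bsub>homs C Y X\<^esub>" unfolding sr' using ob m rs by (simp add: cmp_minus_left)
  finally have "cmp C Y X Z r' (cmp C Y Z X s' (cmp C Y X Z r' s)) = \<zero>\<^bsub>homs C Y Z\<^esub>"
    using ob m by simp
  then have 1: "cmp C Y X Z r' s = \<zero>\<^bsub>homs C Y Z\<^esub>"
    using ob m rs' by (simp flip: cmp_assoc)
  have "cmp C X Z Y (cmp C Z X Y r s') r' = cmp C X X Y r (cmp C X Z X s' r')"
    using ob m by simp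
  also have "\<dots> = r \<ominus>\<^bsub>homs C X Y\<^esub> cmp C X Y Y (cmp C Y X Y r s) r"
    unfolding sr' using ob m by (simp add: cmp_minus_right del: rs)
  also have "\<dots> = \<zero>\<^bsub>homs C X Y\<^esub>" using ob m rs by simp
  finally have "cmp C Z X Y (cmp C X Z Y (cmp C Z X Y r s') r') s' = \<zero>\<^bsub>homs C Z Y\<^esub>"
    using ob m by simp
  then have 2: "cmp C Z X Y r s' = \<zero>\<^bsub>homs C Z Y\<^esub>"
    using ob m rs' by simp
  have "cmp C X Y X s r \<oplus>\<^bsub>homs C X X\<^esub> cmp C X Z X s' r' = idm C X"
    unfolding sr' using ob m by (subst H.a_comm) simp_all
  with 1 2 show ?thesis using assms by (simp add: is_biproduct_def)
qed

section \<open>Endomorphism rings and the Krull--Schmidt property\<close>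

lemma end_ring_simps [simp]:
  "carrier (end_ring C X) = mor C X X" "monoid.mult (end_ring C X) = cmp C X X X"
  "one (end_ring C X) = idm C X" "add (end_ring C X) = add (homs C X X)"
  "zero (end_ring C X) = zero (homs C X X)"
  by (simp_all add: end_ring_def)

lemma ring_end_ring:
  assumes "X \<in> ob C"
  shows "ring (end_ring C X)"
proof (rule ringI)
  interpret H: abelian_group "homs C X X" using assms by (simp add: homs_abelian_group)
  show "abelian_group (end_ring C X)"
    by (rule abelian_groupI)
      (use H.a_closed H.a_assoc H.a_comm H.l_neg H.a_inv_closed in \<open>auto intro: bexI\<close>)
  show "monoid (end_ring C X)" by (rule monoidI) (use assms in simp_all)
qed (use assms in \<open>simp_all add: cmp_add_left cmp_add_right\<close>)

text \<open>For an idempotent \<open>e\<close> on an indecomposable object, splitting both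
  \<open>e\<close> and \<open>1 - e\<close> decomposes the object as a biproduct. One summand is
  zero, so \<open>e\<close> is zero or the identity, and Fitting's alternative gives
  locality.\<close>

lemma krull_schmidtI:
  assumes fin: "hom_finite K C" and split: "idempotents_split C"
  shows "krull_schmidt C"
  unfolding krull_schmidt_def
proof (intro conjI allI impI)
  fix X assume ind: "indecomposable C X"
  then have X: "X \<in> ob C" by (simp add: indecomposable_def)
  show "local_ring (end_ring C X)"
  proof (rule local_ring_if_trivial_idempotents[of _ K "homs C X X"])
    show "\<one>\<^bsub>end_ring C X\<^esub> \<noteq> \<zero>\<^bsub>end_ring C X\<^esub>"
      using ind X zero_object_if_idm_zero by (auto simp: indecomposable_def)
    fix e assume e: "e \<in> carrier (end_ring C X)" "e \<otimes>\<^bsub>end_ring C X\<^esub> e = e"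
    define e' where "e' = idm C X \<ominus>\<^bsub>homs C X X\<^esub> e"
    have "e' \<in> mor C X X" "cmp C X X X e' e' = e'"
      using e X by (simp_all add: e'_def cmp_minus_left cmp_minus_right)
    then obtain Z r' s' where Z: "Z \<in> ob C" "r' \<in> mor C X Z" "s' \<in> mor C Z X"
      "cmp C Z X Z r' s' = idm C Z" "cmp C X Z X s' r' = e'"
      using split X unfolding idempotents_split_def by metis
    obtain Y r s where Y: "Y \<in> ob C" "r \<in> mor C X Y" "s \<in> mor C Y X"
      "cmp C Y X Y r s = idm C Y" "cmp C X Y X s r = e"
      using split X e unfolding idempotents_split_def by (metis end_ring_simps(1,2))
    have "is_biproduct C Y Z X s s' r r'"
      by (rule biproduct_of_complementary_idempotents) (use X Y Z in \<open>simp_all add: e'_def\<close>)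
    then have "is_zero_object C Y \<or> is_zero_object C Z"
      using ind unfolding indecomposable_def by blast
    then show "e = \<zero>\<^bsub>end_ring C X\<^esub> \<or> e = \<one>\<^bsub>end_ring C X\<^esub>"
    proof
      assume "is_zero_object C Y"
      then have "s = cmp C Y Y X s \<zero>\<^bsub>homs C Y Y\<^esub>"
        using X Y zero_object_idm by (metis cmp_idm_right)
      then show ?thesis using X Y by (metis cmp_zero_left cmp_zero_right end_ring_simps(5))
    next
      assume "is_zero_object C Z"
      then have "s' = cmp C Z Z X s' \<zero>\<^bsub>homs C Z Z\<^esub>"
        using X Z zero_object_idm by (metis cmp_idm_right)
      then have "e' = \<zero>\<^bsub>homs C X X\<^esub>" using X Z by (metis cmp_zero_left cmp_zero_right)
      then show ?thesis using X e by (simp add: e'_def)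
    qed
  qed (use X fin homs_vectorspace ring_end_ring in
      \<open>simp_all add: hom_finite_def cmp_smult_left cmp_smult_right\<close>)
qed (fact split)

end

section \<open>Lifting equivariant structures\<close>

context k_linear_category
begin

text \<open>With \<open>cmp_assoc\<close> as a rewrite rule composites are nested to the right, so
  the left side of a known equation \<open>b a = d c\<close> does not occur in
  \<open>b (a x)\<close>. This form attaches the tail \<open>x\<close>.\<close>

lemma cmp_eq_tail:
  assumes "cmp C X Y Z b a = cmp C X Y' Z d c"
    and "W \<in> ob C" "X \<in> ob C" "Y \<in> ob C" "Y' \<in> ob C" "Z \<in> ob C" "x \<in> mor C W X" "a \<in> mor C X Y"
      "b \<in> mor C Y Z" "c \<in> mor C X Y'" "d \<in> mor C Y' Z"
  shows "cmp C W Y Z b (cmp C W X Y a x) = cmp C W Y' Z d (cmp C W X Y' c x)"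
  using assms by (simp flip: cmp_assoc)

text \<open>The same device for a composite that equals a single morphism, as for inverse pairs and
  factorizations.\<close>

lemma cmp_eq_tail1:
  assumes "cmp C X Y Z b a = e"
    and "W \<in> ob C" "X \<in> ob C" "Y \<in> ob C" "Z \<in> ob C" "x \<in> mor C W X" "a \<in> mor C X Y"
      "b \<in> mor C Y Z"
  shows "cmp C W Y Z b (cmp C W X Y a x) = cmp C W X Z e x"
  using assms by (simp flip: cmp_assoc)

lemma is_iso_mor [simp]: "is_iso C X Y f \<Longrightarrow> f \<in> mor C X Y"
  by (simp add: is_iso_def)

lemma is_isoI:
  "\<lbrakk>f \<in> mor C X Y; f' \<in> mor C Y X; cmp C X Y X f' f = idm C X; cmp C Y X Y f f' = idm C Y\<rbrakk>
    \<Longrightarrow> is_iso C X Y f"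
  unfolding is_iso_def by blast

text \<open>Two legs are what biproducts and pullbacks provide; a single monomorphism enters as the
  pair \<open>u\<close>, \<open>u\<close>, so one lifting argument serves all cases.\<close>

definition jointly_monic :: "'o \<Rightarrow> 'o \<Rightarrow> 'o \<Rightarrow> 'm \<Rightarrow> 'm \<Rightarrow> bool"
  where "jointly_monic N X Y u v \<longleftrightarrow> (\<forall>W \<in> ob C. \<forall>a \<in> mor C W N. \<forall>b \<in> mor C W N.
    cmp C W N X u a = cmp C W N X u b \<and> cmp C W N Y v a = cmp C W N Y v b \<longrightarrow> a = b)"

definition jointly_epic :: "'o \<Rightarrow> 'o \<Rightarrow> 'o \<Rightarrow> 'm \<Rightarrow> 'm \<Rightarrow> bool"
  where "jointly_epic X Y N u v \<longleftrightarrow> (\<forall>W \<in> ob C. \<forall>a \<in> mor C N W. \<forall>b \<in> mor C N W.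
    cmp C X N W a u = cmp C X N W b u \<and> cmp C Y N W a v = cmp C Y N W b v \<longrightarrow> a = b)"

lemma jointly_monic_if_mono: "is_mono C N X u \<Longrightarrow> jointly_monic N X X u u"
  by (simp add: jointly_monic_def is_mono_def)

lemma jointly_epic_if_epi: "is_epi C X N u \<Longrightarrow> jointly_epic X X N u u"
  by (simp add: jointly_epic_def is_epi_def)

end

section \<open>The functors \<open>g \<otimes> -\<close> and their faithfulness\<close>

context category_action
begin

lemma group_simps [simp]:
  "\<one> \<in> carrier G" "\<lbrakk>g \<in> carrier G; h \<in> carrier G\<rbrakk> \<Longrightarrow> g \<otimes> h \<in> carrier G"
  "g \<in> carrier G \<Longrightarrow> inv g \<in> carrier G"
  "g \<in> carrier G \<Longrightarrow> inv g \<otimes> g = \<one>" "g \<in> carrier G \<Longrightarrow> g \<otimes> inv g = \<one>"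
  using group_axioms
  by (simp_all add: group.is_monoid monoid.one_closed monoid.m_closed group.inv_closed
      group.l_inv group.r_inv)

abbreviation "T \<equiv> tens_ob A"
abbreviation "M \<equiv> tens_mor A"

lemma tens_simps [simp]:
  assumes "g \<in> carrier G"
  shows "X \<in> ob C \<Longrightarrow> T g X \<in> ob C"
    and "\<lbrakk>X \<in> ob C; Y \<in> ob C; f \<in> mor C X Y\<rbrakk> \<Longrightarrow> M g X Y f \<in> mor C (T g X) (T g Y)"
    and "X \<in> ob C \<Longrightarrow> M g X X (idm C X) = idm C (T g X)"
    and "\<lbrakk>X \<in> ob C; Y \<in> ob C; Z \<in> ob C; f \<in> mor C X Y; f' \<in> mor C Y Z\<rbrakk>
      \<Longrightarrow> M g X Z (cmp C X Y Z f' f) = cmp C (T g X) (T g Y) (T g Z) (M g Y Z f') (M g X Y f)"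
    and "\<lbrakk>X \<in> ob C; Y \<in> ob C; f \<in> mor C X Y; f' \<in> mor C X Y\<rbrakk>
      \<Longrightarrow> M g X Y (f \<oplus>\<^bsub>homs C X Y\<^esub> f') = M g X Y f \<oplus>\<^bsub>homs C (T g X) (T g Y)\<^esub> M g X Y f'"
    and "\<lbrakk>X \<in> ob C; Y \<in> ob C; c \<in> carrier K; f \<in> mor C X Y\<rbrakk>
      \<Longrightarrow> M g X Y (c \<odot>\<^bsub>homs C X Y\<^esub> f) = c \<odot>\<^bsub>homs C (T g X) (T g Y)\<^esub> M g X Y f"
  using k_linear_functor.Fo_ob[OF tens_functor[OF assms]]
    k_linear_functor.Fm_mor[OF tens_functor[OF assms]]
    k_linear_functor.Fm_idm[OF tens_functor[OF assms]]
    k_linear_functor.Fm_cmp[OF tens_functor[OF assms]]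
    k_linear_functor.Fm_add[OF tens_functor[OF assms]]
    k_linear_functor.Fm_smult[OF tens_functor[OF assms]]
  by simp_all

lemma tens_zero [simp]:
  assumes "g \<in> carrier G" and "X \<in> ob C" and "Y \<in> ob C"
  shows "M g X Y \<zero>\<^bsub>homs C X Y\<^esub> = \<zero>\<^bsub>homs C (T g X) (T g Y)\<^esub>"
proof -
  let ?z = "\<zero>\<^bsub>homs C X Y\<^esub>"
  interpret H: abelian_group "homs C (T g X) (T g Y)" using assms by (simp add: homs_abelian_group)
  have "M g X Y ?z = M g X Y ?z \<oplus>\<^bsub>homs C (T g X) (T g Y)\<^esub> M g X Y ?z"
    using tens_simps(5)[of g X Y ?z ?z] assms by simp
  then show ?thesis using assms by (metis H.add.r_cancel_one tens_simps(2) zero_mor)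
qed

lemma asc_mor [simp]:
  "\<lbrakk>g \<in> carrier G; h \<in> carrier G; X \<in> ob C\<rbrakk> \<Longrightarrow> asc A g h X \<in> mor C (T (g \<otimes> h) X) (T g (T h X))"
  by (simp add: asc_iso)

lemma unitor_mor [simp]: "X \<in> ob C \<Longrightarrow> unitor A X \<in> mor C (T \<one> X) X"
  by (simp add: unitor_iso)

text \<open>Naturality of \<open>asc\<close> at \<open>inv g\<close>, \<open>g\<close> expresses
  \<open>M \<one> X Y f\<close> through \<open>M g X Y f\<close>, and naturality of the unitor
  recovers \<open>f\<close> from \<open>M \<one> X Y f\<close>.\<close>

lemma tens_faithful:
  assumes g: "g \<in> carrier G"
    and eq: "M g X Y f = M g X Y f'" and X: "X \<in> ob C" and Y: "Y \<in> ob C"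
    and f: "f \<in> mor C X Y" and f': "f' \<in> mor C X Y"
  shows "f = f'"
proof -
  let ?k = "inv g"
  note * = g X Y f f'
  have eq1: "cmp C (T \<one> X) (T \<one> Y) (T ?k (T g Y)) (asc A ?k g Y) (M \<one> X Y f)
      = cmp C (T \<one> X) (T \<one> Y) (T ?k (T g Y)) (asc A ?k g Y) (M \<one> X Y f')"
    using asc_natural[of ?k g X Y f] asc_natural[of ?k g X Y f'] * eq by simp
  have iso: "is_iso C (T \<one> Y) (T ?k (T g Y)) (asc A ?k g Y)"
    using asc_iso[of ?k g Y] * by simp
  have "M \<one> X Y f = M \<one> X Y f'"
    by (rule iso_cancel_left[OF iso eq1]) (use * in simp_all)
  then have eq2: "cmp C (T \<one> X) X Y f (unitor A X) = cmp C (T \<one> X) X Y f' (unitor A X)"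
    using * by (simp flip: unitor_natural)
  show ?thesis by (rule iso_cancel_right[OF unitor_iso eq2]) (use * in simp_all)
qed

text \<open>In \<open>f r f = f\<close> the left factor \<open>f\<close> can be cancelled after
  applying \<open>k \<otimes> -\<close>, where it has the left inverse \<open>l\<close>.
  Faithfulness then brings back \<open>r f = 1\<close>.\<close>

lemma is_iso_if_section:
  assumes k: "k \<in> carrier G" and *: "X \<in> ob C" "Y \<in> ob C" "f \<in> mor C X Y" "r \<in> mor C Y X"
      "l \<in> mor C (T k Y) (T k X)"
    and fr: "cmp C Y X Y f r = idm C Y"
    and lf: "cmp C (T k X) (T k Y) (T k X) l (M k X Y f) = idm C (T k X)"
  shows "is_iso C X Y f"
proof -
  have "cmp C X X Y f (cmp C X Y X r f) = f"
    using * cmp_eq_tail1[OF fr] by simp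
  then have "M k X Y (cmp C X X Y f (cmp C X Y X r f)) = M k X Y f" by (simp only:)
  then have "cmp C (T k X) (T k Y) (T k X) l
      (cmp C (T k X) (T k X) (T k Y) (M k X Y f) (M k X X (cmp C X Y X r f))) = idm C (T k X)"
    using k * lf by simp
  then have "M k X X (cmp C X Y X r f) = M k X X (idm C X)"
    using k * cmp_eq_tail1[OF lf] by simp
  then have "cmp C X Y X r f = idm C X"
    by (rule tens_faithful[OF k]) (use * in simp_all)
  then show ?thesis using * fr by (intro is_isoI)
qed

text \<open>The mirror image: in \<open>f l f = f\<close> the right factor is cancelled after
  applying \<open>k \<otimes> -\<close>, by means of \<open>r\<close>.\<close>

lemma is_iso_if_retraction:
  assumes k: "k \<in> carrier G" and *: "X \<in> ob C" "Y \<in> ob C" "f \<in> mor C X Y" "l \<in> mor C Y X"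
      "r \<in> mor C (T k Y) (T k X)"
    and lf: "cmp C X Y X l f = idm C X"
    and fr: "cmp C (T k Y) (T k X) (T k Y) (M k X Y f) r = idm C (T k Y)"
  shows "is_iso C X Y f"
proof -
  have "cmp C X Y Y (cmp C Y X Y f l) f = f"
    using * lf by simp
  then have "M k X Y (cmp C X Y Y (cmp C Y X Y f l) f) = M k X Y f" by (simp only:)
  then have "cmp C (T k Y) (T k X) (T k Y)
      (cmp C (T k X) (T k Y) (T k Y) (M k Y Y (cmp C Y X Y f l)) (M k X Y f)) r = idm C (T k Y)"
    using k * fr by simp
  then have "M k Y Y (cmp C Y X Y f l) = M k Y Y (idm C Y)"
    using k * fr by simp
  then have "cmp C Y X Y f l = idm C Y"
    by (rule tens_faithful[OF k]) (use * in simp_all)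
  then show ?thesis using * lf by (intro is_isoI)
qed

section \<open>Cocycles, coactions and the invertibility of structure maps\<close>

lemma equivariant_objectD:
  assumes "(X, \<psi>) \<in> equivariant_objects C G A"
  shows "X \<in> ob C" and "g \<in> carrier G \<Longrightarrow> \<psi> g \<in> mor C (T g X) X"
    and "g \<in> carrier G \<Longrightarrow> is_iso C (T g X) X (\<psi> g)"
    and "\<lbrakk>g \<in> carrier G; h \<in> carrier G\<rbrakk> \<Longrightarrow> \<psi> (g \<otimes> h) =
      cmp C (T (g \<otimes> h) X) (T g X) X (\<psi> g)
        (cmp C (T (g \<otimes> h) X) (T g (T h X)) (T g X) (M g (T h X) X (\<psi> h)) (asc A g h X))"
    and "\<psi> \<one> = unitor A X"
proof -
  show X: "X \<in> ob C" using assms by (simp add: equivariant_objects_def)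
  show iso: "is_iso C (T g X) X (\<psi> g)" if "g \<in> carrier G" for g
    using assms that unfolding equivariant_objects_def by (simp, blast)
  then show mor: "\<psi> g \<in> mor C (T g X) X" if "g \<in> carrier G" for g
    using that by simp
  show "\<psi> (g \<otimes> h) =
      cmp C (T (g \<otimes> h) X) (T g X) X (\<psi> g)
        (cmp C (T (g \<otimes> h) X) (T g (T h X)) (T g X) (M g (T h X) X (\<psi> h)) (asc A g h X))"
    if "g \<in> carrier G" "h \<in> carrier G" for g h
    using assms that X mor[of g] mor[of h] by (simp add: equivariant_objects_def)
  show "\<psi> \<one> = unitor A X" using assms by (simp add: equivariant_objects_def)
qed

text \<open>Invertibility of the structure maps is automatic: the cocycle condition at \<open>g, g\<inverse>\<close> gives a
  right inverse of \<open>\<psi> g\<close>, and at \<open>g\<inverse>, g\<close> a left inverse of \<open>g\<inverse> \<otimes> \<psi> g\<close>.\<close>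

lemma equivariant_objectI:
  assumes X: "X \<in> ob C" and ext: "\<psi> \<in> extensional (carrier G)"
    and mor: "\<And>g. g \<in> carrier G \<Longrightarrow> \<psi> g \<in> mor C (T g X) X"
    and cocycle: "\<And>g h. \<lbrakk>g \<in> carrier G; h \<in> carrier G\<rbrakk> \<Longrightarrow> \<psi> (g \<otimes> h) =
      cmp C (T (g \<otimes> h) X) (T g X) X (\<psi> g)
        (cmp C (T (g \<otimes> h) X) (T g (T h X)) (T g X) (M g (T h X) X (\<psi> h)) (asc A g h X))"
    and unit: "\<psi> \<one> = unitor A X"
  shows "(X, \<psi>) \<in> equivariant_objects C G A"
proof -
  have "is_iso C (T g X) X (\<psi> g)" if g: "g \<in> carrier G" for g
  proof -
    let ?k = "inv g"
    note * = X g mor[OF g] mor[of ?k]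
    obtain u where u: "u \<in> mor C X (T \<one> X)" "cmp C X (T \<one> X) X (unitor A X) u = idm C X"
      "cmp C (T \<one> X) X (T \<one> X) u (unitor A X) = idm C (T \<one> X)"
      using unitor_iso[OF X] by (rule is_isoE)
    let ?r = "cmp C X (T \<one> X) (T g X)
      (cmp C (T \<one> X) (T g (T ?k X)) (T g X) (M g (T ?k X) X (\<psi> ?k)) (asc A g ?k X)) u"
    have asc: "asc A g ?k X \<in> mor C (T \<one> X) (T g (T ?k X))"
      "asc A ?k g X \<in> mor C (T \<one> X) (T ?k (T g X))"
      "is_iso C (T \<one> X) (T ?k (T g X)) (asc A ?k g X)"
      using * asc_mor[of g ?k X] asc_mor[of ?k g X] asc_iso[of ?k g X] by simp_all
    have "unitor A X = cmp C (T \<one> X) (T g X) X (\<psi> g)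
        (cmp C (T \<one> X) (T g (T ?k X)) (T g X) (M g (T ?k X) X (\<psi> ?k)) (asc A g ?k X))"
      using cocycle[of g ?k] unit g by simp
    then have "cmp C X (T g X) X (\<psi> g) ?r = cmp C X (T \<one> X) X (unitor A X) u"
      using * asc u by simp
    then have "cmp C X (T g X) X (\<psi> g) ?r = idm C X" using u by simp
    moreover obtain a where a: "a \<in> mor C (T ?k (T g X)) (T \<one> X)"
      "cmp C (T ?k (T g X)) (T \<one> X) (T ?k (T g X)) (asc A ?k g X) a = idm C (T ?k (T g X))"
      using asc(3) by (rule is_isoE)
    have "cmp C (T \<one> X) (T ?k X) X (\<psi> ?k)
        (cmp C (T \<one> X) (T ?k (T g X)) (T ?k X) (M ?k (T g X) X (\<psi> g)) (asc A ?k g X)) = unitor A X"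
      using cocycle[of ?k g] unit g by simp
    then have "cmp C (T ?k (T g X)) (T \<one> X) X (cmp C (T \<one> X) (T ?k X) X (\<psi> ?k)
        (cmp C (T \<one> X) (T ?k (T g X)) (T ?k X) (M ?k (T g X) X (\<psi> g)) (asc A ?k g X))) a
      = cmp C (T ?k (T g X)) (T \<one> X) X (unitor A X) a"
      by (simp only:)
    then have eq: "cmp C (T ?k (T g X)) (T ?k X) X (\<psi> ?k) (M ?k (T g X) X (\<psi> g))
      = cmp C (T ?k (T g X)) (T \<one> X) X (unitor A X) a"
      using * asc a by simp
    \<comment> \<open>By \<open>eq\<close>, \<open>\<psi> ?k\<close> after the image of
      \<open>\<psi> g\<close> is the isomorphism \<open>unitor\<close> after \<open>a\<close>; its
      inverse is \<open>asc\<close> after \<open>u\<close>.\<close>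
    let ?l = "cmp C (T ?k X) (T \<one> X) (T ?k (T g X)) (asc A ?k g X) (cmp C (T ?k X) X (T \<one> X) u (\<psi> ?k))"
    have "cmp C (T ?k (T g X)) (T ?k X) (T ?k (T g X)) ?l (M ?k (T g X) X (\<psi> g))
        = idm C (T ?k (T g X))"
      using * asc a u eq cmp_eq_tail1[OF u(3)] by simp
    ultimately show ?thesis
      using is_iso_if_section[of ?k "T g X" X "\<psi> g" ?r ?l] * asc u by simp
  qed
  then show ?thesis
    using assms by (auto simp: equivariant_objects_def PiE_def)
qed

text \<open>The coaction law at \<open>g\<close>, \<open>inv g\<close> gives a left inverse of
  \<open>t g\<close>, and at \<open>inv g\<close>, \<open>g\<close> a right inverse of its image
  under \<open>inv g \<otimes> -\<close>, so \<open>t g\<close> is invertible. Inverting both sides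
  of the coaction law produces the cocycle condition.\<close>

lemma equivariant_object_of_coaction:
  assumes N: "N \<in> ob C" and mor: "\<And>g. g \<in> carrier G \<Longrightarrow> t g \<in> mor C N (T g N)"
    and coaction: "\<And>g h. \<lbrakk>g \<in> carrier G; h \<in> carrier G\<rbrakk> \<Longrightarrow>
      cmp C N (T (g \<otimes> h) N) (T g (T h N)) (asc A g h N) (t (g \<otimes> h))
        = cmp C N (T g N) (T g (T h N)) (M g N (T h N) (t h)) (t g)"
    and counit: "cmp C N (T \<one> N) N (unitor A N) (t \<one>) = idm C N"
  shows "\<exists>\<phi>. (N, \<phi>) \<in> equivariant_objects C G A \<and> (\<forall>g \<in> carrier G.
    cmp C N (T g N) N (\<phi> g) (t g) = idm C N \<and> cmp C (T g N) N (T g N) (t g) (\<phi> g) = idm C (T g N))"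
proof -
  have "is_iso C N (T g N) (t g)" if g: "g \<in> carrier G" for g
  proof -
    let ?k = "inv g"
    note * = N g mor[OF g] mor[of ?k] mor[of \<one>]
    obtain u where u: "u \<in> mor C N (T \<one> N)" "cmp C (T \<one> N) N (T \<one> N) u (unitor A N) = idm C (T \<one> N)"
      using unitor_iso[OF N] by (rule is_isoE)
    have asc: "asc A g ?k N \<in> mor C (T \<one> N) (T g (T ?k N))"
      "asc A ?k g N \<in> mor C (T \<one> N) (T ?k (T g N))"
      "is_iso C (T \<one> N) (T g (T ?k N)) (asc A g ?k N)"
      "is_iso C (T \<one> N) (T ?k (T g N)) (asc A ?k g N)"
      using * asc_mor[of g ?k N] asc_mor[of ?k g N] asc_iso[of g ?k N] asc_iso[of ?k g N] by simp_all
    obtain a where a: "a \<in> mor C (T g (T ?k N)) (T \<one> N)"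
      "cmp C (T \<one> N) (T g (T ?k N)) (T \<one> N) a (asc A g ?k N) = idm C (T \<one> N)"
      using asc(3) by (rule is_isoE)
    obtain b where b: "b \<in> mor C (T ?k (T g N)) (T \<one> N)"
      "cmp C (T ?k (T g N)) (T \<one> N) (T ?k (T g N)) (asc A ?k g N) b = idm C (T ?k (T g N))"
      using asc(4) by (rule is_isoE)
    \<comment> \<open>The image of \<open>t ?k\<close> after \<open>t g\<close> equals
      \<open>asc\<close> after \<open>t \<one>\<close>; this is undone by \<open>a\<close>, followed
      by the unitor through the counit law.\<close>
    let ?l = "cmp C (T g N) (T \<one> N) N (unitor A N)
      (cmp C (T g N) (T g (T ?k N)) (T \<one> N) a (M g N (T ?k N) (t ?k)))"
    have "cmp C N (T g N) (T g (T ?k N)) (M g N (T ?k N) (t ?k)) (t g)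
        = cmp C N (T \<one> N) (T g (T ?k N)) (asc A g ?k N) (t \<one>)"
      using coaction[of g ?k] g by simp
    then have l: "cmp C N (T g N) N ?l (t g) = idm C N"
      using * asc a counit cmp_eq_tail1[OF a(2), of N] by simp
    let ?r = "cmp C (T ?k (T g N)) N (T ?k N) (t ?k)
      (cmp C (T ?k (T g N)) (T \<one> N) N (unitor A N) b)"
    \<comment> \<open>The counit law makes \<open>t \<one>\<close> a right inverse of the unitor,
      whose left inverse is \<open>u\<close>.\<close>
    have "t \<one> = u" using * u(1) counit cmp_eq_tail1[OF u(2), of N "t \<one>"] by simp
    then have "cmp C N (T ?k N) (T ?k (T g N)) (M ?k N (T g N) (t g)) (t ?k)
        = cmp C N (T \<one> N) (T ?k (T g N)) (asc A ?k g N) u"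
      using coaction[of ?k g] g by simp
    then have "cmp C (T ?k (T g N)) (T ?k N) (T ?k (T g N)) (M ?k N (T g N) (t g)) ?r
        = idm C (T ?k (T g N))"
      using * asc b u cmp_eq_tail[of N "T ?k N" "T ?k (T g N)" "M ?k N (T g N) (t g)" "t ?k" "T \<one> N"
          "asc A ?k g N" u "T ?k (T g N)"] cmp_eq_tail1[OF u(2), of "T ?k (T g N)"] by simp
    with l show ?thesis
      using is_iso_if_retraction[of ?k N "T g N" "t g" ?l ?r] * asc a b by simp
  qed
  then have "\<forall>g \<in> carrier G. \<exists>p. p \<in> mor C (T g N) N \<and>
    cmp C N (T g N) N p (t g) = idm C N \<and> cmp C (T g N) N (T g N) (t g) p = idm C (T g N)"
    unfolding is_iso_def by blast
  from bchoice[OF this] obtain p where p: "\<And>g. g \<in> carrier G \<Longrightarrow> p g \<in> mor C (T g N) N"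
    "\<And>g. g \<in> carrier G \<Longrightarrow> cmp C N (T g N) N (p g) (t g) = idm C N"
    "\<And>g. g \<in> carrier G \<Longrightarrow> cmp C (T g N) N (T g N) (t g) (p g) = idm C (T g N)"
    by blast
  define \<phi> where "\<phi> = restrict p (carrier G)"
  have \<phi>: "\<phi> g = p g" if "g \<in> carrier G" for g using that by (simp add: \<phi>_def)
  have "(N, \<phi>) \<in> equivariant_objects C G A"
  proof (rule equivariant_objectI)
    fix g h assume gh: "g \<in> carrier G" "h \<in> carrier G"
    note * = N gh mor[of g] mor[of h] mor[of "g \<otimes> h"] p(1)[of g] p(1)[of h] p(1)[of "g \<otimes> h"]
    \<comment> \<open>The right side of the cocycle condition. It is shown to be a left inverse of
      \<open>t (g \<otimes> h)\<close>, and so to agree with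
      \<open>p (g \<otimes> h)\<close>.\<close>
    let ?q = "cmp C (T (g \<otimes> h) N) (T g N) N (p g)
      (cmp C (T (g \<otimes> h) N) (T g (T h N)) (T g N) (M g (T h N) N (p h)) (asc A g h N))"
    have "M g N N (cmp C N (T h N) N (p h) (t h)) = M g N N (idm C N)" using p(2)[OF gh(2)] by simp
    then have "cmp C (T g N) (T g (T h N)) (T g N) (M g (T h N) N (p h)) (M g N (T h N) (t h))
        = idm C (T g N)"
      using * by simp
    then have "cmp C N (T (g \<otimes> h) N) N ?q (t (g \<otimes> h)) = idm C N"
      using * p(2)[OF gh(1)] coaction[OF gh]
        cmp_eq_tail1[of "T g N" "T g (T h N)" "T g N" "M g (T h N) N (p h)" "M g N (T h N) (t h)"
          "idm C (T g N)" N "t g"] by simp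
    then have "cmp C (T (g \<otimes> h) N) N N (cmp C N (T (g \<otimes> h) N) N ?q (t (g \<otimes> h))) (p (g \<otimes> h))
        = p (g \<otimes> h)"
      using * by simp
    then have "?q = p (g \<otimes> h)" using * p(3)[of "g \<otimes> h"] by simp
    then show "\<phi> (g \<otimes> h) = cmp C (T (g \<otimes> h) N) (T g N) N (\<phi> g)
      (cmp C (T (g \<otimes> h) N) (T g (T h N)) (T g N) (M g (T h N) N (\<phi> h)) (asc A g h N))"
      using gh \<phi> by simp
  next
    have "cmp C (T \<one> N) N N (cmp C N (T \<one> N) N (unitor A N) (t \<one>)) (p \<one>) = p \<one>"
      using N p(1)[of \<one>] counit by simp
    then have "unitor A N = p \<one>"
      using N p(1)[of \<one>] p(3)[of \<one>] mor[of \<one>] by simp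
    then show "\<phi> \<one> = unitor A N" by (simp add: \<phi>)
  qed (use N p(1) \<phi> in \<open>simp_all add: \<phi>_def\<close>)
  then show ?thesis using \<phi> p by auto
qed

text \<open>The leg equation moves \<open>u\<close> past each \<open>\<phi>\<close>, turning both
  sides into composites with \<open>\<psi>\<close>; there the cocycle condition of \<open>X\<close>
  and naturality of \<open>asc\<close> apply. A jointly monic pair of such legs yields the cocycle
  condition on \<open>N\<close>.\<close>

lemma cocycle_at_leg:
  assumes X: "(X, \<psi>) \<in> equivariant_objects C G A" and N: "N \<in> ob C" and u: "u \<in> mor C N X"
    and mor: "\<And>g. g \<in> carrier G \<Longrightarrow> \<phi> g \<in> mor C (T g N) N"
    and leg: "\<And>g. g \<in> carrier G \<Longrightarrow>
      cmp C (T g N) N X u (\<phi> g) = cmp C (T g N) (T g X) X (\<psi> g) (M g N X u)"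
    and gh: "g \<in> carrier G" "h \<in> carrier G"
  shows "cmp C (T (g \<otimes> h) N) N X u (\<phi> (g \<otimes> h)) = cmp C (T (g \<otimes> h) N) N X u
    (cmp C (T (g \<otimes> h) N) (T g N) N (\<phi> g)
      (cmp C (T (g \<otimes> h) N) (T g (T h N)) (T g N) (M g (T h N) N (\<phi> h)) (asc A g h N)))"
proof -
  note \<psi> = equivariant_objectD[OF X]
  note * = N u gh mor[of g] mor[of h] mor[of "g \<otimes> h"] \<psi>(1) \<psi>(2)[of g] \<psi>(2)[of h] \<psi>(2)[of "g \<otimes> h"]
  have "M g (T h N) X (cmp C (T h N) N X u (\<phi> h))
      = M g (T h N) X (cmp C (T h N) (T h X) X (\<psi> h) (M h N X u))"
    using leg[OF gh(2)] by simp
  then have gleg: "cmp C (T g (T h N)) (T g N) (T g X) (M g N X u) (M g (T h N) N (\<phi> h))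
      = cmp C (T g (T h N)) (T g (T h X)) (T g X) (M g (T h X) X (\<psi> h)) (M g (T h N) (T h X) (M h N X u))"
    using * by simp
  have "cmp C (T (g \<otimes> h) N) N X u (\<phi> (g \<otimes> h))
      = cmp C (T (g \<otimes> h) N) (T (g \<otimes> h) X) X (\<psi> (g \<otimes> h)) (M (g \<otimes> h) N X u)"
    using leg gh by simp
  also have "\<dots> = cmp C (T (g \<otimes> h) N) (T g X) X (\<psi> g)
      (cmp C (T (g \<otimes> h) N) (T g (T h X)) (T g X) (M g (T h X) X (\<psi> h))
        (cmp C (T (g \<otimes> h) N) (T (g \<otimes> h) X) (T g (T h X)) (asc A g h X) (M (g \<otimes> h) N X u)))"
    using * \<psi>(4)[OF gh] by simp
  also have "\<dots> = cmp C (T (g \<otimes> h) N) (T g X) X (\<psi> g)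
      (cmp C (T (g \<otimes> h) N) (T g (T h X)) (T g X) (M g (T h X) X (\<psi> h))
        (cmp C (T (g \<otimes> h) N) (T g (T h N)) (T g (T h X)) (M g (T h N) (T h X) (M h N X u))
          (asc A g h N)))"
    using * asc_natural[OF gh _ _ u] by simp
  also have "\<dots> = cmp C (T (g \<otimes> h) N) (T g X) X (\<psi> g)
      (cmp C (T (g \<otimes> h) N) (T g N) (T g X) (M g N X u)
        (cmp C (T (g \<otimes> h) N) (T g (T h N)) (T g N) (M g (T h N) N (\<phi> h)) (asc A g h N)))"
    using * cmp_eq_tail[OF gleg] by simp
  also have "\<dots> = cmp C (T (g \<otimes> h) N) N X u (cmp C (T (g \<otimes> h) N) (T g N) N (\<phi> g)
      (cmp C (T (g \<otimes> h) N) (T g (T h N)) (T g N) (M g (T h N) N (\<phi> h)) (asc A g h N)))"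
    using * cmp_eq_tail[OF leg[OF gh(1)]] by simp
  finally show ?thesis .
qed

text \<open>The leg hypothesis says, without naming an inverse of \<open>\<psi> g\<close>, that
  \<open>t g\<close> after \<open>u\<close> is the image of \<open>u\<close> after that inverse. To
  use it the two sides are compared after precomposing with the isomorphism
  \<open>\<psi> (g \<otimes> h)\<close>.\<close>

lemma coaction_at_leg:
  assumes X: "(X, \<psi>) \<in> equivariant_objects C G A" and N: "N \<in> ob C" and u: "u \<in> mor C X N"
    and mor: "\<And>g. g \<in> carrier G \<Longrightarrow> t g \<in> mor C N (T g N)"
    and leg: "\<And>g. g \<in> carrier G \<Longrightarrow>
      cmp C (T g X) N (T g N) (t g) (cmp C (T g X) X N u (\<psi> g)) = M g X N u"
    and gh: "g \<in> carrier G" "h \<in> carrier G"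
  shows "cmp C X N (T g (T h N)) (cmp C N (T (g \<otimes> h) N) (T g (T h N)) (asc A g h N) (t (g \<otimes> h))) u
    = cmp C X N (T g (T h N)) (cmp C N (T g N) (T g (T h N)) (M g N (T h N) (t h)) (t g)) u"
proof (rule iso_cancel_right[OF equivariant_objectD(3)[OF X, of "g \<otimes> h"]])
  note \<psi> = equivariant_objectD[OF X]
  note * = N u gh mor[of g] mor[of h] mor[of "g \<otimes> h"] \<psi>(1) \<psi>(2)[of g] \<psi>(2)[of h] \<psi>(2)[of "g \<otimes> h"]
  show "g \<otimes> h \<in> carrier G" "T (g \<otimes> h) X \<in> ob C" "X \<in> ob C" "T g (T h N) \<in> ob C"
    "cmp C X N (T g (T h N)) (cmp C N (T (g \<otimes> h) N) (T g (T h N)) (asc A g h N) (t (g \<otimes> h))) u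
      \<in> mor C X (T g (T h N))"
    "cmp C X N (T g (T h N)) (cmp C N (T g N) (T g (T h N)) (M g N (T h N) (t h)) (t g)) u
      \<in> mor C X (T g (T h N))"
    using * by simp_all
  have "M g (T h X) (T h N) (cmp C (T h X) N (T h N) (t h) (cmp C (T h X) X N u (\<psi> h)))
      = M g (T h X) (T h N) (M h X N u)"
    using leg[OF gh(2)] by simp
  then have gleg: "cmp C (T g (T h X)) (T g N) (T g (T h N)) (M g N (T h N) (t h))
      (cmp C (T g (T h X)) (T g X) (T g N) (M g X N u) (M g (T h X) X (\<psi> h)))
    = M g (T h X) (T h N) (M h X N u)"
    using * by simp
  let ?a = "asc A g h X"
  let ?\<psi>h = "cmp C (T (g \<otimes> h) X) (T g (T h X)) (T g X) (M g (T h X) X (\<psi> h)) ?a"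
  have "cmp C (T (g \<otimes> h) X) X (T g (T h N))
      (cmp C X N (T g (T h N)) (cmp C N (T (g \<otimes> h) N) (T g (T h N)) (asc A g h N) (t (g \<otimes> h))) u)
      (\<psi> (g \<otimes> h))
    = cmp C (T (g \<otimes> h) X) (T (g \<otimes> h) N) (T g (T h N)) (asc A g h N) (M (g \<otimes> h) X N u)"
    using * leg[of "g \<otimes> h"] by simp
  also have "\<dots> = cmp C (T (g \<otimes> h) X) (T g (T h X)) (T g (T h N)) (M g (T h X) (T h N) (M h X N u)) ?a"
    using * asc_natural[OF gh _ _ u] by simp
  also have "\<dots> = cmp C (T (g \<otimes> h) X) (T g N) (T g (T h N)) (M g N (T h N) (t h))
      (cmp C (T (g \<otimes> h) X) (T g X) (T g N) (M g X N u) ?\<psi>h)"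
    unfolding gleg[symmetric] using * by simp
  also have "\<dots> = cmp C (T (g \<otimes> h) X) (T g N) (T g (T h N)) (M g N (T h N) (t h))
      (cmp C (T (g \<otimes> h) X) (T g X) (T g N)
        (cmp C (T g X) N (T g N) (t g) (cmp C (T g X) X N u (\<psi> g))) ?\<psi>h)"
    unfolding leg[OF gh(1)] by (rule refl)
  also have "\<dots> = cmp C (T (g \<otimes> h) X) X (T g (T h N))
      (cmp C X N (T g (T h N)) (cmp C N (T g N) (T g (T h N)) (M g N (T h N) (t h)) (t g)) u)
      (\<psi> (g \<otimes> h))"
    using * \<psi>(4)[OF gh] by simp
  finally show "cmp C (T (g \<otimes> h) X) X (T g (T h N))
      (cmp C X N (T g (T h N)) (cmp C N (T (g \<otimes> h) N) (T g (T h N)) (asc A g h N) (t (g \<otimes> h))) u)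
      (\<psi> (g \<otimes> h))
    = cmp C (T (g \<otimes> h) X) X (T g (T h N))
      (cmp C X N (T g (T h N)) (cmp C N (T g N) (T g (T h N)) (M g N (T h N) (t h)) (t g)) u)
      (\<psi> (g \<otimes> h))" .
qed

lemma equivariant_mor_iff:
  "f \<in> equivariant_mor C G A (X, \<psi>) (Y, \<chi>) \<longleftrightarrow> f \<in> mor C X Y \<and> (\<forall>g \<in> carrier G.
    cmp C (T g X) X Y f (\<psi> g) = cmp C (T g X) (T g Y) Y (\<chi> g) (M g X Y f))"
  by (simp add: equivariant_mor_def)

text \<open>The maps \<open>t\<close> for different group elements may be chosen independently:
  joint monicity makes each of them unique, and it cancels the legs from the cocycle and unit
  laws.\<close>

lemma lift_along_jointly_monic:
  assumes X: "(X, \<psi>) \<in> equivariant_objects C G A" and Y: "(Y, \<chi>) \<in> equivariant_objects C G A"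
    and N: "N \<in> ob C" and u: "u \<in> mor C N X" and v: "v \<in> mor C N Y"
    and monic: "jointly_monic N X Y u v"
    and lift: "\<And>g. g \<in> carrier G \<Longrightarrow> \<exists>t \<in> mor C (T g N) N.
      cmp C (T g N) N X u t = cmp C (T g N) (T g X) X (\<psi> g) (M g N X u) \<and>
      cmp C (T g N) N Y v t = cmp C (T g N) (T g Y) Y (\<chi> g) (M g N Y v)"
  shows "\<exists>\<phi>. (N, \<phi>) \<in> equivariant_objects C G A \<and>
    u \<in> equivariant_mor C G A (N, \<phi>) (X, \<psi>) \<and> v \<in> equivariant_mor C G A (N, \<phi>) (Y, \<chi>)"
proof -
  obtain t where t: "\<And>g. g \<in> carrier G \<Longrightarrow> t g \<in> mor C (T g N) N \<and>
      cmp C (T g N) N X u (t g) = cmp C (T g N) (T g X) X (\<psi> g) (M g N X u) \<and>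
      cmp C (T g N) N Y v (t g) = cmp C (T g N) (T g Y) Y (\<chi> g) (M g N Y v)"
    using lift by metis
  define \<phi> where "\<phi> = restrict t (carrier G)"
  have \<phi>: "\<phi> g \<in> mor C (T g N) N"
    and legu: "cmp C (T g N) N X u (\<phi> g) = cmp C (T g N) (T g X) X (\<psi> g) (M g N X u)"
    and legv: "cmp C (T g N) N Y v (\<phi> g) = cmp C (T g N) (T g Y) Y (\<chi> g) (M g N Y v)"
    if "g \<in> carrier G" for g
    using t[OF that] that by (simp_all add: \<phi>_def)
  note ob = equivariant_objectD(1)[OF X] equivariant_objectD(1)[OF Y]
  have cancel: "a = b" if "W \<in> ob C" "a \<in> mor C W N" "b \<in> mor C W N"
    "cmp C W N X u a = cmp C W N X u b" "cmp C W N Y v a = cmp C W N Y v b" for W a b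
    using monic that by (simp add: jointly_monic_def)
  have "(N, \<phi>) \<in> equivariant_objects C G A"
  proof (rule equivariant_objectI)
    fix g h assume gh: "g \<in> carrier G" "h \<in> carrier G"
    show "\<phi> (g \<otimes> h) = cmp C (T (g \<otimes> h) N) (T g N) N (\<phi> g)
        (cmp C (T (g \<otimes> h) N) (T g (T h N)) (T g N) (M g (T h N) N (\<phi> h)) (asc A g h N))"
      by (rule cancel[OF _ _ _ cocycle_at_leg[OF X N u \<phi> legu gh] cocycle_at_leg[OF Y N v \<phi> legv gh]])
        (use N gh \<phi>[of g] \<phi>[of h] \<phi>[of "g \<otimes> h"] in simp_all)
  next
    show "\<phi> \<one> = unitor A N"
    proof (rule cancel)
      show "cmp C (T \<one> N) N X u (\<phi> \<one>) = cmp C (T \<one> N) N X u (unitor A N)"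
        using unitor_natural[OF N ob(1) u] legu[of \<one>] equivariant_objectD(5)[OF X] by simp
      show "cmp C (T \<one> N) N Y v (\<phi> \<one>) = cmp C (T \<one> N) N Y v (unitor A N)"
        using unitor_natural[OF N ob(2) v] legv[of \<one>] equivariant_objectD(5)[OF Y] by simp
    qed (use N \<phi> in simp_all)
  qed (use N \<phi> in \<open>simp_all add: \<phi>_def\<close>)
  then show ?thesis using u v legu legv by (auto simp: equivariant_mor_iff)
qed

text \<open>Here the maps \<open>N \<rightarrow> g \<otimes> N\<close> inverse to the structure maps are lifted: they can be obtained from
  the universal property of \<open>N\<close>, whereas maps out of \<open>g \<otimes> N\<close> would require that \<open>g \<otimes> -\<close> preserves it.\<close>

lemma lift_along_jointly_epic:
  assumes X: "(X, \<psi>) \<in> equivariant_objects C G A" and Y: "(Y, \<chi>) \<in> equivariant_objects C G A"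
    and N: "N \<in> ob C" and u: "u \<in> mor C X N" and v: "v \<in> mor C Y N"
    and epic: "jointly_epic X Y N u v"
    and lift: "\<And>g. g \<in> carrier G \<Longrightarrow> \<exists>t \<in> mor C N (T g N).
      cmp C (T g X) N (T g N) t (cmp C (T g X) X N u (\<psi> g)) = M g X N u \<and>
      cmp C (T g Y) N (T g N) t (cmp C (T g Y) Y N v (\<chi> g)) = M g Y N v"
  shows "\<exists>\<phi>. (N, \<phi>) \<in> equivariant_objects C G A \<and>
    u \<in> equivariant_mor C G A (X, \<psi>) (N, \<phi>) \<and> v \<in> equivariant_mor C G A (Y, \<chi>) (N, \<phi>)"
proof -
  obtain t where t: "\<And>g. g \<in> carrier G \<Longrightarrow> t g \<in> mor C N (T g N)"
    and legu: "\<And>g. g \<in> carrier G \<Longrightarrow>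
      cmp C (T g X) N (T g N) (t g) (cmp C (T g X) X N u (\<psi> g)) = M g X N u"
    and legv: "\<And>g. g \<in> carrier G \<Longrightarrow>
      cmp C (T g Y) N (T g N) (t g) (cmp C (T g Y) Y N v (\<chi> g)) = M g Y N v"
    using lift by metis
  note ob = equivariant_objectD(1)[OF X] equivariant_objectD(1)[OF Y]
  have cancel: "a = b" if "W \<in> ob C" "a \<in> mor C N W" "b \<in> mor C N W"
    "cmp C X N W a u = cmp C X N W b u" "cmp C Y N W a v = cmp C Y N W b v" for W a b
    using epic that by (simp add: jointly_epic_def)
  \<comment> \<open>Tested after a leg \<open>w\<close> and the isomorphism
    \<open>\<omega> \<one>\<close>. The latter is the unitor of \<open>Z\<close>, so naturality of
    the unitor closes the comparison.\<close>
  have counit: "cmp C Z N N (cmp C N (T \<one> N) N (unitor A N) (t \<one>)) w = cmp C Z N N (idm C N) w"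
    if Z: "(Z, \<omega>) \<in> equivariant_objects C G A" and w: "w \<in> mor C Z N"
      and leg: "cmp C (T \<one> Z) N (T \<one> N) (t \<one>) (cmp C (T \<one> Z) Z N w (\<omega> \<one>)) = M \<one> Z N w"
    for Z \<omega> w
  proof (rule iso_cancel_right[OF equivariant_objectD(3)[OF Z, of \<one>]])
    note \<omega> = equivariant_objectD[OF Z]
    show "cmp C (T \<one> Z) Z N (cmp C Z N N (cmp C N (T \<one> N) N (unitor A N) (t \<one>)) w) (\<omega> \<one>)
        = cmp C (T \<one> Z) Z N (cmp C Z N N (idm C N) w) (\<omega> \<one>)"
      using \<omega>(1) \<omega>(2)[of \<one>] N w t[of \<one>] leg unitor_natural[OF \<omega>(1) N w] \<omega>(5) by simp
  qed (use equivariant_objectD(1)[OF Z] N w t[of \<one>] in simp_all)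
  have "\<exists>\<phi>. (N, \<phi>) \<in> equivariant_objects C G A \<and> (\<forall>g \<in> carrier G.
    cmp C N (T g N) N (\<phi> g) (t g) = idm C N \<and> cmp C (T g N) N (T g N) (t g) (\<phi> g) = idm C (T g N))"
  proof (rule equivariant_object_of_coaction[OF N t])
    fix g h assume gh: "g \<in> carrier G" "h \<in> carrier G"
    show "cmp C N (T (g \<otimes> h) N) (T g (T h N)) (asc A g h N) (t (g \<otimes> h))
        = cmp C N (T g N) (T g (T h N)) (M g N (T h N) (t h)) (t g)"
      by (rule cancel[OF _ _ _ coaction_at_leg[OF X N u t legu gh] coaction_at_leg[OF Y N v t legv gh]])
        (use N gh t[of g] t[of h] t[of "g \<otimes> h"] in simp_all)
  next
    show "cmp C N (T \<one> N) N (unitor A N) (t \<one>) = idm C N"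
      by (rule cancel[OF _ _ _ counit[OF X u legu] counit[OF Y v legv]])
        (use N t[of \<one>] in simp_all)
  qed
  then obtain \<phi> where \<phi>: "(N, \<phi>) \<in> equivariant_objects C G A"
    "\<And>g. g \<in> carrier G \<Longrightarrow> cmp C N (T g N) N (\<phi> g) (t g) = idm C N"
    by blast
  \<comment> \<open>Apply \<open>\<phi> g\<close> to the leg equation; it cancels \<open>t g\<close>
    and leaves equivariance of \<open>w\<close>.\<close>
  have "cmp C (T g Z) Z N w (\<omega> g) = cmp C (T g Z) (T g N) N (\<phi> g) (M g Z N w)"
    if Z: "(Z, \<omega>) \<in> equivariant_objects C G A" and w: "w \<in> mor C Z N" and g: "g \<in> carrier G"
      and leg: "cmp C (T g Z) N (T g N) (t g) (cmp C (T g Z) Z N w (\<omega> g)) = M g Z N w"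
    for Z \<omega> w g
    unfolding leg[symmetric]
    using equivariant_objectD(1)[OF Z] equivariant_objectD(2)[OF Z g] N w g t[OF g]
      equivariant_objectD(2)[OF \<phi>(1) g] cmp_eq_tail1[OF \<phi>(2)[OF g]] by simp
  then show ?thesis using X Y u v legu legv \<phi>(1) by (auto simp: equivariant_mor_iff)
qed

end

section \<open>The equivariant category\<close>

context category_action
begin

abbreviation "CG \<equiv> equivariant_category C G A"

lemma equivariant_category_simps [simp]:
  "ob CG = equivariant_objects C G A" "mor CG P Q = equivariant_mor C G A P Q"
  "idm CG P = idm C (fst P)" "cmp CG P Q R = cmp C (fst P) (fst Q) (fst R)"
  "add (homs CG P Q) = add (homs C (fst P) (fst Q))"
  "zero (homs CG P Q) = zero (homs C (fst P) (fst Q))"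
  "smult (homs CG P Q) = smult (homs C (fst P) (fst Q))"
  by (simp_all add: equivariant_category_def)

lemma equivariant_morD:
  assumes "f \<in> equivariant_mor C G A (X, \<psi>) (Y, \<chi>)"
  shows "f \<in> mor C X Y"
    and "g \<in> carrier G \<Longrightarrow> cmp C (T g X) X Y f (\<psi> g) = cmp C (T g X) (T g Y) Y (\<chi> g) (M g X Y f)"
  using assms by (simp_all add: equivariant_mor_iff)

text \<open>Composition and \<open>M g\<close> are linear, hence so is the equivariance condition.
  Both linearity and Hom-finiteness of \<open>CG\<close> come from here.\<close>

lemma equivariant_mor_subspace:
  assumes X: "(X, \<psi>) \<in> equivariant_objects C G A" and Y: "(Y, \<chi>) \<in> equivariant_objects C G A"
  shows "VectorSpace.subspace K (equivariant_mor C G A (X, \<psi>) (Y, \<chi>)) (homs C X Y)"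
proof -
  note \<psi> = equivariant_objectD[OF X] and \<chi> = equivariant_objectD[OF Y]
  interpret V: vectorspace K "homs C X Y" using \<psi>(1) \<chi>(1) by (rule homs_vectorspace)
  have "LinearCombinations.submodule K (equivariant_mor C G A (X, \<psi>) (Y, \<chi>)) (homs C X Y)"
    by standard
      (use \<psi>(1,2) \<chi>(1,2) in \<open>auto simp: equivariant_mor_iff cmp_add_left cmp_add_right
        cmp_smult_left cmp_smult_right\<close>)
  then show ?thesis using V.vectorspace_axioms by (simp add: VectorSpace.subspace_def)
qed

lemma homs_CG:
  "homs CG (X, \<psi>) (Y, \<chi>) = (homs C X Y)\<lparr>carrier := equivariant_mor C G A (X, \<psi>) (Y, \<chi>)\<rparr>"
  by (simp add: equivariant_category_def)

lemma cmp_equivariant: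
  assumes X: "(X, \<psi>) \<in> equivariant_objects C G A" and Y: "(Y, \<chi>) \<in> equivariant_objects C G A"
    and Z: "(Z, \<omega>) \<in> equivariant_objects C G A"
    and f: "f \<in> equivariant_mor C G A (X, \<psi>) (Y, \<chi>)" and h: "h \<in> equivariant_mor C G A (Y, \<chi>) (Z, \<omega>)"
  shows "cmp C X Y Z h f \<in> equivariant_mor C G A (X, \<psi>) (Z, \<omega>)"
  unfolding equivariant_mor_iff
proof (intro conjI ballI)
  note \<psi> = equivariant_objectD[OF X] and \<chi> = equivariant_objectD[OF Y]
    and \<omega> = equivariant_objectD[OF Z]
  note * = \<psi>(1) \<chi>(1) \<omega>(1) equivariant_morD(1)[OF f] equivariant_morD(1)[OF h]
  show "cmp C X Y Z h f \<in> mor C X Z" using * by simp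
  fix g assume g: "g \<in> carrier G"
  show "cmp C (T g X) X Z (cmp C X Y Z h f) (\<psi> g)
      = cmp C (T g X) (T g Z) Z (\<omega> g) (M g X Z (cmp C X Y Z h f))"
    using * g \<psi>(2)[OF g] \<chi>(2)[OF g] \<omega>(2)[OF g] equivariant_morD(2)[OF f g]
      cmp_eq_tail[OF equivariant_morD(2)[OF h g]] by simp
qed

lemma idm_equivariant:
  "(X, \<psi>) \<in> equivariant_objects C G A \<Longrightarrow> idm C X \<in> equivariant_mor C G A (X, \<psi>) (X, \<psi>)"
  using equivariant_objectD(1,2)[of X \<psi>] by (simp add: equivariant_mor_iff)

lemma k_linear_CG: "k_linear_category K CG"
proof (rule k_linear_category.intro)
  show "field K" by (rule k_linear_category.axioms(1)[OF k_linear_category_axioms])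
  have ob: "fst P \<in> ob C" if "P \<in> equivariant_objects C G A" for P
    using that equivariant_objectD(1) by (cases P) auto
  have mor: "f \<in> mor C (fst P) (fst Q)" if "f \<in> equivariant_mor C G A P Q" for f P Q
    using that by (cases P; cases Q) (auto simp: equivariant_mor_iff)
  show "k_linear_category_axioms K CG"
  proof (rule k_linear_category_axioms.intro, unfold equivariant_category_simps)
    fix P Q assume "P \<in> equivariant_objects C G A" "Q \<in> equivariant_objects C G A"
    then show "vectorspace K (homs CG P Q)"
      using vectorspace.subspace_is_vs[OF homs_vectorspace equivariant_mor_subspace] ob
      by (cases P; cases Q) (auto simp: homs_CG)
  next
    fix P assume "P \<in> equivariant_objects C G A"
    then show "idm C (fst P) \<in> equivariant_mor C G A P P"
      by (cases P) (simp add: idm_equivariant)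
  next
    fix P Q R f h
    assume "P \<in> equivariant_objects C G A" "Q \<in> equivariant_objects C G A"
      "R \<in> equivariant_objects C G A" "f \<in> equivariant_mor C G A P Q" "h \<in> equivariant_mor C G A Q R"
    then show "cmp C (fst P) (fst Q) (fst R) h f \<in> equivariant_mor C G A P R"
      by (cases P; cases Q; cases R) (auto intro: cmp_equivariant)
  qed (simp_all add: ob mor cmp_add_left cmp_add_right cmp_smult_left cmp_smult_right)
qed

lemma hom_finite_CG:
  assumes "hom_finite K C"
  shows "hom_finite K CG"
  unfolding hom_finite_def equivariant_category_simps
proof (intro ballI)
  fix P Q assume *: "P \<in> equivariant_objects C G A" "Q \<in> equivariant_objects C G A"
  obtain X \<psi> Y \<chi> where PQ: "P = (X, \<psi>)" "Q = (Y, \<chi>)" by (cases P; cases Q)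
  have "X \<in> ob C" "Y \<in> ob C" using * equivariant_objectD(1) by (auto simp: PQ)
  then show "vectorspace.fin_dim K (homs CG P Q)"
    using assms * unfolding PQ homs_CG hom_finite_def
    by (intro vectorspace.subspace_fin_dim equivariant_mor_subspace homs_vectorspace) auto
qed

text \<open>Shows that morphisms supplied by a universal property in \<open>C\<close> are
  equivariant: the two sides of the condition on \<open>w\<close> agree after \<open>u\<close> and
  after \<open>v\<close>.\<close>

lemma equivariant_if_jointly_monic:
  assumes X: "(X, \<psi>) \<in> equivariant_objects C G A" and Y: "(Y, \<chi>) \<in> equivariant_objects C G A"
    and N: "(N, \<phi>) \<in> equivariant_objects C G A" and W: "(W, \<omega>) \<in> equivariant_objects C G A"
    and u: "u \<in> equivariant_mor C G A (N, \<phi>) (X, \<psi>)" and v: "v \<in> equivariant_mor C G A (N, \<phi>) (Y, \<chi>)"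
    and monic: "jointly_monic N X Y u v" and w: "w \<in> mor C W N"
    and uw: "cmp C W N X u w \<in> equivariant_mor C G A (W, \<omega>) (X, \<psi>)"
    and vw: "cmp C W N Y v w \<in> equivariant_mor C G A (W, \<omega>) (Y, \<chi>)"
  shows "w \<in> equivariant_mor C G A (W, \<omega>) (N, \<phi>)"
  unfolding equivariant_mor_iff
proof (intro conjI ballI w)
  fix g assume g: "g \<in> carrier G"
  note \<phi> = equivariant_objectD[OF N] and \<omega> = equivariant_objectD[OF W]
  have leg: "cmp C (T g W) N Z z (cmp C (T g W) W N w (\<omega> g))
      = cmp C (T g W) N Z z (cmp C (T g W) (T g N) N (\<phi> g) (M g W N w))"
    if Z: "(Z, \<zeta>) \<in> equivariant_objects C G A" and z: "z \<in> equivariant_mor C G A (N, \<phi>) (Z, \<zeta>)"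
      and zw: "cmp C W N Z z w \<in> equivariant_mor C G A (W, \<omega>) (Z, \<zeta>)" for Z \<zeta> z
    using equivariant_objectD(1)[OF Z] equivariant_objectD(2)[OF Z g] \<phi>(1) \<phi>(2)[OF g] \<omega>(1)
      \<omega>(2)[OF g] w g equivariant_morD(1)[OF z] equivariant_morD(2)[OF zw g]
      cmp_eq_tail[OF equivariant_morD(2)[OF z g]] by simp
  have "\<lbrakk>V \<in> ob C; a \<in> mor C V N; b \<in> mor C V N; cmp C V N X u a = cmp C V N X u b;
      cmp C V N Y v a = cmp C V N Y v b\<rbrakk> \<Longrightarrow> a = b" for V a b
    using monic by (simp add: jointly_monic_def)
  from this[OF _ _ _ leg[OF X u uw] leg[OF Y v vw]]
  show "cmp C (T g W) W N w (\<omega> g) = cmp C (T g W) (T g N) N (\<phi> g) (M g W N w)"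
    using \<phi>(1) \<phi>(2)[OF g] \<omega>(1) \<omega>(2)[OF g] w g by simp
qed

text \<open>The condition on \<open>w\<close> concerns maps out of \<open>T g N\<close>, while
  \<open>u\<close> and \<open>v\<close> are jointly epic onto \<open>N\<close>. The inverse
  \<open>p\<close> of \<open>\<phi> g\<close> rewrites it as an equation between maps out of
  \<open>N\<close>, which the legs can test.\<close>

lemma equivariant_if_jointly_epic:
  assumes X: "(X, \<psi>) \<in> equivariant_objects C G A" and Y: "(Y, \<chi>) \<in> equivariant_objects C G A"
    and N: "(N, \<phi>) \<in> equivariant_objects C G A" and W: "(W, \<omega>) \<in> equivariant_objects C G A"
    and u: "u \<in> equivariant_mor C G A (X, \<psi>) (N, \<phi>)" and v: "v \<in> equivariant_mor C G A (Y, \<chi>) (N, \<phi>)"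
    and epic: "jointly_epic X Y N u v" and w: "w \<in> mor C N W"
    and wu: "cmp C X N W w u \<in> equivariant_mor C G A (X, \<psi>) (W, \<omega>)"
    and wv: "cmp C Y N W w v \<in> equivariant_mor C G A (Y, \<chi>) (W, \<omega>)"
  shows "w \<in> equivariant_mor C G A (N, \<phi>) (W, \<omega>)"
  unfolding equivariant_mor_iff
proof (intro conjI ballI w)
  fix g assume g: "g \<in> carrier G"
  note \<phi> = equivariant_objectD[OF N] and \<omega> = equivariant_objectD[OF W]
  obtain p where p: "p \<in> mor C N (T g N)" "cmp C (T g N) N (T g N) p (\<phi> g) = idm C (T g N)"
    "cmp C N (T g N) N (\<phi> g) p = idm C N"
    using \<phi>(3)[OF g] by (rule is_isoE)
  have leg: "cmp C Z N W w z = cmp C Z N W (cmp C N (T g W) W (\<omega> g)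
      (cmp C N (T g N) (T g W) (M g N W w) p)) z"
    if Z: "(Z, \<zeta>) \<in> equivariant_objects C G A" and z: "z \<in> equivariant_mor C G A (Z, \<zeta>) (N, \<phi>)"
      and wz: "cmp C Z N W w z \<in> equivariant_mor C G A (Z, \<zeta>) (W, \<omega>)" for Z \<zeta> z
  proof (rule iso_cancel_right[OF equivariant_objectD(3)[OF Z g]])
    note * = equivariant_objectD(1)[OF Z] equivariant_objectD(2)[OF Z g] \<phi>(1) \<phi>(2)[OF g] \<omega>(1)
      \<omega>(2)[OF g] w g equivariant_morD(1)[OF z] p(1)
    show "cmp C (T g Z) Z W (cmp C Z N W w z) (\<zeta> g) = cmp C (T g Z) Z W
      (cmp C Z N W (cmp C N (T g W) W (\<omega> g) (cmp C N (T g N) (T g W) (M g N W w) p)) z) (\<zeta> g)"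
      using * equivariant_morD(2)[OF wz g] equivariant_morD(2)[OF z g] cmp_eq_tail1[OF p(2)] by simp
  qed (use equivariant_objectD(1)[OF Z] \<phi>(1) \<omega>(1) \<omega>(2)[OF g] w g equivariant_morD(1)[OF z] p(1)
      in simp_all)
  have "\<lbrakk>V \<in> ob C; a \<in> mor C N V; b \<in> mor C N V; cmp C X N V a u = cmp C X N V b u;
      cmp C Y N V a v = cmp C Y N V b v\<rbrakk> \<Longrightarrow> a = b" for V a b
    using epic by (simp add: jointly_epic_def)
  from this[OF _ _ _ leg[OF X u wu] leg[OF Y v wv]]
  have "w = cmp C N (T g W) W (\<omega> g) (cmp C N (T g N) (T g W) (M g N W w) p)"
    using \<phi>(1) \<omega>(1) \<omega>(2)[OF g] w g p(1) by simp
  then have "cmp C (T g N) N W w (\<phi> g)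
      = cmp C (T g N) N W (cmp C N (T g W) W (\<omega> g) (cmp C N (T g N) (T g W) (M g N W w) p)) (\<phi> g)"
    by (rule arg_cong)
  then show "cmp C (T g N) N W w (\<phi> g) = cmp C (T g N) (T g W) W (\<omega> g) (M g N W w)"
    using \<phi>(1) \<phi>(2)[OF g] \<omega>(1) \<omega>(2)[OF g] w g p by simp
qed

section \<open>Biproducts, zero objects and split idempotents\<close>

lemma biproduct_jointly_monic:
  assumes "is_biproduct C X Y P i j p q"
  shows "jointly_monic P X Y p q"
  unfolding jointly_monic_def
proof (intro ballI impI)
  fix W a b
  assume W: "W \<in> ob C" "a \<in> mor C W P" "b \<in> mor C W P"
    "cmp C W P X p a = cmp C W P X p b \<and> cmp C W P Y q a = cmp C W P Y q b"
  have *: "X \<in> ob C" "Y \<in> ob C" "P \<in> ob C" "i \<in> mor C X P" "j \<in> mor C Y P" "p \<in> mor C P X"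
    "q \<in> mor C P Y" "cmp C P X P i p \<oplus>\<^bsub>homs C P P\<^esub> cmp C P Y P j q = idm C P"
    using assms by (simp_all add: is_biproduct_def)
  \<comment> \<open>A map into \<open>P\<close> is reassembled from its components by
    \<open>1 = i p + j q\<close>.\<close>
  have "c = cmp C W X P i (cmp C W P X p c) \<oplus>\<^bsub>homs C W P\<^esub> cmp C W Y P j (cmp C W P Y q c)"
    if c: "c \<in> mor C W P" for c
    using * W(1) c cmp_add_left[of W P P c "cmp C P X P i p" "cmp C P Y P j q"] by simp
  from this[OF W(2)] this[OF W(3)] show "a = b" using W(4) by simp
qed

lemma biproduct_structure:
  assumes X: "(X, \<psi>) \<in> equivariant_objects C G A" and Y: "(Y, \<chi>) \<in> equivariant_objects C G A"
    and bi: "is_biproduct C X Y P i j p q"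
  shows "\<exists>\<phi>. is_biproduct CG (X, \<psi>) (Y, \<chi>) (P, \<phi>) i j p q"
proof -
  note \<psi> = equivariant_objectD[OF X] and \<chi> = equivariant_objectD[OF Y]
  interpret CG: k_linear_category K CG by (rule k_linear_CG)
  have *: "P \<in> ob C" "i \<in> mor C X P" "j \<in> mor C Y P" "p \<in> mor C P X" "q \<in> mor C P Y"
    and eqs: "cmp C X P X p i = idm C X" "cmp C Y P Y q j = idm C Y"
    "cmp C X P Y q i = \<zero>\<^bsub>homs C X Y\<^esub>" "cmp C Y P X p j = \<zero>\<^bsub>homs C Y X\<^esub>"
    using bi by (simp_all add: is_biproduct_def)
  note monic = biproduct_jointly_monic[OF bi]
  have "\<exists>\<phi>. (P, \<phi>) \<in> equivariant_objects C G A \<and>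
    p \<in> equivariant_mor C G A (P, \<phi>) (X, \<psi>) \<and> q \<in> equivariant_mor C G A (P, \<phi>) (Y, \<chi>)"
  proof (rule lift_along_jointly_monic[OF X Y *(1,4,5) monic])
    fix g assume g: "g \<in> carrier G"
    let ?x = "cmp C (T g P) (T g X) X (\<psi> g) (M g P X p)"
    let ?y = "cmp C (T g P) (T g Y) Y (\<chi> g) (M g P Y q)"
    \<comment> \<open>The map into \<open>P\<close> with components \<open>?x\<close> and
      \<open>?y\<close>.\<close>
    let ?t = "cmp C (T g P) X P i ?x \<oplus>\<^bsub>homs C (T g P) P\<^esub> cmp C (T g P) Y P j ?y"
    have xy: "?x \<in> mor C (T g P) X" "?y \<in> mor C (T g P) Y"
      using * g \<psi>(1) \<psi>(2)[OF g] \<chi>(1) \<chi>(2)[OF g] by simp_all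
    have "cmp C (T g P) P X p ?t = ?x" "cmp C (T g P) P Y q ?t = ?y" "?t \<in> mor C (T g P) P"
      using * g \<psi>(1) \<psi>(2)[OF g] \<chi>(1) \<chi>(2)[OF g] xy
        cmp_eq_tail1[OF eqs(1)] cmp_eq_tail1[OF eqs(2)] cmp_eq_tail1[OF eqs(3)] cmp_eq_tail1[OF eqs(4)]
      by (simp_all add: cmp_add_right)
    then show "\<exists>t \<in> mor C (T g P) P. cmp C (T g P) P X p t = ?x \<and> cmp C (T g P) P Y q t = ?y"
      by blast
  qed
  then obtain \<phi> where P: "(P, \<phi>) \<in> equivariant_objects C G A"
    and p: "p \<in> equivariant_mor C G A (P, \<phi>) (X, \<psi>)" and q: "q \<in> equivariant_mor C G A (P, \<phi>) (Y, \<chi>)"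
    by blast
  note equiv = equivariant_if_jointly_monic[OF X Y P _ p q monic]
  \<comment> \<open>The projections test the injections: the composites are identities and zero
    maps, which are equivariant.\<close>
  have "i \<in> equivariant_mor C G A (X, \<psi>) (P, \<phi>)"
    using equiv[OF X *(2)] eqs X Y CG.idm_mor[of "(X, \<psi>)"] CG.zero_mor[of "(X, \<psi>)" "(Y, \<chi>)"] by simp
  moreover have "j \<in> equivariant_mor C G A (Y, \<chi>) (P, \<phi>)"
    using equiv[OF Y *(3)] eqs X Y CG.idm_mor[of "(Y, \<chi>)"] CG.zero_mor[of "(Y, \<chi>)" "(X, \<psi>)"] by simp
  ultimately show ?thesis
    using bi X Y P p q unfolding is_biproduct_def equivariant_category_simps fst_conv by blast
qed

text \<open>Cocycle and unit laws compare maps into \<open>Z\<close>, and any two parallel ones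
  agree.\<close>

lemma zero_object_structure:
  assumes Z: "is_zero_object C Z"
  shows "\<exists>\<phi>. is_zero_object CG (Z, \<phi>)"
proof -
  interpret CG: k_linear_category K CG by (rule k_linear_CG)
  have ob: "Z \<in> ob C" using Z by (simp add: is_zero_object_def)
  have unique: "a = b" if "X \<in> ob C" "a \<in> mor C X Z" "b \<in> mor C X Z" for X a b
    using Z that unfolding is_zero_object_def by blast
  define \<phi> where "\<phi> = (\<lambda>g \<in> carrier G. \<zero>\<^bsub>homs C (T g Z) Z\<^esub>)"
  have \<phi>: "(Z, \<phi>) \<in> equivariant_objects C G A"
  proof (rule equivariant_objectI)
    fix g h assume gh: "g \<in> carrier G" "h \<in> carrier G"
    show "\<phi> (g \<otimes> h) = cmp C (T (g \<otimes> h) Z) (T g Z) Z (\<phi> g)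
        (cmp C (T (g \<otimes> h) Z) (T g (T h Z)) (T g Z) (M g (T h Z) Z (\<phi> h)) (asc A g h Z))"
      by (rule unique[of "T (g \<otimes> h) Z"]) (use ob gh in \<open>simp_all add: \<phi>_def\<close>)
  next
    show "\<phi> \<one> = unitor A Z" by (rule unique[of "T \<one> Z"]) (use ob in \<open>simp_all add: \<phi>_def\<close>)
  qed (use ob in \<open>simp_all add: \<phi>_def\<close>)
  moreover have "idm C Z = \<zero>\<^bsub>homs C Z Z\<^esub>" using Z by (rule zero_object_idm)
  ultimately show ?thesis using CG.zero_object_if_idm_zero[of "(Z, \<phi>)"] by auto
qed

lemma k_category_CG:
  assumes "k_category K C"
  shows "k_category K CG"
proof (rule k_category.intro[OF k_linear_CG], unfold_locales)
  interpret k_category K C by fact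
  show "\<exists>Z. is_zero_object CG Z" using ex_zero_object zero_object_structure by blast
  show "\<exists>R i j p q. is_biproduct CG P Q R i j p q" if PQ: "P \<in> ob CG" "Q \<in> ob CG" for P Q
  proof -
    obtain X \<psi> Y \<chi> where eq: "P = (X, \<psi>)" "Q = (Y, \<chi>)" by (cases P; cases Q)
    then have *: "(X, \<psi>) \<in> equivariant_objects C G A" "(Y, \<chi>) \<in> equivariant_objects C G A"
      using PQ by simp_all
    obtain R i j p q where "is_biproduct C X Y R i j p q"
      using ex_biproduct equivariant_objectD(1)[OF *(1)] equivariant_objectD(1)[OF *(2)] by blast
    from biproduct_structure[OF * this] show ?thesis unfolding eq by blast
  qed
qed

text \<open>The summand \<open>Y\<close> embeds by the split monomorphism \<open>s\<close>, so a
  structure on it requires that \<open>\<psi> g\<close> after the image of \<open>s\<close> factor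
  through \<open>s\<close>. It does, via \<open>r\<close>, since the equivariant
  \<open>e = s r\<close> fixes it. Finally \<open>r\<close> is equivariant because
  \<open>s r = e\<close> is.\<close>

lemma idempotents_split_CG:
  assumes "idempotents_split C"
  shows "idempotents_split CG"
  unfolding idempotents_split_def equivariant_category_simps
proof (intro ballI impI)
  fix P e
  assume P: "P \<in> equivariant_objects C G A" and e: "e \<in> equivariant_mor C G A P P"
    and ee: "cmp C (fst P) (fst P) (fst P) e e = e"
  obtain X \<psi> where X: "P = (X, \<psi>)" by (cases P)
  note \<psi> = equivariant_objectD[OF P[unfolded X]]
  note eD = equivariant_morD[OF e[unfolded X]]
  obtain Y r s where Y: "Y \<in> ob C" "r \<in> mor C X Y" "s \<in> mor C Y X"
    and rs: "cmp C Y X Y r s = idm C Y" and sr: "cmp C X Y X s r = e"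
    using assms \<psi>(1) eD(1) ee unfolding X fst_conv idempotents_split_def by blast
  have "is_mono C Y X s"
    unfolding is_mono_def
  proof (intro conjI ballI impI)
    fix W a b
    assume W: "W \<in> ob C" "a \<in> mor C W Y" "b \<in> mor C W Y" "cmp C W Y X s a = cmp C W Y X s b"
    then have "cmp C W X Y r (cmp C W Y X s a) = cmp C W X Y r (cmp C W Y X s b)" by simp
    then show "a = b" using W(1-3) Y \<psi>(1) cmp_eq_tail1[OF rs] by simp
  qed (fact Y)
  then have monic: "jointly_monic Y X X s s" by (rule jointly_monic_if_mono)
  have es: "cmp C Y X X e s = s" unfolding sr[symmetric] using Y \<psi>(1) rs by simp
  have "\<exists>\<phi>. (Y, \<phi>) \<in> equivariant_objects C G A \<and>
    s \<in> equivariant_mor C G A (Y, \<phi>) (X, \<psi>) \<and> s \<in> equivariant_mor C G A (Y, \<phi>) (X, \<psi>)"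
  proof (rule lift_along_jointly_monic[OF P[unfolded X] P[unfolded X] Y(1,3,3) monic])
    fix g assume g: "g \<in> carrier G"
    let ?x = "cmp C (T g Y) (T g X) X (\<psi> g) (M g Y X s)"
    have x: "?x \<in> mor C (T g Y) X" using Y g \<psi>(1) \<psi>(2)[OF g] by simp
    have "M g Y X (cmp C Y X X e s) = M g Y X s" unfolding es by (rule refl)
    then have "cmp C (T g Y) X X e ?x = ?x"
      using Y g \<psi>(1) \<psi>(2)[OF g] eD(1) cmp_eq_tail[OF eD(2)[OF g]] by simp
    then have "cmp C (T g Y) Y X s (cmp C (T g Y) X Y r ?x) = ?x"
      using Y g \<psi>(1) x cmp_eq_tail1[OF sr, of "T g Y" ?x] by simp
    moreover have "cmp C (T g Y) X Y r ?x \<in> mor C (T g Y) Y" using Y g \<psi>(1) x by simp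
    ultimately show "\<exists>t \<in> mor C (T g Y) Y. cmp C (T g Y) Y X s t = ?x \<and> cmp C (T g Y) Y X s t = ?x"
      by blast
  qed
  then obtain \<phi> where \<phi>: "(Y, \<phi>) \<in> equivariant_objects C G A" "s \<in> equivariant_mor C G A (Y, \<phi>) (X, \<psi>)"
    by blast
  have "r \<in> equivariant_mor C G A (X, \<psi>) (Y, \<phi>)"
    by (rule equivariant_if_jointly_monic[OF _ _ \<phi>(1) _ \<phi>(2,2) monic Y(2)])
      (use P e sr X in simp_all)
  then show "\<exists>Q \<in> equivariant_objects C G A. \<exists>r \<in> equivariant_mor C G A P Q.
      \<exists>s \<in> equivariant_mor C G A Q P.
        cmp C (fst Q) (fst P) (fst Q) r s = idm C (fst Q) \<and> cmp C (fst P) (fst Q) (fst P) s r = e"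
    using \<phi> rs sr X by (intro bexI[of _ "(Y, \<phi>)"] bexI[of _ r] bexI[of _ s]) simp_all
qed

end

section \<open>Limits and colimits of equivariant diagrams\<close>

context k_linear_category
begin

lemma pullback_jointly_monic:
  assumes pb: "is_pullback C X Y Z f g P u v"
  shows "jointly_monic P X Y u v"
  unfolding jointly_monic_def
proof (intro ballI impI)
  fix W a b
  assume W: "W \<in> ob C" "a \<in> mor C W P" "b \<in> mor C W P"
    "cmp C W P X u a = cmp C W P X u b \<and> cmp C W P Y v a = cmp C W P Y v b"
  have *: "X \<in> ob C" "Y \<in> ob C" "Z \<in> ob C" "P \<in> ob C" "f \<in> mor C X Z" "g \<in> mor C Y Z"
    "u \<in> mor C P X" "v \<in> mor C P Y" and sq: "cmp C P X Z f u = cmp C P Y Z g v"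
    using pb by (simp_all add: is_pullback_def)
  have "\<exists>!w. w \<in> mor C W P \<and> cmp C W P X u w = cmp C W P X u b \<and> cmp C W P Y v w = cmp C W P Y v b"
    using pb W * cmp_eq_tail[OF sq, of W b] by (simp add: is_pullback_def)
  then show "a = b" using W by blast
qed

lemma pushout_jointly_epic:
  assumes po: "is_pushout C X Y Z f g P u v"
  shows "jointly_epic X Y P u v"
  unfolding jointly_epic_def
proof (intro ballI impI)
  fix W a b
  assume W: "W \<in> ob C" "a \<in> mor C P W" "b \<in> mor C P W"
    "cmp C X P W a u = cmp C X P W b u \<and> cmp C Y P W a v = cmp C Y P W b v"
  have *: "X \<in> ob C" "Y \<in> ob C" "Z \<in> ob C" "P \<in> ob C" "f \<in> mor C Z X" "g \<in> mor C Z Y"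
    "u \<in> mor C X P" "v \<in> mor C Y P" and sq: "cmp C Z X P u f = cmp C Z Y P v g"
    using po by (simp_all add: is_pushout_def)
  have "\<exists>!w. w \<in> mor C P W \<and> cmp C X P W w u = cmp C X P W b u \<and> cmp C Y P W w v = cmp C Y P W b v"
    using po W * sq by (simp add: is_pushout_def)
  then show "a = b" using W by blast
qed

text \<open>Here \<open>g\<close> factors as \<open>k p\<close>, so whatever \<open>p\<close> kills
  is killed by \<open>g\<close>. This trades a \<open>g\<close> that need not be equivariant for a
  cokernel, which inherits a structure.\<close>

lemma kernel_of_cokernel:
  assumes ker: "is_kernel C Y Z g X f" and coker: "is_cokernel C X Y f Q p"
  shows "is_kernel C Y Q p X f"
proof -
  have *: "X \<in> ob C" "Y \<in> ob C" "Z \<in> ob C" "Q \<in> ob C" "f \<in> mor C X Y" "g \<in> mor C Y Z"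
    "p \<in> mor C Y Q" and gf: "cmp C X Y Z g f = \<zero>\<^bsub>homs C X Z\<^esub>"
    using ker coker by (simp_all add: is_kernel_def is_cokernel_def)
  obtain k where k: "k \<in> mor C Q Z" "cmp C Y Q Z k p = g"
    using coker * gf unfolding is_cokernel_def by blast
  have "cmp C W Y Z g h = \<zero>\<^bsub>homs C W Z\<^esub>"
    if "W \<in> ob C" "h \<in> mor C W Y" "cmp C W Y Q p h = \<zero>\<^bsub>homs C W Q\<^esub>" for W h
    unfolding k(2)[symmetric] using * k(1) that by simp
  then show ?thesis using ker coker by (simp add: is_kernel_def is_cokernel_def)
qed

text \<open>Dually \<open>g\<close> factors as \<open>i k\<close>, so a map that kills
  \<open>i\<close> kills \<open>g\<close>.\<close>

lemma cokernel_of_kernel: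
  assumes coker: "is_cokernel C Z X g Y f" and ker: "is_kernel C X Y f N i"
  shows "is_cokernel C N X i Y f"
proof -
  have *: "X \<in> ob C" "Y \<in> ob C" "Z \<in> ob C" "N \<in> ob C" "f \<in> mor C X Y" "g \<in> mor C Z X"
    "i \<in> mor C N X" and fg: "cmp C Z X Y f g = \<zero>\<^bsub>homs C Z Y\<^esub>"
    using ker coker by (simp_all add: is_kernel_def is_cokernel_def)
  obtain k where k: "k \<in> mor C Z N" "cmp C Z N X i k = g"
    using ker * fg unfolding is_kernel_def by blast
  have "cmp C Z X W h g = \<zero>\<^bsub>homs C Z W\<^esub>"
    if "W \<in> ob C" "h \<in> mor C X W" "cmp C N X W h i = \<zero>\<^bsub>homs C N W\<^esub>" for W h
    unfolding k(2)[symmetric] using * k(1) that cmp_eq_tail1[OF that(3)] by simp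
  then show ?thesis using ker coker by (simp add: is_kernel_def is_cokernel_def)
qed

end

section \<open>Kernels, cokernels, pullbacks and pushouts of equivariant diagrams\<close>

context category_action
begin

text \<open>The factorization found in \<open>C\<close> is equivariant because its composite with
  the monic \<open>i\<close> is.\<close>

lemma kernel_CG:
  assumes X: "(X, \<psi>) \<in> equivariant_objects C G A" and Y: "(Y, \<chi>) \<in> equivariant_objects C G A"
    and N: "(N, \<phi>) \<in> equivariant_objects C G A"
    and f: "f \<in> equivariant_mor C G A (X, \<psi>) (Y, \<chi>)" and i: "i \<in> equivariant_mor C G A (N, \<phi>) (X, \<psi>)"
    and ker: "is_kernel C X Y f N i"
  shows "is_kernel CG (X, \<psi>) (Y, \<chi>) f (N, \<phi>) i"
  unfolding is_kernel_def equivariant_category_simps fst_conv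
proof (intro conjI ballI impI X Y N f i)
  show "cmp C N X Y f i = \<zero>\<^bsub>homs C N Y\<^esub>" using ker by (simp add: is_kernel_def)
  fix P h
  assume P: "P \<in> equivariant_objects C G A" and h: "h \<in> equivariant_mor C G A P (X, \<psi>)"
    and fh: "cmp C (fst P) X Y f h = \<zero>\<^bsub>homs C (fst P) Y\<^esub>"
  obtain W \<omega> where W: "P = (W, \<omega>)" by (cases P)
  have ex: "\<exists>!u. u \<in> mor C W N \<and> cmp C W N X i u = h"
    using ker fh equivariant_objectD(1)[OF P[unfolded W]] equivariant_morD(1)[OF h[unfolded W]]
    by (simp add: is_kernel_def W)
  have "u \<in> equivariant_mor C G A (W, \<omega>) (N, \<phi>)" if u: "u \<in> mor C W N" "cmp C W N X i u = h" for u
    by (rule equivariant_if_jointly_monic[OF X X N P[unfolded W] i i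
        jointly_monic_if_mono[OF kernel_is_mono[OF ker]] u(1)])
      (use u h W in simp_all)
  then show "\<exists>!u. u \<in> equivariant_mor C G A P (N, \<phi>) \<and> cmp C (fst P) N X i u = h"
    using ex equivariant_morD(1) unfolding W fst_conv by blast
qed

text \<open>The factorization found in \<open>C\<close> is equivariant because its composite with
  the epic \<open>p\<close> is.\<close>

lemma cokernel_CG:
  assumes X: "(X, \<psi>) \<in> equivariant_objects C G A" and Y: "(Y, \<chi>) \<in> equivariant_objects C G A"
    and Q: "(Q, \<phi>) \<in> equivariant_objects C G A"
    and f: "f \<in> equivariant_mor C G A (X, \<psi>) (Y, \<chi>)" and p: "p \<in> equivariant_mor C G A (Y, \<chi>) (Q, \<phi>)"
    and coker: "is_cokernel C X Y f Q p"
  shows "is_cokernel CG (X, \<psi>) (Y, \<chi>) f (Q, \<phi>) p"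
  unfolding is_cokernel_def equivariant_category_simps fst_conv
proof (intro conjI ballI impI X Y Q f p)
  show "cmp C X Y Q p f = \<zero>\<^bsub>homs C X Q\<^esub>" using coker by (simp add: is_cokernel_def)
  fix P h
  assume P: "P \<in> equivariant_objects C G A" and h: "h \<in> equivariant_mor C G A (Y, \<chi>) P"
    and hf: "cmp C X Y (fst P) h f = \<zero>\<^bsub>homs C X (fst P)\<^esub>"
  obtain W \<omega> where W: "P = (W, \<omega>)" by (cases P)
  have ex: "\<exists>!u. u \<in> mor C Q W \<and> cmp C Y Q W u p = h"
    using coker hf equivariant_objectD(1)[OF P[unfolded W]] equivariant_morD(1)[OF h[unfolded W]]
    by (simp add: is_cokernel_def W)
  have "u \<in> equivariant_mor C G A (Q, \<phi>) (W, \<omega>)" if u: "u \<in> mor C Q W" "cmp C Y Q W u p = h" for u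
    by (rule equivariant_if_jointly_epic[OF Y Y Q P[unfolded W] p p
        jointly_epic_if_epi[OF cokernel_is_epi[OF coker]] u(1)])
      (use u h W in simp_all)
  then show "\<exists>!u. u \<in> equivariant_mor C G A (Q, \<phi>) P \<and> cmp C Y Q (fst P) u p = h"
    using ex equivariant_morD(1) unfolding W fst_conv by blast
qed

text \<open>The lift exists since equivariance of \<open>f\<close> turns \<open>f\<close> after
  \<open>\<psi> g\<close> after the image of \<open>i\<close> into \<open>\<chi> g\<close> after the
  image of \<open>f i = 0\<close>.\<close>

lemma kernel_structure:
  assumes X: "(X, \<psi>) \<in> equivariant_objects C G A" and Y: "(Y, \<chi>) \<in> equivariant_objects C G A"
    and f: "f \<in> equivariant_mor C G A (X, \<psi>) (Y, \<chi>)" and ker: "is_kernel C X Y f N i"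
  shows "\<exists>\<phi>. (N, \<phi>) \<in> equivariant_objects C G A \<and> i \<in> equivariant_mor C G A (N, \<phi>) (X, \<psi>)"
proof -
  note \<psi> = equivariant_objectD[OF X] and \<chi> = equivariant_objectD[OF Y]
  note fD = equivariant_morD[OF f]
  have *: "N \<in> ob C" "i \<in> mor C N X" and fi: "cmp C N X Y f i = \<zero>\<^bsub>homs C N Y\<^esub>"
    using ker by (simp_all add: is_kernel_def)
  have "\<exists>\<phi>. (N, \<phi>) \<in> equivariant_objects C G A \<and>
    i \<in> equivariant_mor C G A (N, \<phi>) (X, \<psi>) \<and> i \<in> equivariant_mor C G A (N, \<phi>) (X, \<psi>)"
  proof (rule lift_along_jointly_monic[OF X X *(1,2,2)
        jointly_monic_if_mono[OF kernel_is_mono[OF ker]]])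
    fix g assume g: "g \<in> carrier G"
    let ?x = "cmp C (T g N) (T g X) X (\<psi> g) (M g N X i)"
    have x: "?x \<in> mor C (T g N) X" using * g \<psi>(1) \<psi>(2)[OF g] by simp
    have "M g N Y (cmp C N X Y f i) = \<zero>\<^bsub>homs C (T g N) (T g Y)\<^esub>"
      unfolding fi using * g \<chi>(1) by simp
    then have "cmp C (T g N) X Y f ?x = \<zero>\<^bsub>homs C (T g N) Y\<^esub>"
      using * g \<psi>(1) \<psi>(2)[OF g] \<chi>(1) \<chi>(2)[OF g] fD(1) cmp_eq_tail[OF fD(2)[OF g]] by simp
    then have "\<exists>!t. t \<in> mor C (T g N) N \<and> cmp C (T g N) N X i t = ?x"
      using ker x g * by (simp add: is_kernel_def)
    then show "\<exists>t \<in> mor C (T g N) N. cmp C (T g N) N X i t = ?x \<and> cmp C (T g N) N X i t = ?x"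
      by blast
  qed
  then show ?thesis by blast
qed

text \<open>The map factored through \<open>p\<close> is the image of \<open>p\<close> after the
  inverse \<open>c\<close> of \<open>\<chi> g\<close>. It kills \<open>f\<close>: precomposed with
  the isomorphism \<open>\<psi> g\<close>, its composite with \<open>f\<close> becomes the image of
  \<open>p f = 0\<close>.\<close>

lemma cokernel_structure:
  assumes X: "(X, \<psi>) \<in> equivariant_objects C G A" and Y: "(Y, \<chi>) \<in> equivariant_objects C G A"
    and f: "f \<in> equivariant_mor C G A (X, \<psi>) (Y, \<chi>)" and coker: "is_cokernel C X Y f Q p"
  shows "\<exists>\<phi>. (Q, \<phi>) \<in> equivariant_objects C G A \<and> p \<in> equivariant_mor C G A (Y, \<chi>) (Q, \<phi>)"
proof -
  note \<psi> = equivariant_objectD[OF X] and \<chi> = equivariant_objectD[OF Y]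
  note fD = equivariant_morD[OF f]
  have *: "Q \<in> ob C" "p \<in> mor C Y Q" and pf: "cmp C X Y Q p f = \<zero>\<^bsub>homs C X Q\<^esub>"
    using coker by (simp_all add: is_cokernel_def)
  have "\<exists>\<phi>. (Q, \<phi>) \<in> equivariant_objects C G A \<and>
    p \<in> equivariant_mor C G A (Y, \<chi>) (Q, \<phi>) \<and> p \<in> equivariant_mor C G A (Y, \<chi>) (Q, \<phi>)"
  proof (rule lift_along_jointly_epic[OF Y Y *(1,2,2)
        jointly_epic_if_epi[OF cokernel_is_epi[OF coker]]])
    fix g assume g: "g \<in> carrier G"
    obtain c where c: "c \<in> mor C Y (T g Y)" "cmp C (T g Y) Y (T g Y) c (\<chi> g) = idm C (T g Y)"
      using \<chi>(3)[OF g] by (rule is_isoE)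
    let ?x = "cmp C Y (T g Y) (T g Q) (M g Y Q p) c"
    have x: "?x \<in> mor C Y (T g Q)" using * g \<chi>(1) c by simp
    have "M g X Q (cmp C X Y Q p f) = \<zero>\<^bsub>homs C (T g X) (T g Q)\<^esub>"
      unfolding pf using * g \<psi>(1) by simp
    then have "cmp C (T g X) X (T g Q) (cmp C X Y (T g Q) ?x f) (\<psi> g) = \<zero>\<^bsub>homs C (T g X) (T g Q)\<^esub>"
      using * g \<psi>(1) \<psi>(2)[OF g] \<chi>(1) \<chi>(2)[OF g] c(1) fD(1) fD(2)[OF g] cmp_eq_tail1[OF c(2)] by simp
    then have "cmp C (T g X) X (T g Q) (cmp C X Y (T g Q) ?x f) (\<psi> g)
        = cmp C (T g X) X (T g Q) \<zero>\<^bsub>homs C X (T g Q)\<^esub> (\<psi> g)"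
      using * g \<psi>(1) \<psi>(2)[OF g] by simp
    then have "cmp C X Y (T g Q) ?x f = \<zero>\<^bsub>homs C X (T g Q)\<^esub>"
      by (rule iso_cancel_right[OF \<psi>(3)[OF g]]) (use * g \<psi>(1) \<chi>(1) c(1) fD(1) in simp_all)
    then have "\<exists>!t. t \<in> mor C Q (T g Q) \<and> cmp C Y Q (T g Q) t p = ?x"
      using coker x g * by (simp add: is_cokernel_def)
    then obtain t where t: "t \<in> mor C Q (T g Q)" "cmp C Y Q (T g Q) t p = ?x" by blast
    have "cmp C (T g Y) Q (T g Q) t (cmp C (T g Y) Y Q p (\<chi> g)) = M g Y Q p"
      using * g \<chi>(1) \<chi>(2)[OF g] c t(1) cmp_eq_tail1[OF t(2)] by simp
    with t(1) show "\<exists>t \<in> mor C Q (T g Q).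
        cmp C (T g Y) Q (T g Q) t (cmp C (T g Y) Y Q p (\<chi> g)) = M g Y Q p \<and>
        cmp C (T g Y) Q (T g Q) t (cmp C (T g Y) Y Q p (\<chi> g)) = M g Y Q p"
      by blast
  qed
  then show ?thesis by blast
qed

text \<open>Applying \<open>\<zeta> g\<close> to the image of the square under
  \<open>g \<otimes> -\<close> shows that \<open>?x\<close> and \<open>?y\<close> agree over
  \<open>Z\<close>, so they induce the structure map.\<close>

lemma pullback_structure:
  assumes X: "(X, \<psi>) \<in> equivariant_objects C G A" and Y: "(Y, \<chi>) \<in> equivariant_objects C G A"
    and Z: "(Z, \<zeta>) \<in> equivariant_objects C G A"
    and f: "f \<in> equivariant_mor C G A (X, \<psi>) (Z, \<zeta>)" and h: "h \<in> equivariant_mor C G A (Y, \<chi>) (Z, \<zeta>)"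
    and pb: "is_pullback C X Y Z f h P u v"
  shows "\<exists>\<phi>. is_pullback CG (X, \<psi>) (Y, \<chi>) (Z, \<zeta>) f h (P, \<phi>) u v"
proof -
  note \<psi> = equivariant_objectD[OF X] and \<chi> = equivariant_objectD[OF Y] and \<zeta> = equivariant_objectD[OF Z]
  note fD = equivariant_morD[OF f] and hD = equivariant_morD[OF h]
  have *: "P \<in> ob C" "u \<in> mor C P X" "v \<in> mor C P Y" and sq: "cmp C P X Z f u = cmp C P Y Z h v"
    using pb by (simp_all add: is_pullback_def)
  note monic = pullback_jointly_monic[OF pb]
  have "\<exists>\<phi>. (P, \<phi>) \<in> equivariant_objects C G A \<and>
    u \<in> equivariant_mor C G A (P, \<phi>) (X, \<psi>) \<and> v \<in> equivariant_mor C G A (P, \<phi>) (Y, \<chi>)"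
  proof (rule lift_along_jointly_monic[OF X Y * monic])
    fix g assume g: "g \<in> carrier G"
    let ?x = "cmp C (T g P) (T g X) X (\<psi> g) (M g P X u)"
    let ?y = "cmp C (T g P) (T g Y) Y (\<chi> g) (M g P Y v)"
    have xy: "?x \<in> mor C (T g P) X" "?y \<in> mor C (T g P) Y"
      using * g \<psi>(1) \<psi>(2)[OF g] \<chi>(1) \<chi>(2)[OF g] by simp_all
    have "M g P Z (cmp C P X Z f u) = M g P Z (cmp C P Y Z h v)" unfolding sq by (rule refl)
    then have "cmp C (T g P) X Z f ?x = cmp C (T g P) Y Z h ?y"
      using * g \<psi>(1) \<psi>(2)[OF g] \<chi>(1) \<chi>(2)[OF g] \<zeta>(1) \<zeta>(2)[OF g] fD(1) hD(1)
        cmp_eq_tail[OF fD(2)[OF g]] cmp_eq_tail[OF hD(2)[OF g]] by simp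
    then have "\<exists>!t. t \<in> mor C (T g P) P \<and> cmp C (T g P) P X u t = ?x \<and> cmp C (T g P) P Y v t = ?y"
      using pb xy g * by (simp add: is_pullback_def)
    then show "\<exists>t \<in> mor C (T g P) P. cmp C (T g P) P X u t = ?x \<and> cmp C (T g P) P Y v t = ?y"
      by blast
  qed
  then obtain \<phi> where P: "(P, \<phi>) \<in> equivariant_objects C G A"
    and u: "u \<in> equivariant_mor C G A (P, \<phi>) (X, \<psi>)" and v: "v \<in> equivariant_mor C G A (P, \<phi>) (Y, \<chi>)"
    by blast
  have "is_pullback CG (X, \<psi>) (Y, \<chi>) (Z, \<zeta>) f h (P, \<phi>) u v"
    unfolding is_pullback_def equivariant_category_simps fst_conv
  proof (intro conjI ballI impI X Y Z P f h u v sq)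
    fix Q a b
    assume Q: "Q \<in> equivariant_objects C G A" and a: "a \<in> equivariant_mor C G A Q (X, \<psi>)"
      and b: "b \<in> equivariant_mor C G A Q (Y, \<chi>)"
      and eq: "cmp C (fst Q) X Z f a = cmp C (fst Q) Y Z h b"
    obtain W \<omega> where W: "Q = (W, \<omega>)" by (cases Q)
    have ex: "\<exists>!w. w \<in> mor C W P \<and> cmp C W P X u w = a \<and> cmp C W P Y v w = b"
      using pb eq equivariant_objectD(1)[OF Q[unfolded W]] equivariant_morD(1)[OF a[unfolded W]]
        equivariant_morD(1)[OF b[unfolded W]] by (simp add: is_pullback_def W)
    have "w \<in> equivariant_mor C G A (W, \<omega>) (P, \<phi>)"
      if w: "w \<in> mor C W P" "cmp C W P X u w = a" "cmp C W P Y v w = b" for w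
      by (rule equivariant_if_jointly_monic[OF X Y P Q[unfolded W] u v monic w(1)])
        (use w a b W in simp_all)
    then show "\<exists>!w. w \<in> equivariant_mor C G A Q (P, \<phi>) \<and>
        cmp C (fst Q) P X u w = a \<and> cmp C (fst Q) P Y v w = b"
      using ex equivariant_morD(1) unfolding W fst_conv by blast
  qed
  then show ?thesis by blast
qed

text \<open>The coaction is induced by the images of \<open>u\<close> and \<open>v\<close> after the
  inverses of \<open>\<psi> g\<close> and \<open>\<chi> g\<close>; that these agree on
  \<open>Z\<close> is checked after precomposing with the isomorphism
  \<open>\<zeta> g\<close>.\<close>

lemma pushout_structure:
  assumes X: "(X, \<psi>) \<in> equivariant_objects C G A" and Y: "(Y, \<chi>) \<in> equivariant_objects C G A"
    and Z: "(Z, \<zeta>) \<in> equivariant_objects C G A"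
    and f: "f \<in> equivariant_mor C G A (Z, \<zeta>) (X, \<psi>)" and h: "h \<in> equivariant_mor C G A (Z, \<zeta>) (Y, \<chi>)"
    and po: "is_pushout C X Y Z f h P u v"
  shows "\<exists>\<phi>. is_pushout CG (X, \<psi>) (Y, \<chi>) (Z, \<zeta>) f h (P, \<phi>) u v"
proof -
  note \<psi> = equivariant_objectD[OF X] and \<chi> = equivariant_objectD[OF Y] and \<zeta> = equivariant_objectD[OF Z]
  note fD = equivariant_morD[OF f] and hD = equivariant_morD[OF h]
  have *: "P \<in> ob C" "u \<in> mor C X P" "v \<in> mor C Y P" and sq: "cmp C Z X P u f = cmp C Z Y P v h"
    using po by (simp_all add: is_pushout_def)
  note epic = pushout_jointly_epic[OF po]
  have "\<exists>\<phi>. (P, \<phi>) \<in> equivariant_objects C G A \<and>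
    u \<in> equivariant_mor C G A (X, \<psi>) (P, \<phi>) \<and> v \<in> equivariant_mor C G A (Y, \<chi>) (P, \<phi>)"
  proof (rule lift_along_jointly_epic[OF X Y * epic])
    fix g assume g: "g \<in> carrier G"
    obtain c where c: "c \<in> mor C X (T g X)" "cmp C (T g X) X (T g X) c (\<psi> g) = idm C (T g X)"
      using \<psi>(3)[OF g] by (rule is_isoE)
    obtain d where d: "d \<in> mor C Y (T g Y)" "cmp C (T g Y) Y (T g Y) d (\<chi> g) = idm C (T g Y)"
      using \<chi>(3)[OF g] by (rule is_isoE)
    let ?x = "cmp C X (T g X) (T g P) (M g X P u) c"
    let ?y = "cmp C Y (T g Y) (T g P) (M g Y P v) d"
    have xy: "?x \<in> mor C X (T g P)" "?y \<in> mor C Y (T g P)"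
      using * g \<psi>(1) c(1) \<chi>(1) d(1) by simp_all
    have "M g Z P (cmp C Z X P u f) = M g Z P (cmp C Z Y P v h)" unfolding sq by (rule refl)
    then have "cmp C (T g Z) Z (T g P) (cmp C Z X (T g P) ?x f) (\<zeta> g)
        = cmp C (T g Z) Z (T g P) (cmp C Z Y (T g P) ?y h) (\<zeta> g)"
      using * g \<psi>(1) \<psi>(2)[OF g] \<chi>(1) \<chi>(2)[OF g] \<zeta>(1) \<zeta>(2)[OF g] c(1) d(1) fD(1) hD(1)
        fD(2)[OF g] hD(2)[OF g] cmp_eq_tail1[OF c(2)] cmp_eq_tail1[OF d(2)] by simp
    then have "cmp C Z X (T g P) ?x f = cmp C Z Y (T g P) ?y h"
      by (rule iso_cancel_right[OF \<zeta>(3)[OF g]])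
        (use * g \<psi>(1) \<chi>(1) \<zeta>(1) c(1) d(1) fD(1) hD(1) in simp_all)
    then have "\<exists>!t. t \<in> mor C P (T g P) \<and> cmp C X P (T g P) t u = ?x \<and> cmp C Y P (T g P) t v = ?y"
      using po xy g * by (simp add: is_pushout_def)
    then obtain t where t: "t \<in> mor C P (T g P)" "cmp C X P (T g P) t u = ?x"
      "cmp C Y P (T g P) t v = ?y" by blast
    have "cmp C (T g X) P (T g P) t (cmp C (T g X) X P u (\<psi> g)) = M g X P u"
      using * g \<psi>(1) \<psi>(2)[OF g] c t(1) cmp_eq_tail1[OF t(2)] by simp
    moreover have "cmp C (T g Y) P (T g P) t (cmp C (T g Y) Y P v (\<chi> g)) = M g Y P v"
      using * g \<chi>(1) \<chi>(2)[OF g] d t(1) cmp_eq_tail1[OF t(3)] by simp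
    ultimately show "\<exists>t \<in> mor C P (T g P).
        cmp C (T g X) P (T g P) t (cmp C (T g X) X P u (\<psi> g)) = M g X P u \<and>
        cmp C (T g Y) P (T g P) t (cmp C (T g Y) Y P v (\<chi> g)) = M g Y P v"
      using t(1) by blast
  qed
  then obtain \<phi> where P: "(P, \<phi>) \<in> equivariant_objects C G A"
    and u: "u \<in> equivariant_mor C G A (X, \<psi>) (P, \<phi>)" and v: "v \<in> equivariant_mor C G A (Y, \<chi>) (P, \<phi>)"
    by blast
  have "is_pushout CG (X, \<psi>) (Y, \<chi>) (Z, \<zeta>) f h (P, \<phi>) u v"
    unfolding is_pushout_def equivariant_category_simps fst_conv
  proof (intro conjI ballI impI X Y Z P f h u v sq)
    fix Q a b
    assume Q: "Q \<in> equivariant_objects C G A" and a: "a \<in> equivariant_mor C G A (X, \<psi>) Q"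
      and b: "b \<in> equivariant_mor C G A (Y, \<chi>) Q"
      and eq: "cmp C Z X (fst Q) a f = cmp C Z Y (fst Q) b h"
    obtain W \<omega> where W: "Q = (W, \<omega>)" by (cases Q)
    have ex: "\<exists>!w. w \<in> mor C P W \<and> cmp C X P W w u = a \<and> cmp C Y P W w v = b"
      using po eq equivariant_objectD(1)[OF Q[unfolded W]] equivariant_morD(1)[OF a[unfolded W]]
        equivariant_morD(1)[OF b[unfolded W]] by (simp add: is_pushout_def W)
    have "w \<in> equivariant_mor C G A (P, \<phi>) (W, \<omega>)"
      if w: "w \<in> mor C P W" "cmp C X P W w u = a" "cmp C Y P W w v = b" for w
      by (rule equivariant_if_jointly_epic[OF X Y P Q[unfolded W] u v epic w(1)])
        (use w a b W in simp_all)
    then show "\<exists>!w. w \<in> equivariant_mor C G A (P, \<phi>) Q \<and>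
        cmp C X P (fst Q) w u = a \<and> cmp C Y P (fst Q) w v = b"
      using ex equivariant_morD(1) unfolding W fst_conv by blast
  qed
  then show ?thesis by blast
qed

end

section \<open>Abelian structure\<close>

context category_action
begin

text \<open>The kernel \<open>i\<close> taken in \<open>C\<close> carries a structure, so it is a
  legitimate test map in \<open>CG\<close> and must vanish. Every map killed by \<open>f\<close>
  factors through it.\<close>

lemma mono_if_mono_CG:
  assumes kernels: "\<exists>N i. is_kernel C X Y f N i"
    and X: "(X, \<psi>) \<in> equivariant_objects C G A" and Y: "(Y, \<chi>) \<in> equivariant_objects C G A"
    and mono: "is_mono CG (X, \<psi>) (Y, \<chi>) f"
  shows "is_mono C X Y f"
proof -
  note ob = equivariant_objectD(1)[OF X] equivariant_objectD(1)[OF Y]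
  interpret CG: k_linear_category K CG by (rule k_linear_CG)
  have f: "f \<in> equivariant_mor C G A (X, \<psi>) (Y, \<chi>)" using mono by (simp add: is_mono_def)
  obtain N i where ker: "is_kernel C X Y f N i" using kernels by blast
  then have N: "N \<in> ob C" and fi: "cmp C N X Y f i = \<zero>\<^bsub>homs C N Y\<^esub>" by (simp_all add: is_kernel_def)
  obtain \<phi> where \<phi>: "(N, \<phi>) \<in> equivariant_objects C G A" "i \<in> equivariant_mor C G A (N, \<phi>) (X, \<psi>)"
    using kernel_structure[OF X Y f ker] by blast
  have "i = \<zero>\<^bsub>homs C N X\<^esub>"
    by (rule CG.is_monoD[OF mono, of "(N, \<phi>)"])
      (use \<phi> X fi N ob equivariant_morD(1)[OF f] CG.zero_mor[of "(N, \<phi>)" "(X, \<psi>)"] in simp_all)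
  then have "h = \<zero>\<^bsub>homs C W X\<^esub>"
    if h: "W \<in> ob C" "h \<in> mor C W X" "cmp C W X Y f h = \<zero>\<^bsub>homs C W Y\<^esub>" for W h
  proof -
    obtain u where "u \<in> mor C W N" "cmp C W N X i u = h"
      using ker h unfolding is_kernel_def by blast
    then show ?thesis using \<open>i = \<zero>\<^bsub>homs C N X\<^esub>\<close> h N ob by auto
  qed
  then show ?thesis
    using ob equivariant_morD(1)[OF f] by (intro is_mono_if_trivial_kernel)
qed

text \<open>The cokernel taken in \<open>C\<close> is a test map in \<open>CG\<close>; it vanishes,
  and with it every map that kills \<open>f\<close>.\<close>

lemma epi_if_epi_CG:
  assumes cokernels: "\<exists>Q p. is_cokernel C X Y f Q p"
    and X: "(X, \<psi>) \<in> equivariant_objects C G A" and Y: "(Y, \<chi>) \<in> equivariant_objects C G A"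
    and epi: "is_epi CG (X, \<psi>) (Y, \<chi>) f"
  shows "is_epi C X Y f"
proof -
  note ob = equivariant_objectD(1)[OF X] equivariant_objectD(1)[OF Y]
  interpret CG: k_linear_category K CG by (rule k_linear_CG)
  have f: "f \<in> equivariant_mor C G A (X, \<psi>) (Y, \<chi>)" using epi by (simp add: is_epi_def)
  obtain Q p where coker: "is_cokernel C X Y f Q p" using cokernels by blast
  then have Q: "Q \<in> ob C" and pf: "cmp C X Y Q p f = \<zero>\<^bsub>homs C X Q\<^esub>" by (simp_all add: is_cokernel_def)
  obtain \<phi> where \<phi>: "(Q, \<phi>) \<in> equivariant_objects C G A" "p \<in> equivariant_mor C G A (Y, \<chi>) (Q, \<phi>)"
    using cokernel_structure[OF X Y f coker] by blast
  have "p = \<zero>\<^bsub>homs C Y Q\<^esub>"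
    by (rule CG.is_epiD[OF epi, of "(Q, \<phi>)"])
      (use \<phi> Y pf Q ob equivariant_morD(1)[OF f] CG.zero_mor[of "(Y, \<chi>)" "(Q, \<phi>)"] in simp_all)
  then have "h = \<zero>\<^bsub>homs C Y W\<^esub>"
    if h: "W \<in> ob C" "h \<in> mor C Y W" "cmp C X Y W h f = \<zero>\<^bsub>homs C X W\<^esub>" for W h
  proof -
    obtain u where "u \<in> mor C Q W" "cmp C Y Q W u p = h"
      using coker h unfolding is_cokernel_def by blast
    then show ?thesis using \<open>p = \<zero>\<^bsub>homs C Y Q\<^esub>\<close> h Q ob by auto
  qed
  then show ?thesis
    using ob equivariant_morD(1)[OF f] by (intro is_epi_if_trivial_cokernel)
qed

theorem abelian_CG:
  assumes "abelian_category K C"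
  shows "abelian_category K CG"
proof -
  interpret abelian_category K C by fact
  show ?thesis
  proof (rule abelian_category.intro[OF k_category_CG[OF k_category_axioms]],
      rule abelian_category_axioms.intro, unfold equivariant_category_simps)
    fix P Q f
    assume P: "P \<in> equivariant_objects C G A" and Q: "Q \<in> equivariant_objects C G A"
    obtain X \<psi> Y \<chi> where eq: "P = (X, \<psi>)" "Q = (Y, \<chi>)" by (cases P; cases Q)
    note X = P[unfolded eq] and Y = Q[unfolded eq]
    note ob = equivariant_objectD(1)[OF X] equivariant_objectD(1)[OF Y]
    {
      assume "f \<in> equivariant_mor C G A P Q"
      then have f: "f \<in> equivariant_mor C G A (X, \<psi>) (Y, \<chi>)" by (simp only: eq)
      obtain N i where ker: "is_kernel C X Y f N i"
        using ex_kernel[OF ob equivariant_morD(1)[OF f]] by blast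
      with kernel_structure[OF X Y f ker] kernel_CG[OF X Y _ f]
      show "\<exists>N i. is_kernel CG P Q f N i" unfolding eq by blast
      obtain N i where coker: "is_cokernel C X Y f N i"
        using ex_cokernel[OF ob equivariant_morD(1)[OF f]] by blast
      with cokernel_structure[OF X Y f coker] cokernel_CG[OF X Y _ f]
      show "\<exists>N i. is_cokernel CG P Q f N i" unfolding eq by blast
    next
      assume mono: "is_mono CG P Q f"
      then have f: "f \<in> equivariant_mor C G A (X, \<psi>) (Y, \<chi>)" by (simp add: is_mono_def eq)
      have "is_mono C X Y f"
        using mono_if_mono_CG[OF ex_kernel[OF ob equivariant_morD(1)[OF f]] X Y] mono eq by simp
      then obtain Z g where ker: "is_kernel C Y Z g X f" using mono_is_kernel[OF ob] by blast
      \<comment> \<open>The target of \<open>g\<close> may carry no equivariant structure, so the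
        cokernel of \<open>f\<close> replaces \<open>g\<close>.\<close>
      obtain Z' p where coker: "is_cokernel C X Y f Z' p"
        using ex_cokernel[OF ob equivariant_morD(1)[OF f]] by blast
      obtain \<phi> where \<phi>: "(Z', \<phi>) \<in> equivariant_objects C G A" "p \<in> equivariant_mor C G A (Y, \<chi>) (Z', \<phi>)"
        using cokernel_structure[OF X Y f coker] by blast
      show "\<exists>Z g. is_kernel CG Q Z g P f"
        using kernel_CG[OF Y \<phi>(1) X \<phi>(2) f kernel_of_cokernel[OF ker coker]] unfolding eq by blast
    next
      assume epi: "is_epi CG P Q f"
      then have f: "f \<in> equivariant_mor C G A (X, \<psi>) (Y, \<chi>)" by (simp add: is_epi_def eq)
      have "is_epi C X Y f"
        using epi_if_epi_CG[OF ex_cokernel[OF ob equivariant_morD(1)[OF f]] X Y] epi eq by simp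
      then obtain Z g where coker: "is_cokernel C Z X g Y f" using epi_is_cokernel[OF ob] by blast
      \<comment> \<open>For the same reason the kernel of \<open>f\<close> replaces \<open>g\<close>
        here.\<close>
      obtain N i where ker: "is_kernel C X Y f N i"
        using ex_kernel[OF ob equivariant_morD(1)[OF f]] by blast
      obtain \<phi> where \<phi>: "(N, \<phi>) \<in> equivariant_objects C G A" "i \<in> equivariant_mor C G A (N, \<phi>) (X, \<psi>)"
        using kernel_structure[OF X Y f ker] by blast
      show "\<exists>Z g. is_cokernel CG Z P g Q f"
        using cokernel_CG[OF \<phi>(1) X Y \<phi>(2) f cokernel_of_kernel[OF coker ker]] unfolding eq by blast
    }
  qed
qed

end

section \<open>Exact structure\<close>

text \<open>In an idempotent complete exact category the cancellation axioms hold without the assumption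
  that a kernel or cokernel exists: the base change of \<open>p\<close> along the admissible epimorphism
  \<open>p \<circ> f\<close> is a retraction, and a kernel of that retraction is also a kernel of \<open>p\<close>.\<close>

lemma (in exact_category) epi_cancel_if_idempotents_split:
  assumes split: "idempotents_split C" and Y: "Y \<in> ob C" and Z: "Z \<in> ob C"
    and f: "f \<in> mor C X Y" and p: "p \<in> mor C Y Z" and adm: "admissible_epi E X Z (cmp C X Y Z p f)"
  shows "admissible_epi E Y Z p"
proof -
  let ?q = "cmp C X Y Z p f"
  have X: "X \<in> ob C"
    using adm ses_kernel by (auto simp: admissible_epi_def is_kernel_def)
  obtain P u v where pb: "is_pullback C Y X Z p ?q P u v"
    using epi_base_change[OF adm Y p] by blast
  have P: "P \<in> ob C" "u \<in> mor C P Y" "v \<in> mor C P X" and sq: "cmp C P Y Z p u = cmp C P X Z ?q v"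
    using pb by (simp_all add: is_pullback_def)
  note * = X Y Z f p P
  have uniq: "\<exists>!w. w \<in> mor C W P \<and> cmp C W P Y u w = a \<and> cmp C W P X v w = b"
    if "W \<in> ob C" "a \<in> mor C W Y" "b \<in> mor C W X" "cmp C W Y Z p a = cmp C W X Z ?q b" for W a b
    using pb that by (simp add: is_pullback_def)
  \<comment> \<open>The pair of \<open>f\<close> and the identity of \<open>X\<close> is compatible
    over \<open>Z\<close> and induces a section of \<open>v\<close>.\<close>
  obtain s where s: "s \<in> mor C X P" "cmp C X P Y u s = f" "cmp C X P X v s = idm C X"
    using uniq[of X f "idm C X"] * by auto
  \<comment> \<open>The projection onto the kernel of \<open>v\<close> along \<open>s\<close>;
    splitting it produces that kernel as \<open>t\<close>.\<close>
  define e where "e = idm C P \<ominus>\<^bsub>homs C P P\<^esub> cmp C P X P s v"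
  have "e \<in> mor C P P" using * s(1) by (simp add: e_def)
  moreover have "cmp C P P P e e = e"
    using * s(1) cmp_eq_tail1[OF s(3)] by (simp add: e_def cmp_minus_left cmp_minus_right)
  ultimately obtain N r t where N: "N \<in> ob C" "r \<in> mor C P N" "t \<in> mor C N P"
    and rt: "cmp C N P N r t = idm C N" and tr: "cmp C P N P t r = e"
    using split P(1) unfolding idempotents_split_def by blast
  have "t = cmp C N P P e t" unfolding tr[symmetric] using * N rt by simp
  then have "cmp C N P X v t = cmp C N P X v (cmp C N P P e t)" by simp
  also have "\<dots> = \<zero>\<^bsub>homs C N X\<^esub>"
    using * s(1) N cmp_eq_tail1[OF s(3)] by (simp add: e_def cmp_minus_left cmp_minus_right)
  finally have vt: "cmp C N P X v t = \<zero>\<^bsub>homs C N X\<^esub>" .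
  have "is_kernel C Y Z p N (cmp C N P Y u t)"
    unfolding is_kernel_def
  proof (intro conjI ballI impI)
    show "cmp C N Y Z p (cmp C N P Y u t) = \<zero>\<^bsub>homs C N Z\<^esub>"
      using * N vt cmp_eq_tail[OF sq, of N t] by simp
    fix W h assume h: "W \<in> ob C" "h \<in> mor C W Y" "cmp C W Y Z p h = \<zero>\<^bsub>homs C W Z\<^esub>"
    \<comment> \<open>A map \<open>h\<close> killed by \<open>p\<close> is paired with zero. The
      induced \<open>w\<close> is killed by \<open>v\<close>, hence fixed by \<open>e\<close>, hence
      factors through \<open>t\<close>.\<close>
    obtain w where w: "w \<in> mor C W P" "cmp C W P Y u w = h" "cmp C W P X v w = \<zero>\<^bsub>homs C W X\<^esub>"
      using uniq[of W h "\<zero>\<^bsub>homs C W X\<^esub>"] * h by auto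
    show "\<exists>!k. k \<in> mor C W N \<and> cmp C W N Y (cmp C N P Y u t) k = h"
    proof (rule ex1I[of _ "cmp C W P N r w"], intro conjI)
      show "cmp C W P N r w \<in> mor C W N" using h(1) w(1) P N by simp
      have "cmp C W P P e w = w"
        using * s(1) h(1) w by (simp add: e_def cmp_minus_left)
      then show "cmp C W N Y (cmp C N P Y u t) (cmp C W P N r w) = h"
        using h(1) w(1,2) * N cmp_eq_tail1[OF tr, of W w] by simp
    next
      fix k assume k: "k \<in> mor C W N \<and> cmp C W N Y (cmp C N P Y u t) k = h"
      then have "cmp C W P Y u (cmp C W N P t k) = h" "cmp C W P X v (cmp C W N P t k) = \<zero>\<^bsub>homs C W X\<^esub>"
        using h(1) * N cmp_eq_tail1[OF vt, of W k] by auto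
      then have "cmp C W N P t k = w"
        using uniq[of W h "\<zero>\<^bsub>homs C W X\<^esub>"] * h w k N
        by (metis cmp_mor cmp_zero_right zero_mor)
      then show "k = cmp C W P N r w"
        using h(1) * N k cmp_eq_tail1[OF rt, of W k] by auto
    qed
  qed (use * N in simp_all)
  then show ?thesis using epi_cancel X f adm by blast
qed

text \<open>The cobase change \<open>v\<close> of \<open>i\<close> along the composite
  \<open>f i\<close> is a split monomorphism, retracted by the map that \<open>f\<close> and the
  identity of \<open>Z\<close> induce. Its cokernel \<open>r\<close> comes from splitting
  \<open>1 - v s\<close>, and \<open>r u\<close> is the cokernel of \<open>i\<close> that
  \<open>mono_cancel\<close> asks for.\<close>

lemma (in exact_category) mono_cancel_if_idempotents_split:
  assumes split: "idempotents_split C" and X: "X \<in> ob C" and Y: "Y \<in> ob C"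
    and i: "i \<in> mor C X Y" and f: "f \<in> mor C Y Z" and adm: "admissible_mono E X Z (cmp C X Y Z f i)"
  shows "admissible_mono E X Y i"
proof -
  let ?j = "cmp C X Y Z f i"
  have Z: "Z \<in> ob C"
    using adm ses_kernel by (auto simp: admissible_mono_def is_kernel_def)
  obtain P u v where po: "is_pushout C Y Z X i ?j P u v"
    using mono_cobase_change[OF adm Y i] by blast
  have P: "P \<in> ob C" "u \<in> mor C Y P" "v \<in> mor C Z P" and sq: "cmp C X Y P u i = cmp C X Z P v ?j"
    using po by (simp_all add: is_pushout_def)
  note * = X Y Z f i P
  have uniq: "\<exists>!w. w \<in> mor C P W \<and> cmp C Y P W w u = a \<and> cmp C Z P W w v = b"
    if "W \<in> ob C" "a \<in> mor C Y W" "b \<in> mor C Z W" "cmp C X Y W a i = cmp C X Z W b ?j" for W a b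
    using po that by (simp add: is_pushout_def)
  obtain s where s: "s \<in> mor C P Z" "cmp C Y P Z s u = f" "cmp C Z P Z s v = idm C Z"
    using uniq[of Z f "idm C Z"] * by auto
  define e where "e = idm C P \<ominus>\<^bsub>homs C P P\<^esub> cmp C P Z P v s"
  have "e \<in> mor C P P" using * s(1) by (simp add: e_def)
  moreover have "cmp C P P P e e = e"
    using * s(1) cmp_eq_tail1[OF s(3)] by (simp add: e_def cmp_minus_left cmp_minus_right)
  ultimately obtain N r t where N: "N \<in> ob C" "r \<in> mor C P N" "t \<in> mor C N P"
    and rt: "cmp C N P N r t = idm C N" and tr: "cmp C P N P t r = e"
    using split P(1) unfolding idempotents_split_def by blast
  have "r = cmp C P P N r e"
    unfolding tr[symmetric] using * N cmp_eq_tail1[OF rt, of P r] by simp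
  then have "cmp C Z P N r v = cmp C Z P N (cmp C P P N r e) v" by simp
  also have "\<dots> = \<zero>\<^bsub>homs C Z N\<^esub>"
    using * s N by (simp add: e_def cmp_minus_left cmp_minus_right)
  finally have rv: "cmp C Z P N r v = \<zero>\<^bsub>homs C Z N\<^esub>" .
  have "is_cokernel C X Y i N (cmp C Y P N r u)"
    unfolding is_cokernel_def
  proof (intro conjI ballI impI)
    show "cmp C X Y N (cmp C Y P N r u) i = \<zero>\<^bsub>homs C X N\<^esub>"
      using * N sq cmp_eq_tail1[OF rv, of X ?j] by simp
    fix W h assume h: "W \<in> ob C" "h \<in> mor C Y W" "cmp C X Y W h i = \<zero>\<^bsub>homs C X W\<^esub>"
    \<comment> \<open>A map \<open>h\<close> that kills \<open>i\<close> is paired with zero; the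
      induced \<open>w\<close> kills \<open>v\<close>, so \<open>w e = w\<close> and
      \<open>w\<close> factors through \<open>r\<close>.\<close>
    obtain w where w: "w \<in> mor C P W" "cmp C Y P W w u = h" "cmp C Z P W w v = \<zero>\<^bsub>homs C Z W\<^esub>"
      using uniq[of W h "\<zero>\<^bsub>homs C Z W\<^esub>"] * h by auto
    show "\<exists>!k. k \<in> mor C N W \<and> cmp C Y N W k (cmp C Y P N r u) = h"
    proof (rule ex1I[of _ "cmp C N P W w t"], intro conjI)
      show "cmp C N P W w t \<in> mor C N W" using h(1) w(1) P N by simp
      have "cmp C P P W w e = w"
        using * s(1) h(1) w cmp_eq_tail1[OF w(3), of P s] by (simp add: e_def cmp_minus_right)
      then have "cmp C P N W (cmp C N P W w t) r = w"
        using h(1) w(1) * N tr by simp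
      then show "cmp C Y N W (cmp C N P W w t) (cmp C Y P N r u) = h"
        using h(1) w(1,2) * N cmp_assoc[of Y P N W u r "cmp C N P W w t"] by simp
    next
      fix k assume k: "k \<in> mor C N W \<and> cmp C Y N W k (cmp C Y P N r u) = h"
      then have "cmp C Y P W (cmp C P N W k r) u = h" "cmp C Z P W (cmp C P N W k r) v = \<zero>\<^bsub>homs C Z W\<^esub>"
        using h(1) * N rv by simp_all
      then have "cmp C P N W k r = w"
        using uniq[of W h "\<zero>\<^bsub>homs C Z W\<^esub>"] * h w k N
        by (metis cmp_mor cmp_zero_left zero_mor)
      then show "k = cmp C N P W w t"
        using h(1) * N k rt by auto
    qed
  qed (use * N in simp_all)
  then show ?thesis using mono_cancel Z f adm by blast
qed

section \<open>Admissible maps and the exact structure of \<open>CG\<close>\<close>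

context category_action
begin

lemma equivariant_ses_iff:
  "((X, \<psi>), i, (Y, \<chi>), p, (Z, \<zeta>)) \<in> equivariant_ses C G A E \<longleftrightarrow>
    (X, \<psi>) \<in> equivariant_objects C G A \<and> (Y, \<chi>) \<in> equivariant_objects C G A \<and>
    (Z, \<zeta>) \<in> equivariant_objects C G A \<and> i \<in> equivariant_mor C G A (X, \<psi>) (Y, \<chi>) \<and>
    p \<in> equivariant_mor C G A (Y, \<chi>) (Z, \<zeta>) \<and> (X, i, Y, p, Z) \<in> E"
  by (simp add: equivariant_ses_def)

text \<open>The kernel occurring in an admissible sequence of \<open>C\<close> inherits a structure,
  which lifts the sequence. Axioms on admissible epimorphisms thereby reduce to those of
  \<open>C\<close>.\<close>

lemma admissible_epi_CG_iff:
  assumes "exact_category K C E"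
  shows "admissible_epi (equivariant_ses C G A E) (Y, \<chi>) (Z, \<zeta>) p \<longleftrightarrow>
    (Y, \<chi>) \<in> equivariant_objects C G A \<and> (Z, \<zeta>) \<in> equivariant_objects C G A \<and>
    p \<in> equivariant_mor C G A (Y, \<chi>) (Z, \<zeta>) \<and> admissible_epi E Y Z p"
    (is "?lhs \<longleftrightarrow> ?rhs")
proof
  show "?lhs \<Longrightarrow> ?rhs" by (auto simp: admissible_epi_def equivariant_ses_iff)
  assume r: ?rhs
  interpret exact_category K C E by fact
  obtain X i where E: "(X, i, Y, p, Z) \<in> E" using r by (auto simp: admissible_epi_def)
  then show ?lhs
    using r kernel_structure[of Y \<chi> Z \<zeta> p X i] ses_kernel[OF E]
    unfolding admissible_epi_def by (auto simp: equivariant_ses_iff)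
qed

text \<open>Dually, the cokernel in the admissible sequence inherits a structure.\<close>

lemma admissible_mono_CG_iff:
  assumes "exact_category K C E"
  shows "admissible_mono (equivariant_ses C G A E) (X, \<psi>) (Y, \<chi>) i \<longleftrightarrow>
    (X, \<psi>) \<in> equivariant_objects C G A \<and> (Y, \<chi>) \<in> equivariant_objects C G A \<and>
    i \<in> equivariant_mor C G A (X, \<psi>) (Y, \<chi>) \<and> admissible_mono E X Y i"
    (is "?lhs \<longleftrightarrow> ?rhs")
proof
  show "?lhs \<Longrightarrow> ?rhs" by (auto simp: admissible_mono_def equivariant_ses_iff)
  assume r: ?rhs
  interpret exact_category K C E by fact
  obtain p Z where E: "(X, i, Y, p, Z) \<in> E" using r by (auto simp: admissible_mono_def)
  then show ?lhs
    using r cokernel_structure[of X \<psi> Y \<chi> i Z p] ses_cokernel[OF E]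
    unfolding admissible_mono_def by (auto simp: equivariant_ses_iff)
qed

lemma is_iso_if_is_iso_CG: "is_iso CG (X, \<psi>) (Y, \<chi>) f \<Longrightarrow> is_iso C X Y f"
  unfolding is_iso_def equivariant_category_simps fst_conv using equivariant_morD(1) by blast

lemma is_biproduct_if_is_biproduct_CG:
  "is_biproduct CG (X, \<psi>) (Y, \<chi>) (P, \<phi>) i j p q \<Longrightarrow> is_biproduct C X Y P i j p q"
  unfolding is_biproduct_def equivariant_category_simps fst_conv
  using equivariant_morD(1) equivariant_objectD(1) by blast

theorem exact_CG:
  assumes exact: "exact_category K C E" and split: "idempotents_split C"
  shows "exact_category K CG (equivariant_ses C G A E)"
proof -
  interpret exact_category K C E by fact
  note epi_iff = admissible_epi_CG_iff[OF exact] and mono_iff = admissible_mono_CG_iff[OF exact]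
  let ?E = "equivariant_ses C G A E"
  show ?thesis
  proof (rule exact_category.intro[OF k_category_CG[OF k_category_axioms]],
      rule exact_category_axioms.intro, unfold equivariant_category_simps split_paired_all fst_conv)
    fix X \<psi> i Y \<chi> p Z \<zeta>
    assume "((X, \<psi>), i, (Y, \<chi>), p, (Z, \<zeta>)) \<in> ?E"
    note s = this[unfolded equivariant_ses_iff]
    show "is_kernel CG (Y, \<chi>) (Z, \<zeta>) p (X, \<psi>) i"
      using s ses_kernel by (intro kernel_CG) blast+
    show "is_cokernel CG (X, \<psi>) (Y, \<chi>) i (Z, \<zeta>) p"
      using s ses_cokernel by (intro cokernel_CG) blast+
    fix X' \<psi>' Y' \<chi>' Z' \<zeta>' i' p' a b c
    assume "(X', \<psi>') \<in> equivariant_objects C G A" "(Y', \<chi>') \<in> equivariant_objects C G A"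
      "(Z', \<zeta>') \<in> equivariant_objects C G A" "i' \<in> equivariant_mor C G A (X', \<psi>') (Y', \<chi>')"
      "p' \<in> equivariant_mor C G A (Y', \<chi>') (Z', \<zeta>')"
      "is_iso CG (X, \<psi>) (X', \<psi>') a" "is_iso CG (Y, \<chi>) (Y', \<chi>') b" "is_iso CG (Z, \<zeta>) (Z', \<zeta>') c"
      "cmp C X Y Y' b i = cmp C X X' Y' i' a" "cmp C Y Z Z' c p = cmp C Y Y' Z' p' b"
    then show "((X', \<psi>'), i', (Y', \<chi>'), p', (Z', \<zeta>')) \<in> ?E"
      using s ses_iso[of X i Y p Z X' Y' Z' i' p' a b c] equivariant_objectD(1) equivariant_morD(1)
        is_iso_if_is_iso_CG unfolding equivariant_ses_iff by blast
  next
    fix X \<psi> Z \<zeta> Y \<chi> i j q p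
    assume b: "is_biproduct CG (X, \<psi>) (Z, \<zeta>) (Y, \<chi>) i j q p"
    then have "(X, i, Y, p, Z) \<in> E"
      by (intro ses_split is_biproduct_if_is_biproduct_CG)
    then show "((X, \<psi>), i, (Y, \<chi>), p, (Z, \<zeta>)) \<in> ?E"
      using b by (simp add: is_biproduct_def equivariant_ses_iff)
  next
    fix X \<psi> Y \<chi> p Z \<zeta> q
    assume "admissible_epi ?E (X, \<psi>) (Y, \<chi>) p" "admissible_epi ?E (Y, \<chi>) (Z, \<zeta>) q"
    then show "admissible_epi ?E (X, \<psi>) (Z, \<zeta>) (cmp C X Y Z q p)"
      unfolding epi_iff using epi_cmp cmp_equivariant by blast
  next
    fix Y \<chi> Z \<zeta> p X \<psi> f
    assume p: "admissible_epi ?E (Y, \<chi>) (Z, \<zeta>) p" and X: "(X, \<psi>) \<in> equivariant_objects C G A"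
      and f: "f \<in> equivariant_mor C G A (X, \<psi>) (Z, \<zeta>)"
    note p = p[unfolded epi_iff]
    obtain P u v where pb: "is_pullback C X Y Z f p P u v" "admissible_epi E P X u"
      using epi_base_change p equivariant_objectD(1)[OF X] equivariant_morD(1)[OF f] by blast
    obtain \<phi> where pbG: "is_pullback CG (X, \<psi>) (Y, \<chi>) (Z, \<zeta>) f p (P, \<phi>) u v"
      using pullback_structure[OF X _ _ f _ pb(1)] p by blast
    then have "(P, \<phi>) \<in> equivariant_objects C G A" "u \<in> equivariant_mor C G A (P, \<phi>) (X, \<psi>)"
      by (simp_all add: is_pullback_def)
    then have "admissible_epi ?E (P, \<phi>) (X, \<psi>) u" using pb(2) X by (simp add: epi_iff)
    with pbG show "\<exists>P u v. is_pullback CG (X, \<psi>) (Y, \<chi>) (Z, \<zeta>) f p P u v \<and> admissible_epi ?E P (X, \<psi>) u"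
      by blast
  next
    fix X \<psi> Y \<chi> i Z \<zeta> j
    assume "admissible_mono ?E (X, \<psi>) (Y, \<chi>) i" "admissible_mono ?E (Y, \<chi>) (Z, \<zeta>) j"
    then show "admissible_mono ?E (X, \<psi>) (Z, \<zeta>) (cmp C X Y Z j i)"
      unfolding mono_iff using mono_cmp cmp_equivariant by blast
  next
    fix Z \<zeta> Y \<chi> i X \<psi> f
    assume i: "admissible_mono ?E (Z, \<zeta>) (Y, \<chi>) i" and X: "(X, \<psi>) \<in> equivariant_objects C G A"
      and f: "f \<in> equivariant_mor C G A (Z, \<zeta>) (X, \<psi>)"
    note i = i[unfolded mono_iff]
    obtain P u v where po: "is_pushout C X Y Z f i P u v" "admissible_mono E X P u"
      using mono_cobase_change i equivariant_objectD(1)[OF X] equivariant_morD(1)[OF f] by blast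
    obtain \<phi> where poG: "is_pushout CG (X, \<psi>) (Y, \<chi>) (Z, \<zeta>) f i (P, \<phi>) u v"
      using pushout_structure[OF X _ _ f _ po(1)] i by blast
    then have "(P, \<phi>) \<in> equivariant_objects C G A" "u \<in> equivariant_mor C G A (X, \<psi>) (P, \<phi>)"
      by (simp_all add: is_pushout_def)
    then have "admissible_mono ?E (X, \<psi>) (P, \<phi>) u" using po(2) X by (simp add: mono_iff)
    with poG show "\<exists>P u v. is_pushout CG (X, \<psi>) (Y, \<chi>) (Z, \<zeta>) f i P u v \<and> admissible_mono ?E (X, \<psi>) P u"
      by blast
  next
    fix Y \<chi> Z \<zeta> p N \<nu> n X \<psi> f
    assume "is_kernel CG (Y, \<chi>) (Z, \<zeta>) p (N, \<nu>) n"
    then have *: "(Y, \<chi>) \<in> equivariant_objects C G A" "(Z, \<zeta>) \<in> equivariant_objects C G A"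
      "p \<in> equivariant_mor C G A (Y, \<chi>) (Z, \<zeta>)"
      by (simp_all add: is_kernel_def)
    assume "f \<in> equivariant_mor C G A (X, \<psi>) (Y, \<chi>)"
      "admissible_epi ?E (X, \<psi>) (Z, \<zeta>) (cmp C X Y Z p f)"
    \<comment> \<open>The given kernel is tested against equivariant objects only, so a kernel of
      \<open>p\<close> in \<open>C\<close> is produced by splitting an idempotent in
      \<open>epi_cancel_if_idempotents_split\<close>.\<close>
    with * show "admissible_epi ?E (Y, \<chi>) (Z, \<zeta>) p"
      unfolding epi_iff
      using epi_cancel_if_idempotents_split[OF split] equivariant_objectD(1) equivariant_morD(1) by blast
  next
    fix X \<psi> Y \<chi> i Q \<kappa> q Z \<zeta> f
    assume "is_cokernel CG (X, \<psi>) (Y, \<chi>) i (Q, \<kappa>) q"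
    then have *: "(X, \<psi>) \<in> equivariant_objects C G A" "(Y, \<chi>) \<in> equivariant_objects C G A"
      "i \<in> equivariant_mor C G A (X, \<psi>) (Y, \<chi>)"
      by (simp_all add: is_cokernel_def)
    assume "f \<in> equivariant_mor C G A (Y, \<chi>) (Z, \<zeta>)"
      "admissible_mono ?E (X, \<psi>) (Z, \<zeta>) (cmp C X Y Z f i)"
    with * show "admissible_mono ?E (X, \<psi>) (Y, \<chi>) i"
      unfolding mono_iff
      using mono_cancel_if_idempotents_split[OF split] equivariant_objectD(1) equivariant_morD(1) by blast
  qed
qed

end

theorem lemma2p8:
  fixes K :: "('k, 'r) ring_scheme"
    and C :: "('o, 'm, 'k) klin_cat"
    and \<Gamma> :: "('g, 's) monoid_scheme"
    and A :: "('g, 'o, 'm) cat_action"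
  assumes "field K"
    and "k_category K C" and "hom_finite K C" and "krull_schmidt C"
    and "group \<Gamma>" and "finite (carrier \<Gamma>)" and "\<not> ring_char K dvd order \<Gamma>"
    and "category_action K C \<Gamma> A"
  shows "(k_category K (equivariant_category C \<Gamma> A) \<and>
          hom_finite K (equivariant_category C \<Gamma> A) \<and>
          krull_schmidt (equivariant_category C \<Gamma> A)) \<and>
         (abelian_category K C \<longrightarrow> abelian_category K (equivariant_category C \<Gamma> A)) \<and>
         (\<forall>E. exact_category K C E \<and>
              (\<forall>g \<in> carrier \<Gamma>. exact_functor E E (tens_ob A g) (tens_mor A g)) \<longrightarrow>
              exact_category K (equivariant_category C \<Gamma> A) (equivariant_ses C \<Gamma> A E))"
proof -
  interpret category_action K C \<Gamma> A by fact
  \<comment> \<open>Splitting of idempotents passes from \<open>C\<close> to \<open>CG\<close>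
    directly and also drives the cancellation axioms; locality in \<open>CG\<close> is derived
    afresh from finite dimension.\<close>
  have split: "idempotents_split C" using assms(4) by (simp add: krull_schmidt_def)
  have fin: "hom_finite K CG" using assms(3) by (rule hom_finite_CG)
  then have "krull_schmidt CG"
    using k_linear_category.krull_schmidtI[OF k_linear_CG] idempotents_split_CG[OF split] by blast
  then show ?thesis
    using k_category_CG[OF assms(2)] fin abelian_CG exact_CG[OF _ split] by blast
qed

end
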